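(* Let $(\Omega,\Sigma,P)$ be a probability space and $N=\{N_t\}_{t\in\mathbb{R}_+}$ a counting process on it with interarrival process $\{W_n\}_{n\in\mathbb{N}}$. For a real-valued random variable $\check\Theta$ on $\Omega$ consider the statements: (i) $N$ has the multinomial property; (ii) $N$ has the Markov property; (iii) $N$ is a $P$-MPP$(\check\Theta)$. Then (iii)$\Rightarrow$(i)$\Rightarrow$(ii). Moreover, let $\Theta:\Omega\to\mathbb{R}^d$ be a random vector, suppose that $N$ is a $P$-MRP$(\mathbf{K}(\Theta))$, and let $\{P_\theta\}_{\theta\in\mathbb{R}^d}$ be a disintegration of $P$ over $P_\Theta$ consistent with $\Theta$, with $(P_\theta)_{W_n}=\mathbf{K}(\theta)$ for all $n\in\mathbb{N}$ and $\theta\in\mathbb{R}^d$. Put $F_\theta(t):=P_\theta(\{W_n\le t\})$ for $t\ge0$ (this does not depend on $n$), and assume that there exist a $P_\Theta$-null Borel set $L\subseteq\mathbb{R}^d$ and a function $C\in\mathcal{L}^1(P_\Theta)$ such that for every $\theta\notin L$ the function $F_\theta$ is continuously differentiable on $(0,\infty)$ with $0<F_\theta'(t)<C(\theta)$ for each $t>0$, and such that the function $p_d:\mathbb{R}^d\setminus L\to\mathbb{R}$, $p_d(\theta):=\lim_{t\to0}F'_\theta(t)$, is (well defined,) positive and injective. Put $\check\Theta(\omega):=p_d(\Theta(\omega))$ for $\omega\in\Theta^{-1}(L^c)$ and denote again by $\check\Theta$ any measurable extension of this function from $\Theta^{-1}(L^c)$ to $\Omega$. Then (i), (ii) and (iii)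 (with this $\check\Theta$) are all equivalent.
   Context: Notation: $\mathfrak{B}(E)$ is the Borel $\sigma$-algebra of $E$; $P_X$ is the law of $X$ under $P$, and $(P_\theta)_X$ the law of $X$ under $P_\theta$; $\mathcal{L}^1(Q)$ is the set of real-valued $Q$-integrable functions; $\sigma(\Theta)$ is the $\sigma$-algebra generated by $\Theta$. Disintegration: a family $\{P_\theta\}_{\theta\in\mathbb{R}^d}$ of probability measures on $\Sigma$ is a disintegration of $P$ over $P_\Theta$ if $\theta\mapsto P_\theta(A)$ is Borel measurable and $\int P_\theta(A)\,P_\Theta(d\theta)=P(A)$ for every $A\in\Sigma$. It is consistent with $\Theta$ if for each Borel $B\subseteq\mathbb{R}^d$ one has $P_\theta(\Theta^{-1}(B))=1$ for $P_\Theta$-almost every $\theta\in B$. Counting process: a family $N=\{N_t\}_{t\ge0}$ of random variables with values in $\mathbb{N}_0\cup\{\infty\}$ whose paths are right-continuous, have jumps of size at most one, vanish at $t=0$ and increase to infinity (these path properties are assumed to hold for every $\omega\in\Omega$). Arrival process: $T_0:=0$, $T_n:=\inf\{t\ge0:N_t=n\}$. Interarrival process: $W_n:=T_n-T_{n-1}$, $n\in\mathbb{N}$. Conditional distribution of a real random variable $X$ over $\Theta$: a map $P_{X|\Theta}:\mathfrak{B}(\mathbb{R})\times\Omega\to[0,1]$ such that $P_{X|\Theta}(\cdot,\omega)$ is a probability measure for each $\omega$, and for each $B$, $P_{X|\Theta}(B,\cdot)$ is $\sigma(\Theta)$-measurable and a version of $P(X^{-1}(B)\mid\sigma(\Theta))$.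 $\mathbf{K}$ denotes a family of probability measures $\mathbf{K}(\theta)$, $\theta\in\mathbb{R}^d$, on $\mathfrak{B}(\mathbb{R})$ with $\theta\mapsto\mathbf{K}(\theta)(B)$ Borel measurable for each $B$; $\mathbf{K}(\Theta)$ is the map $(B,\omega)\mapsto\mathbf{K}(\Theta(\omega))(B)$. $N$ is a mixed renewal process with mixing parameter $\Theta$, written $P$-MRP$(\mathbf{K}(\Theta))$, if $\{W_n\}_{n\in\mathbb{N}}$ is $P$-conditionally independent given $\sigma(\Theta)$ and for every $n$, $P_{W_n|\Theta}=\mathbf{K}(\Theta)$ $P\upharpoonright\sigma(\Theta)$-a.s. (equality of measures on $\mathfrak{B}(\mathbb{R})$ for all $\omega$ off a $P$-null set in $\sigma(\Theta)$). Mixed Poisson process: for a real random variable $\Psi$ with $P(\Psi\in(0,\infty))=1$, $N$ is a $P$-MPP$(\Psi)$ if $N$ has $P$-conditionally independent increments given $\Psi$ and, for all $t\ge0$, $s>0$, the conditional distribution of $N_{t+s}-N_t$ over $\Psi$ is a.s. the Poisson distribution with parameter $s\Psi$. Markov property (w.r.t. $P$): $P(N_{t_{m+1}}=n_{m+1}\mid\bigcap_{j=1}^m\{N_{t_j}=n_j\})=P(N_{t_{m+1}}=n_{m+1}\mid N_{t_m}=n_m)$ for all $m\in\mathbb{N}$, $0<t_1<\dots<t_{m+1}$ and $n_1,\dots,n_{m+1}\in\mathbb{N}_0$ with $P(\bigcap_{j=1}^m\{N_{t_j}=n_j\})>0$. Multinomial property (w.r.t. $P$): for all $m\in\mathbb{N}$,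 $0=t_0<t_1<\dots<t_m$ and $k_1,\dots,k_m\in\mathbb{N}_0$ with $n:=\sum_{j=1}^m k_j$, $P(\bigcap_{j=1}^m\{N_{t_j}-N_{t_{j-1}}=k_j\})=\frac{n!}{\prod_{j=1}^m k_j!}\prod_{j=1}^m\bigl(\frac{t_j-t_{j-1}}{t_m}\bigr)^{k_j}P(N_{t_m}=n)$. *)

theory Defs
  imports "HOL-Probability.Probability"
begin

section \<open>Conditioning on a sub-sigma-algebra\<close>

abbreviation generated_sigma ::
    "'a measure \<Rightarrow> ('a \<Rightarrow> 'b::topological_space) \<Rightarrow> 'a measure" where
  "generated_sigma M X \<equiv> vimage_algebra (space M) X borel"

abbreviation cond_prob_of :: "'a measure \<Rightarrow> 'a measure \<Rightarrow> 'a set \<Rightarrow> 'a \<Rightarrow> real" where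
  "cond_prob_of M G A \<equiv> real_cond_exp M G (indicat_real A)"

definition cond_indep_vars ::
    "'a measure \<Rightarrow> 'a measure \<Rightarrow> ('i \<Rightarrow> 'b measure) \<Rightarrow> ('i \<Rightarrow> 'a \<Rightarrow> 'b) \<Rightarrow> 'i set \<Rightarrow> bool" where
  "cond_indep_vars M G S X I \<longleftrightarrow>
     (\<forall>i\<in>I. X i \<in> M \<rightarrow>\<^sub>M S i) \<and>
     (\<forall>J\<subseteq>I. J \<noteq> {} \<longrightarrow> finite J \<longrightarrow> (\<forall>B. (\<forall>j\<in>J. B j \<in> sets (S j)) \<longrightarrow>
        (AE \<omega> in M. cond_prob_of M G (\<Inter>j\<in>J. X j -` B j \<inter> space M) \<omega> =
                     (\<Prod>j\<in>J. cond_prob_of M G (X j -` B j \<inter> space M) \<omega>))))"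

text \<open>
  \<open>\<kappa>\<close> is a regular version of the conditional distribution given \<open>G\<close> of the
  \<open>S\<close>-valued random variable \<open>X\<close>.
\<close>

definition cond_distribution ::
    "'a measure \<Rightarrow> 'a measure \<Rightarrow> 'b measure \<Rightarrow> ('a \<Rightarrow> 'b) \<Rightarrow> ('a \<Rightarrow> 'b measure) \<Rightarrow> bool" where
  "cond_distribution M G S X \<kappa> \<longleftrightarrow>
     (\<forall>\<omega>\<in>space M. prob_space (\<kappa> \<omega>) \<and> sets (\<kappa> \<omega>) = sets S) \<and>
     (\<forall>B\<in>sets S.
        (\<lambda>\<omega>. measure (\<kappa> \<omega>) B) \<in> borel_measurable G \<and>
        (AE \<omega> in M. measure (\<kappa> \<omega>) B = cond_prob_of M G (X -` B \<inter> space M) \<omega>))"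

section \<open>Disintegrations\<close>

definition disintegration ::
    "'a measure \<Rightarrow> ('a \<Rightarrow> 'b::topological_space) \<Rightarrow> ('b \<Rightarrow> 'a measure) \<Rightarrow> bool" where
  "disintegration M \<Theta> D \<longleftrightarrow>
     (\<forall>\<theta>. prob_space (D \<theta>) \<and> sets (D \<theta>) = sets M) \<and>
     (\<forall>A\<in>sets M.
        (\<lambda>\<theta>. measure (D \<theta>) A) \<in> borel_measurable borel \<and>
        (\<integral>\<theta>. measure (D \<theta>) A \<partial>distr M borel \<Theta>) = measure M A)"

definition consistent_with ::
    "'a measure \<Rightarrow> ('a \<Rightarrow> 'b::topological_space) \<Rightarrow> ('b \<Rightarrow> 'a measure) \<Rightarrow> bool" where
  "consistent_with M \<Theta> D \<longleftrightarrow>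
     (\<forall>B\<in>sets borel. AE \<theta> in distr M borel \<Theta>.
        \<theta> \<in> B \<longrightarrow> measure (D \<theta>) (\<Theta> -` B \<inter> space M) = 1)"

section \<open>Counting processes\<close>

text \<open>
  Only \<open>N t\<close> for \<open>t \<ge> 0\<close> is meaningful. As the paths are increasing, the supremum below is
  the left limit at \<open>t\<close>; written as a sum, the bound on the jump also makes sense when the
  left limit is \<open>\<infinity>\<close>.
\<close>

definition counting_process :: "'a measure \<Rightarrow> (real \<Rightarrow> 'a \<Rightarrow> enat) \<Rightarrow> bool" where
  "counting_process M N \<longleftrightarrow>
     (\<forall>t\<ge>0. N t \<in> M \<rightarrow>\<^sub>M count_space UNIV) \<and>
     (\<forall>\<omega>\<in>space M.
        N 0 \<omega> = 0 \<and>
        mono_on {0..} (\<lambda>t. N t \<omega>) \<and>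
        ((\<lambda>t. N t \<omega>) \<longlongrightarrow> \<infinity>) at_top \<and>
        (\<forall>t\<ge>0. continuous (at_right t) (\<lambda>s. N s \<omega>)) \<and>
        (\<forall>t>0. N t \<omega> \<le> (SUP s\<in>{0..<t}. N s \<omega>) + 1))"

definition arrival :: "(real \<Rightarrow> 'a \<Rightarrow> enat) \<Rightarrow> nat \<Rightarrow> 'a \<Rightarrow> real" where
  "arrival N n \<omega> = (if n = 0 then 0 else Inf {t. 0 \<le> t \<and> N t \<omega> = enat n})"

text \<open>The interarrival process is indexed by \<open>n \<ge> 1\<close>.\<close>

definition interarrival :: "(real \<Rightarrow> 'a \<Rightarrow> enat) \<Rightarrow> nat \<Rightarrow> 'a \<Rightarrow> real" where
  "interarrival N n \<omega> = arrival N n \<omega> - arrival N (n - 1) \<omega>"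

definition mixed_renewal_process ::
    "'a measure \<Rightarrow> (real \<Rightarrow> 'a \<Rightarrow> enat) \<Rightarrow> ('a \<Rightarrow> 'b::topological_space) \<Rightarrow>
     ('b \<Rightarrow> real measure) \<Rightarrow> bool" where
  "mixed_renewal_process M N \<Theta> K \<longleftrightarrow>
     cond_indep_vars M (generated_sigma M \<Theta>) (\<lambda>_. borel) (interarrival N) {1..} \<and>
     (\<forall>n\<ge>1. \<exists>\<kappa>. cond_distribution M (generated_sigma M \<Theta>) borel (interarrival N n) \<kappa> \<and>
        (AE \<omega> in restr_to_subalg M (generated_sigma M \<Theta>). \<kappa> \<omega> = K (\<Theta> \<omega>)))"

text \<open>
  Increments are differences in \<^typ>\<open>enat\<close>, where \<open>\<infinity> - \<infinity> = \<infinity>\<close>. This convention is immaterial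
  below: a mixed Poisson process is almost surely finite at each time, and in the multinomial
  property all increments, starting from \<open>N 0 = 0\<close>, are prescribed to be finite.
\<close>

definition cond_indep_increments ::
    "'a measure \<Rightarrow> (real \<Rightarrow> 'a \<Rightarrow> enat) \<Rightarrow> ('a \<Rightarrow> 'b::topological_space) \<Rightarrow> bool" where
  "cond_indep_increments M N \<Psi> \<longleftrightarrow>
     (\<forall>(m::nat) (t::nat \<Rightarrow> real). 1 \<le> m \<longrightarrow> t 0 = 0 \<longrightarrow> strict_mono_on {0..m} t \<longrightarrow>
        cond_indep_vars M (generated_sigma M \<Psi>) (\<lambda>_. count_space UNIV)
          (\<lambda>j \<omega>. N (t j) \<omega> - N (t (j - 1)) \<omega>) {1..m})"

definition mixed_poisson_process ::
    "'a measure \<Rightarrow> (real \<Rightarrow> 'a \<Rightarrow> enat) \<Rightarrow> ('a \<Rightarrow> real) \<Rightarrow> bool" where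
  "mixed_poisson_process M N \<Psi> \<longleftrightarrow>
     \<Psi> \<in> borel_measurable M \<and>
     measure M {\<omega>\<in>space M. 0 < \<Psi> \<omega>} = 1 \<and>
     cond_indep_increments M N \<Psi> \<and>
     (\<forall>t\<ge>0. \<forall>s>0. \<exists>\<kappa>.
        cond_distribution M (generated_sigma M \<Psi>) (count_space UNIV)
          (\<lambda>\<omega>. N (t + s) \<omega> - N t \<omega>) \<kappa> \<and>
        (AE \<omega> in restr_to_subalg M (generated_sigma M \<Psi>).
           \<kappa> \<omega> = measure_pmf (map_pmf enat (poisson_pmf (s * \<Psi> \<omega>)))))"

definition markov_property :: "'a measure \<Rightarrow> (real \<Rightarrow> 'a \<Rightarrow> enat) \<Rightarrow> bool" where
  "markov_property M N \<longleftrightarrow>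
     (\<forall>(m::nat) (t::nat \<Rightarrow> real) (n::nat \<Rightarrow> nat).
        1 \<le> m \<longrightarrow> 0 < t 1 \<longrightarrow> strict_mono_on {1..m+1} t \<longrightarrow>
        \<P>(\<omega> in M. \<forall>j\<in>{1..m}. N (t j) \<omega> = enat (n j)) > 0 \<longrightarrow>
        \<P>(\<omega> in M. N (t (m+1)) \<omega> = enat (n (m+1)) \<bar> \<forall>j\<in>{1..m}. N (t j) \<omega> = enat (n j)) =
        \<P>(\<omega> in M. N (t (m+1)) \<omega> = enat (n (m+1)) \<bar> N (t m) \<omega> = enat (n m)))"

definition multinomial_property :: "'a measure \<Rightarrow> (real \<Rightarrow> 'a \<Rightarrow> enat) \<Rightarrow> bool" where
  "multinomial_property M N \<longleftrightarrow>
     (\<forall>(m::nat) (t::nat \<Rightarrow> real) (k::nat \<Rightarrow> nat).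
        1 \<le> m \<longrightarrow> t 0 = 0 \<longrightarrow> strict_mono_on {0..m} t \<longrightarrow>
        (let n = (\<Sum>j=1..m. k j) in
         \<P>(\<omega> in M. \<forall>j\<in>{1..m}. N (t j) \<omega> - N (t (j - 1)) \<omega> = enat (k j)) =
         fact n / (\<Prod>j=1..m. fact (k j)) *
         (\<Prod>j=1..m. ((t j - t (j - 1)) / t m) ^ k j) *
         \<P>(\<omega> in M. N (t m) \<omega> = enat n)))"

end

theory Submission imports Defs begin

text \<open>
  The implications from (iii) to (i) to (ii) are computations with Poisson and multinomial weights.
  For the converse, the process is described by the stream of its interarrival times, whose
  conditional law given \<open>\<Theta> = \<theta>\<close> is the product measure of \<open>K \<theta>\<close>. By the Markov property, given
  \<open>N t = 1\<close> the position of the first jump is independent of \<open>N s\<close> (\<open>s \<ge> t\<close>) together with \<open>W 3\<close>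
  and \<open>W 4\<close>. Since \<open>(W 3, W 4)\<close> is a conditionally independent copy of \<open>(W 1, W 2)\<close>, an
  orthogonality argument turns this into an identity for almost every single \<open>\<theta>\<close>: on \<open>{0..t}\<close>
  the measures \<open>S(s - x) K \<theta> (dx)\<close>, where \<open>S\<close> is the survival function of \<open>K \<theta>\<close>, are proportional
  for all \<open>s \<ge> t\<close>. Hence \<open>S\<close> is multiplicative, so \<open>K \<theta>\<close> is the exponential law with rate
  \<open>- S'(0) = p \<theta>\<close>, and lack of memory yields independent Poisson increments.
\<close>

text \<open>The obstacle is that the Markov property only controls integrals over \<Theta>, while
  the conclusion concerns single values \<theta>. A relation between two functions of \<theta> can
  be localized if it holds against sufficiently many weights. The events of the future provide them:
  given \<Theta>, the gaps after the second jump are a fresh sample from \<open>K \<theta>\<close>,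
  so the mass of any window event can reappear as a weight. Two later gaps are needed because a
  window event involves two gaps: the first jump lies in (a, b] and the second comes after s.

  Proportionality says that S(s - a) / S(s' - a) does not depend on a. Comparing a = 1 with a' = v +
  1 - e at s = v + 1 + u and s' = v + 1, and letting e tend to 0, gives S(u + v) = S(u) S(v).

  Exceptional null sets can be collected only for countably many parameters. The analysis of a
  single \<open>K \<theta>\<close> therefore starts from rational windows and reaches real arguments
  by right limits. Explosion is excluded only almost surely, so events of the counting process and
  events of the gap stream are matched up to null sets.\<close>

section \<open>Product measures on streams\<close>

lemma (in prob_space) emeasure_stream_space_cylinder:
  assumes "\<And>i. A i \<in> sets M"
  shows "emeasure (stream_space M) {w\<in>space (stream_space M). \<forall>i<n. w !! i \<in> A i} =
    (\<Prod>i<n. emeasure M (A i))"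
  using assms
proof (induction n arbitrary: A)
  case 0
  interpret S: prob_space "stream_space M" by (rule prob_space_stream_space)
  show ?case by (simp add: S.emeasure_space_1)
next
  case (Suc n)
  have [measurable]: "\<And>i. A i \<in> sets M" using Suc.prems by simp
  have "emeasure (stream_space M) {w\<in>space (stream_space M). \<forall>i<Suc n. w !! i \<in> A i} =
    (\<integral>\<^sup>+t. emeasure (stream_space M) {x\<in>space (stream_space M).
       t ## x \<in> {w\<in>space (stream_space M). \<forall>i<Suc n. w !! i \<in> A i}} \<partial>M)"
    by (rule emeasure_stream_space) measurable
  also have "\<dots> = (\<integral>\<^sup>+t. indicator (A 0) t * (\<Prod>i<n. emeasure M (A (Suc i))) \<partial>M)"
  proof (rule nn_integral_cong)
    fix t assume t: "t \<in> space M"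
    have "{x\<in>space (stream_space M). t ## x \<in> {w\<in>space (stream_space M). \<forall>i<Suc n. w !! i \<in> A i}} =
      (if t \<in> A 0 then {w\<in>space (stream_space M). \<forall>i<n. w !! i \<in> A (Suc i)} else {})"
      using t by (auto simp: space_stream_space  less_Suc_eq_0_disj)
    then show "emeasure (stream_space M) {x\<in>space (stream_space M).
        t ## x \<in> {w\<in>space (stream_space M). \<forall>i<Suc n. w !! i \<in> A i}} =
      indicator (A 0) t * (\<Prod>i<n. emeasure M (A (Suc i)))"
      using Suc.IH[of "\<lambda>i. A (Suc i)"] Suc.prems by simp
  qed
  also have "\<dots> = emeasure M (A 0) * (\<Prod>i<n. emeasure M (A (Suc i)))"
    by (subst nn_integral_multc) auto
  finally show ?case by (simp only: prod.lessThan_Suc_shift)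
qed

lemma stream_space_cylinder_generator:
  fixes M :: "'a measure"
  defines "G \<equiv> {{w\<in>space (stream_space M). \<forall>i<n. w !! i \<in> A i} | n A. \<forall>i. A i \<in> sets M}"
  shows "Int_stable G" "G \<subseteq> Pow (space (stream_space M))"
    "sets (stream_space M) = sigma_sets (space (stream_space M)) G"
proof -
  show "Int_stable G"
  proof (rule Int_stableI)
    fix a b assume "a \<in> G" "b \<in> G"
    then obtain n A m B where A: "\<And>i. A i \<in> sets M" and B: "\<And>i. B i \<in> sets M"
      and a: "a = {w\<in>space (stream_space M). \<forall>i<n. w !! i \<in> A i}"
      and b: "b = {w\<in>space (stream_space M). \<forall>i<m. w !! i \<in> B i}"
      unfolding G_def by blast
    \<comment> \<open>Padding with \<open>space M\<close> brings both cylinders to the common length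
      \<open>max n m\<close>.\<close>
    let ?C = "\<lambda>i. (if i < n then A i else space M) \<inter> (if i < m then B i else space M)"
    have "a \<inter> b = {w\<in>space (stream_space M). \<forall>i<max n m. w !! i \<in> ?C i}"
    proof (intro set_eqI iffI)
      fix w assume "w \<in> a \<inter> b"
      then show "w \<in> {w\<in>space (stream_space M). \<forall>i<max n m. w !! i \<in> ?C i}"
        unfolding a b by (simp add: space_stream_space snth_in)
    next
      fix w assume w: "w \<in> {w\<in>space (stream_space M). \<forall>i<max n m. w !! i \<in> ?C i}"
      have "w !! i \<in> A i" if "i < n" for i
      proof -
        have "i < max n m" using that by simp
        then have "w !! i \<in> ?C i" using w by blast
        then show ?thesis using that by simp
      qed
      moreover have "w !! i \<in> B i" if "i < m" for i
      proof -
        have "i < max n m" using that by simp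
        then have "w !! i \<in> ?C i" using w by blast
        then show ?thesis using that by simp
      qed
      ultimately show "w \<in> a \<inter> b" using w unfolding a b by blast
    qed
    moreover have "?C i \<in> sets M" for i using A[of i] B[of i] by simp
    ultimately show "a \<inter> b \<in> G"
      unfolding G_def mem_Collect_eq by (intro exI[of _ "max n m"] exI[of _ ?C] conjI allI)
  qed
  show sub: "G \<subseteq> Pow (space (stream_space M))" unfolding G_def by auto
  have "G \<subseteq> sets (stream_space M)"
  proof
    fix a assume "a \<in> G"
    then obtain n A where [measurable]: "\<And>i. A i \<in> sets M"
      and a: "a = {w\<in>space (stream_space M). \<forall>i<n. w !! i \<in> A i}"
      unfolding G_def by blast
    show "a \<in> sets (stream_space M)" unfolding a by measurable
  qed
  then have "sigma_sets (space (stream_space M)) G \<subseteq> sets (stream_space M)"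
    by (rule sets.sigma_sets_subset)
  moreover have "sets (stream_space M) \<subseteq> sets (sigma (space (stream_space M)) G)"
  proof (rule sets_stream_space_in_sets)
    show "space (sigma (space (stream_space M)) G) = streams (space M)"
      using sub by (simp add: space_stream_space space_measure_of_conv)
    fix i
    show "(\<lambda>x. x !! i) \<in> sigma (space (stream_space M)) G \<rightarrow>\<^sub>M M"
    proof (rule measurableI)
      fix w assume "w \<in> space (sigma (space (stream_space M)) G)"
      then show "w !! i \<in> space M"
        using sub by (simp add: space_measure_of_conv space_stream_space snth_in)
    next
      fix B assume B: "B \<in> sets M"
      let ?A = "\<lambda>j. if j = i then B else space M"
      have "(\<lambda>x. x !! i) -` B \<inter> space (stream_space M) =
        {w\<in>space (stream_space M). \<forall>j<Suc i. w !! j \<in> ?A j}"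
        by (auto simp: space_stream_space snth_in)
      moreover have "\<dots> \<in> G"
        unfolding G_def mem_Collect_eq using B by (intro exI[of _ "Suc i"] exI[of _ ?A]) simp
      ultimately show "(\<lambda>x. x !! i) -` B \<inter> space (sigma (space (stream_space M)) G)
          \<in> sets (sigma (space (stream_space M)) G)"
        using sub by (simp add: space_measure_of_conv sets_measure_of_conv sigma_sets.Basic)
    qed
  qed
  ultimately show "sets (stream_space M) = sigma_sets (space (stream_space M)) G"
    using sub by auto
qed

text \<open>Cylinders form an intersection-stable generator, and on a cylinder the mass is a finite
  product of masses of \<open>K x\<close>. The result allows the product law to be mixed over the
  values of \<Theta>.\<close>

lemma measurable_stream_space_kernel:
  assumes K: "K \<in> N \<rightarrow>\<^sub>M prob_algebra S"
  shows "(\<lambda>x. stream_space (K x)) \<in> N \<rightarrow>\<^sub>M prob_algebra (stream_space S)"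
proof (rule measurable_prob_algebra_generated)
  show "sets (stream_space S) = sigma_sets (space (stream_space S))
      {{w\<in>space (stream_space S). \<forall>i<n. w !! i \<in> A i} | n A. \<forall>i. A i \<in> sets S}"
    by (rule stream_space_cylinder_generator)
  show "Int_stable {{w\<in>space (stream_space S). \<forall>i<n. w !! i \<in> A i} | n A. \<forall>i. A i \<in> sets S}"
    by (rule stream_space_cylinder_generator)
  show "{{w\<in>space (stream_space S). \<forall>i<n. w !! i \<in> A i} | n A. \<forall>i. A i \<in> sets S}
      \<subseteq> Pow (space (stream_space S))"
    by (rule stream_space_cylinder_generator)
next
  fix x assume x: "x \<in> space N"
  then have "prob_space (K x)" "sets (K x) = sets S"
    using measurable_space[OF K x] by (auto simp: space_prob_algebra)
  then show "prob_space (stream_space (K x))" "sets (stream_space (K x)) = sets (stream_space S)"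
    by (simp_all add: prob_space.prob_space_stream_space cong: sets_stream_space_cong)
next
  fix a assume "a \<in> {{w\<in>space (stream_space S). \<forall>i<n. w !! i \<in> A i} | n A. \<forall>i. A i \<in> sets S}"
  then obtain n A where A: "\<And>i. A i \<in> sets S"
    and a: "a = {w\<in>space (stream_space S). \<forall>i<n. w !! i \<in> A i}" by blast
  have "emeasure (stream_space (K x)) a = (\<Prod>i<n. emeasure (K x) (A i))" if x: "x \<in> space N" for x
  proof -
    have Kx: "prob_space (K x)" "sets (K x) = sets S"
      using measurable_space[OF K x] by (auto simp: space_prob_algebra)
    have sp: "space (stream_space (K x)) = space (stream_space S)"
      unfolding space_stream_space sets_eq_imp_space_eq[OF Kx(2)] ..
    show ?thesis
      unfolding a sp[symmetric] using A
      by (intro prob_space.emeasure_stream_space_cylinder Kx(1)) (simp only: Kx(2))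
  qed
  moreover have "(\<lambda>x. \<Prod>i<n. emeasure (K x) (A i)) \<in> borel_measurable N"
    by (intro borel_measurable_prod_ennreal measurable_emeasure_kernel[OF measurable_prob_algebraD[OF K]] A)
  ultimately show "(\<lambda>x. emeasure (stream_space (K x)) a) \<in> borel_measurable N"
    by (simp cong: measurable_cong)
qed

section \<open>Counting with exponential gaps\<close>

text \<open>Recursion on the stream, instead of a condition on partial sums, removes one gap at a
  time, just as integration over \<open>stream_space\<close> does. For positive gaps and
  \<open>0 \<le> t\<close> it means that exactly k jumps occur in {0..t}; see
  \<open>jumps_by_iff_sum\<close>.\<close>

primrec jumps_by :: "nat \<Rightarrow> real \<Rightarrow> real stream \<Rightarrow> bool" where
  "jumps_by 0 t w \<longleftrightarrow> t < shd w"
| "jumps_by (Suc k) t w \<longleftrightarrow> shd w \<le> t \<and> jumps_by k (t - shd w) (stl w)"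

text \<open>The gaps as seen from time t: the residual waiting time followed by the later gaps. This
  reading requires \<open>jumps_by k t w\<close>, which is why k is an argument.\<close>

primrec restart :: "nat \<Rightarrow> real \<Rightarrow> real stream \<Rightarrow> real stream" where
  "restart 0 t w = (shd w - t) ## stl w"
| "restart (Suc k) t w = restart k (t - shd w) (stl w)"

lemma jumps_by_unique: "jumps_by k t w \<Longrightarrow> jumps_by l t w \<Longrightarrow> k = l"
proof (induction k arbitrary: t w l)
  case 0 then show ?case by (cases l) auto
next
  case (Suc k) then show ?case by (cases l) auto
qed

text \<open>Restarting at t splits the count at t + u into the count at t and that of the restarted
  stream. Increments over adjacent intervals can thus be read off one stream after another.\<close>

lemma jumps_by_add_iff:
  assumes "0 \<le> u" "jumps_by k t w"
  shows "jumps_by n (t + u) w \<longleftrightarrow> (\<exists>l. n = k + l \<and> jumps_by l u (restart k t w))"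
  using assms(2)
proof (induction k arbitrary: t w n)
  case 0
  then show ?case
    by (cases n) (auto simp: algebra_simps)
next
  case (Suc k)
  show ?case
  proof (cases n)
    case 0
    then show ?thesis using Suc.prems assms(1) by auto
  next
    case (Suc n')
    have "jumps_by n (t + u) w \<longleftrightarrow> jumps_by n' ((t - shd w) + u) (stl w)"
      using Suc.prems assms(1) by (auto simp: Suc algebra_simps)
    then show ?thesis
      using Suc.IH[of "t - shd w" "stl w" n'] Suc.prems by (simp add: Suc)
  qed
qed

lemma measurable_jumps_by[measurable (raw)]:
  assumes "f \<in> borel_measurable M" "g \<in> M \<rightarrow>\<^sub>M stream_space borel"
  shows "Measurable.pred M (\<lambda>x. jumps_by k (f x) (g x))"
  using assms
proof (induction k arbitrary: f g)
  case 0
  note [measurable] = this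
  show ?case by simp
next
  case (Suc k)
  note [measurable] = Suc.prems Suc.IH
  show ?case by simp
qed

lemma measurable_restart[measurable (raw)]:
  assumes "f \<in> borel_measurable M" "g \<in> M \<rightarrow>\<^sub>M stream_space borel"
  shows "(\<lambda>x. restart k (f x) (g x)) \<in> M \<rightarrow>\<^sub>M stream_space borel"
  using assms
proof (induction k arbitrary: f g)
  case 0
  note [measurable] = this
  show ?case by simp
next
  case (Suc k)
  note [measurable] = Suc.prems Suc.IH
  show ?case by simp
qed

section \<open>Lack of memory and Poisson increments for exponential gaps\<close>

abbreviation exponential_law :: "real \<Rightarrow> real measure" where
  "exponential_law l \<equiv> density lborel (exponential_density l)"

abbreviation poisson_weight :: "real \<Rightarrow> nat \<Rightarrow> real" where
  "poisson_weight r k \<equiv> r ^ k / fact k * exp (- r)"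

lemma nn_integral_exponential_law_memoryless:
  assumes [measurable]: "g \<in> borel_measurable borel" and l: "0 < l" and t: "0 \<le> t"
  shows "(\<integral>\<^sup>+x. indicator {t<..} x * g (x - t) \<partial>exponential_law l) =
    ennreal (exp (- (l * t))) * (\<integral>\<^sup>+x. g x \<partial>exponential_law l)"
proof -
  have "(\<integral>\<^sup>+x. indicator {t<..} x * g (x - t) \<partial>exponential_law l) =
    (\<integral>\<^sup>+x. ennreal (exponential_density l x) * (indicator {t<..} x * g (x - t)) \<partial>lborel)"
    by (subst nn_integral_density) auto
  also have "\<dots> = (\<integral>\<^sup>+y. ennreal (exponential_density l (t + y)) * (indicator {t<..} (t + y) * g y) \<partial>lborel)"
    by (subst nn_integral_real_affine[where c=1 and t=t]) auto
  also have "\<dots> = (\<integral>\<^sup>+y. ennreal (exp (- (l * t))) * (ennreal (exponential_density l y) * g y) \<partial>lborel)"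
  proof (rule nn_integral_cong_AE)
    \<comment> \<open>At y = 0 the strict indicator vanishes although the density does not, so the
      integrands agree only off this point.\<close>
    show "AE y in lborel. ennreal (exponential_density l (t + y)) * (indicator {t<..} (t + y) * g y) =
      ennreal (exp (- (l * t))) * (ennreal (exponential_density l y) * g y)"
      using AE_lborel_singleton[of 0]
    proof eventually_elim
      case (elim y)
      show ?case
      proof (cases "y < 0")
        case True then show ?thesis by (simp add: exponential_density_def)
      next
        case False
        then have "exponential_density l (t + y) = exp (- (l * t)) * exponential_density l y"
          using t by (simp add: exponential_density_def exp_add[symmetric] algebra_simps)
        then show ?thesis
          using False elim by (simp add: ennreal_mult' mult.assoc)
      qed
    qed
  qed
  also have "\<dots> = ennreal (exp (- (l * t))) * (\<integral>\<^sup>+x. g x \<partial>exponential_law l)"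
    by (subst nn_integral_cmult) (auto simp: nn_integral_density)
  finally show ?thesis .
qed

text \<open>This is the step of conditioning on the first jump x. The two exponentials multiply to
  the constant exp(- l t), which leaves the polynomial (t - x)^k to be integrated over
  {0..t}.\<close>

lemma nn_integral_exponential_law_poisson_weight:
  assumes l: "0 < l" and t: "0 \<le> t"
  shows "(\<integral>\<^sup>+x. indicator {..t} x * ennreal (poisson_weight (l * (t - x)) k) \<partial>exponential_law l) =
    ennreal (poisson_weight (l * t) (Suc k))"
proof -
  let ?c = "l ^ Suc k * exp (- (l * t)) / fact k"
  have "(\<integral>\<^sup>+x. indicator {..t} x * ennreal (poisson_weight (l * (t - x)) k) \<partial>exponential_law l) =
    (\<integral>\<^sup>+x. ennreal (exponential_density l x) *
      (indicator {..t} x * ennreal (poisson_weight (l * (t - x)) k)) \<partial>lborel)"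
    by (subst nn_integral_density) auto
  also have "\<dots> = (\<integral>\<^sup>+x. ennreal (?c * (t - x) ^ k) * indicator {0..t} x \<partial>lborel)"
  proof (rule nn_integral_cong)
    fix x :: real
    show "ennreal (exponential_density l x) *
      (indicator {..t} x * ennreal (poisson_weight (l * (t - x)) k)) =
      ennreal (?c * (t - x) ^ k) * indicator {0..t} x"
    proof (cases "0 \<le> x \<and> x \<le> t")
      case True
      have "exp (- x * l) * exp (- (l * (t - x))) = exp (- (l * t))"
        by (simp add: exp_add[symmetric] algebra_simps)
      with True have "exponential_density l x * poisson_weight (l * (t - x)) k = ?c * (t - x) ^ k"
        by (simp add: exponential_density_def power_mult_distrib)
      then show ?thesis
        using True l by (simp add: exponential_density_nonneg ennreal_mult'[symmetric])
    qed (auto simp: exponential_density_def indicator_def)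
  qed
  also have "\<dots> = ennreal ((- ?c * (t - t) ^ Suc k / Suc k) - (- ?c * (t - 0) ^ Suc k / Suc k))"
  proof (rule nn_integral_FTC_Icc[where F="\<lambda>x. - ?c * (t - x) ^ Suc k / Suc k"])
    fix x assume x: "x \<in> {0..t}"
    have "((\<lambda>x. - ?c * (t - x) ^ Suc k / Suc k) has_real_derivative
        - ?c * (real (Suc k) * ((0 - 1) * (t - x) ^ (Suc k - Suc 0))) / Suc k) (at x)"
      by (intro DERIV_cdivide DERIV_cmult DERIV_power DERIV_diff DERIV_const DERIV_ident)
    then show "((\<lambda>x. - ?c * (t - x) ^ Suc k / Suc k) has_real_derivative ?c * (t - x) ^ k) (at x)"
      by (simp add: mult.assoc del: of_nat_Suc power_Suc)
    show "0 \<le> ?c * (t - x) ^ k" using l x by auto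
  qed (use t in auto)
  also have "(- ?c * (t - t) ^ Suc k / Suc k) - (- ?c * (t - 0) ^ Suc k / Suc k) = poisson_weight (l * t) (Suc k)"
    by (simp add: power_mult_distrib field_simps del: of_nat_Suc)
  finally show ?thesis .
qed

lemma sets_stream_space_exponential_law[measurable_cong, simp]:
  "sets (stream_space (exponential_law l)) = sets (stream_space borel)"
  by (rule sets_stream_space_cong) simp

text \<open>The count at t is Poisson, and the restarted stream is an independent copy of the
  original one. The case k = 0 is lack of memory; for \<open>Suc k\<close> the first gap x is split
  off and t shrinks to t - x. The arbitrary f allows the result to be iterated over further
  intervals.\<close>

lemma nn_integral_restart_exponential:
  assumes f[measurable]: "f \<in> borel_measurable (stream_space borel)" and l: "0 < l" and "0 \<le> t"
  shows "(\<integral>\<^sup>+w. indicator {w. jumps_by k t w} w * f (restart k t w) \<partial>stream_space (exponential_law l)) =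
    ennreal (poisson_weight (l * t) k) * (\<integral>\<^sup>+w. f w \<partial>stream_space (exponential_law l))"
  using \<open>0 \<le> t\<close>
proof (induction k arbitrary: t)
  interpret prob_space "exponential_law l" by (rule prob_space_exponential_density[OF l])
  interpret S: prob_space "stream_space (exponential_law l)" by (rule prob_space_stream_space)
  case 0
  let ?g = "\<lambda>y. \<integral>\<^sup>+W. f (y ## W) \<partial>stream_space (exponential_law l)"
  have [measurable]: "?g \<in> borel_measurable borel"
    by measurable
  have "(\<integral>\<^sup>+w. indicator {w. jumps_by 0 t w} w * f (restart 0 t w) \<partial>stream_space (exponential_law l)) =
    (\<integral>\<^sup>+x. \<integral>\<^sup>+W. indicator {w. jumps_by 0 t w} (x ## W) * f (restart 0 t (x ## W))
      \<partial>stream_space (exponential_law l) \<partial>exponential_law l)"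
    by (rule nn_integral_stream_space) measurable
  also have "\<dots> = (\<integral>\<^sup>+x. indicator {t<..} x * ?g (x - t) \<partial>exponential_law l)"
    by (intro nn_integral_cong) (auto simp: indicator_def)
  also have "\<dots> = ennreal (exp (- (l * t))) * (\<integral>\<^sup>+x. ?g x \<partial>exponential_law l)"
    using l 0 by (intro nn_integral_exponential_law_memoryless) auto
  also have "(\<integral>\<^sup>+x. ?g x \<partial>exponential_law l) = (\<integral>\<^sup>+w. f w \<partial>stream_space (exponential_law l))"
    by (rule nn_integral_stream_space[symmetric]) measurable
  finally show ?case by simp
next
  interpret prob_space "exponential_law l" by (rule prob_space_exponential_density[OF l])
  case (Suc k)
  let ?I = "\<integral>\<^sup>+w. f w \<partial>stream_space (exponential_law l)"
  have "(\<integral>\<^sup>+w. indicator {w. jumps_by (Suc k) t w} w * f (restart (Suc k) t w) \<partial>stream_space (exponential_law l)) =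
    (\<integral>\<^sup>+x. \<integral>\<^sup>+W. indicator {w. jumps_by (Suc k) t w} (x ## W) * f (restart (Suc k) t (x ## W))
      \<partial>stream_space (exponential_law l) \<partial>exponential_law l)"
    by (rule nn_integral_stream_space) measurable
  also have "\<dots> = (\<integral>\<^sup>+x. indicator {..t} x * ennreal (poisson_weight (l * (t - x)) k) * ?I \<partial>exponential_law l)"
  proof (rule nn_integral_cong)
    fix x
    show "(\<integral>\<^sup>+W. indicator {w. jumps_by (Suc k) t w} (x ## W) * f (restart (Suc k) t (x ## W))
        \<partial>stream_space (exponential_law l)) =
      indicator {..t} x * ennreal (poisson_weight (l * (t - x)) k) * ?I"
      using Suc.IH[of "t - x"] by (cases "x \<le> t") (simp_all add: indicator_def)
  qed
  also have "\<dots> = (\<integral>\<^sup>+x. indicator {..t} x * ennreal (poisson_weight (l * (t - x)) k) \<partial>exponential_law l) * ?I"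
    by (rule nn_integral_multc) simp
  finally show ?case
    by (simp only: nn_integral_exponential_law_poisson_weight[OF l Suc.prems])
qed

text \<open>An entry consists of the length of an interval and a set of admissible increments; the
  stream is restarted at the end of each interval. Only finite counts can match, so even the set
  \<open>UNIV\<close> excludes explosion.\<close>

primrec increments_in :: "(real \<times> enat set) list \<Rightarrow> real stream \<Rightarrow> bool" where
  "increments_in [] w \<longleftrightarrow> True"
| "increments_in (x # xs) w \<longleftrightarrow>
    (\<exists>k. enat k \<in> snd x \<and> jumps_by k (fst x) w \<and> increments_in xs (restart k (fst x) w))"

lemma measurable_increments_in[measurable (raw)]:
  assumes "f \<in> M \<rightarrow>\<^sub>M stream_space borel"
  shows "Measurable.pred M (\<lambda>x. increments_in xs (f x))"
  using assms
proof (induction xs arbitrary: f)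
  case (Cons x xs)
  note [measurable] = Cons.prems
  have [measurable]: "Measurable.pred M (\<lambda>w. increments_in xs (restart k (fst x) (f w)))" for k
    by (rule Cons.IH) measurable
  have "Measurable.pred M
      (\<lambda>w. \<exists>k. enat k \<in> snd x \<and> jumps_by k (fst x) (f w) \<and> increments_in xs (restart k (fst x) (f w)))"
    by (intro pred_intros_countable pred_intros_logic) measurable
  then show ?case by simp
qed simp

lemma emeasure_poisson_pmf_enat:
  assumes "0 < r"
  shows "emeasure (measure_pmf (map_pmf enat (poisson_pmf r))) B =
    (\<Sum>k. indicator B (enat k) * ennreal (poisson_weight r k))"
proof -
  have "emeasure (measure_pmf (map_pmf enat (poisson_pmf r))) B = emeasure (measure_pmf (poisson_pmf r)) (enat -` B)"
    by simp
  also have "\<dots> = (\<integral>\<^sup>+k. indicator (enat -` B) k \<partial>measure_pmf (poisson_pmf r))"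
    by simp
  also have "\<dots> = (\<integral>\<^sup>+k. indicator B (enat k) * ennreal (poisson_weight r k) \<partial>count_space UNIV)"
    using assms by (subst nn_integral_measure_pmf) (auto intro!: nn_integral_cong simp: indicator_def)
  finally show ?thesis by (simp add: nn_integral_count_space_nat)
qed

text \<open>The event is split by the number of jumps in the first interval.
  \<open>nn_integral_restart_exponential\<close>, with the indicator of the remaining requirements
  as f, then detaches one Poisson factor.\<close>

lemma emeasure_increments_in_exponential:
  assumes l: "0 < l" and "\<And>u B. (u, B) \<in> set xs \<Longrightarrow> 0 < u"
  shows "emeasure (stream_space (exponential_law l)) {w. increments_in xs w} =
    (\<Prod>(u, B)\<leftarrow>xs. emeasure (measure_pmf (map_pmf enat (poisson_pmf (l * u)))) B)"
  using assms(2)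
proof (induction xs)
  interpret prob_space "exponential_law l" by (rule prob_space_exponential_density[OF l])
  interpret S: prob_space "stream_space (exponential_law l)" by (rule prob_space_stream_space)
  case Nil
  show ?case using S.emeasure_space_1 by (simp add: space_stream_space)
next
  case (Cons x xs)
  obtain u B where x: "x = (u, B)" by (cases x)
  have u: "0 < u" using Cons.prems x by auto
  let ?S = "stream_space (exponential_law l)"
  have [simp]: "space ?S = UNIV" by (simp add: space_stream_space)
  have [measurable, simp]: "{w. increments_in ys (f w)} \<in> sets (stream_space borel)"
    if "f \<in> stream_space borel \<rightarrow>\<^sub>M stream_space borel" for f ys
    using predE[OF measurable_increments_in[OF that, of ys]] by (simp add: space_stream_space)
  have [measurable]: "(\<lambda>w. indicator {w. jumps_by k u w} w * indicator {w. increments_in xs w} (restart k u w) :: ennreal)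
      \<in> borel_measurable (stream_space borel)" for k
  proof -
    have "(\<lambda>w. indicator {w. jumps_by k u w} w * indicator {w. increments_in xs w} (restart k u w) :: ennreal) =
      (\<lambda>w. if jumps_by k u w \<and> increments_in xs (restart k u w) then 1 else 0)"
      by (auto simp: indicator_def)
    also have "\<dots> \<in> borel_measurable (stream_space borel)" by measurable
    finally show ?thesis .
  qed
  have "emeasure ?S {w. increments_in (x # xs) w} = (\<integral>\<^sup>+w. indicator {w. increments_in (x # xs) w} w \<partial>?S)"
    by (intro nn_integral_indicator[symmetric]) (simp del: increments_in.simps)
  also have "\<dots> = (\<integral>\<^sup>+w. (\<Sum>k. indicator B (enat k) * (indicator {w. jumps_by k u w} w *
      indicator {w. increments_in xs w} (restart k u w))) \<partial>?S)"
  \<comment> \<open>By uniqueness of the count at most one term of the series is nonzero.\<close>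
  proof (rule nn_integral_cong)
    fix w
    show "indicator {w. increments_in (x # xs) w} w = (\<Sum>k. indicator B (enat k) *
      (indicator {w. jumps_by k u w} w * indicator {w. increments_in xs w} (restart k u w)) :: ennreal)"
    proof (cases "\<exists>k. jumps_by k u w")
      case True
      then obtain k where k: "jumps_by k u w" by blast
      then have "jumps_by j u w \<longleftrightarrow> j = k" for j using jumps_by_unique by blast
      then show ?thesis
        by (subst suminf_finite[where N="{k}"]) (auto simp: x indicator_def)
    qed (auto simp: x indicator_def)
  qed
  also have "\<dots> = (\<Sum>k. \<integral>\<^sup>+w. indicator B (enat k) * (indicator {w. jumps_by k u w} w *
      indicator {w. increments_in xs w} (restart k u w)) \<partial>?S)"
    by (rule nn_integral_suminf) measurable
  also have "\<dots> = (\<Sum>k. indicator B (enat k) * ennreal (poisson_weight (l * u) k) *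
      emeasure ?S {w. increments_in xs w})"
  proof (rule arg_cong[where f=suminf], rule ext)
    fix k
    have "(\<integral>\<^sup>+w. indicator {w. jumps_by k u w} w * indicator {w. increments_in xs w} (restart k u w) \<partial>?S) =
      ennreal (poisson_weight (l * u) k) * (\<integral>\<^sup>+w. indicator {w. increments_in xs w} w \<partial>?S)"
      using l u by (intro nn_integral_restart_exponential) auto
    also have "(\<integral>\<^sup>+w. indicator {w. increments_in xs w} w \<partial>?S) = emeasure ?S {w. increments_in xs w}"
      by (intro nn_integral_indicator) simp
    finally show "(\<integral>\<^sup>+w. indicator B (enat k) * (indicator {w. jumps_by k u w} w *
      indicator {w. increments_in xs w} (restart k u w)) \<partial>?S) =
      indicator B (enat k) * ennreal (poisson_weight (l * u) k) * emeasure ?S {w. increments_in xs w}"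
      by (subst nn_integral_cmult) (auto simp: mult.assoc)
  qed
  also have "\<dots> = (\<Sum>k. indicator B (enat k) * ennreal (poisson_weight (l * u) k)) *
      emeasure ?S {w. increments_in xs w}"
    by (rule ennreal_suminf_multc)
  also have "(\<Sum>k. indicator B (enat k) * ennreal (poisson_weight (l * u) k)) =
      emeasure (measure_pmf (map_pmf enat (poisson_pmf (l * u)))) B"
    using l u by (intro emeasure_poisson_pmf_enat[symmetric]) auto
  finally have "emeasure ?S {w. increments_in (x # xs) w} =
      emeasure (measure_pmf (map_pmf enat (poisson_pmf (l * u)))) B * emeasure ?S {w. increments_in xs w}" .
  also have "emeasure ?S {w. increments_in xs w} =
      (\<Prod>(u, B)\<leftarrow>xs. emeasure (measure_pmf (map_pmf enat (poisson_pmf (l * u)))) B)"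
    using Cons.prems by (intro Cons.IH) auto
  finally show ?case by (simp only: x list.map prod_list.Cons prod.case)
qed

section \<open>Interarrival times of a counting process\<close>

lemma counting_processD:
  assumes "counting_process M N"
  shows "0 \<le> t \<Longrightarrow> N t \<in> M \<rightarrow>\<^sub>M count_space UNIV"
    and "\<omega> \<in> space M \<Longrightarrow> N 0 \<omega> = 0"
    and "\<omega> \<in> space M \<Longrightarrow> 0 \<le> s \<Longrightarrow> s \<le> t \<Longrightarrow> N s \<omega> \<le> N t \<omega>"
  using assms by (auto simp: counting_process_def mono_on_def)

text \<open>Jumps of size at most one force the path to take every value n, and right-continuity
  makes the infimum a minimum. The time of reaching n exactly is therefore the time of reaching at
  least n, and events on arrival times become events on counts.\<close>

lemma arrival_properties:
  assumes cp: "counting_process M N" and \<omega>: "\<omega> \<in> space M"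
  shows "0 \<le> arrival N n \<omega>" and "N (arrival N n \<omega>) \<omega> = enat n"
    and "0 \<le> t \<Longrightarrow> arrival N n \<omega> \<le> t \<longleftrightarrow> enat n \<le> N t \<omega>"
proof -
  let ?f = "\<lambda>t. N t \<omega>"
  have f0: "?f 0 = 0" and mono: "\<And>s t. 0 \<le> s \<Longrightarrow> s \<le> t \<Longrightarrow> ?f s \<le> ?f t"
    using counting_processD[OF cp] \<omega> by auto
  have lim: "(?f \<longlongrightarrow> \<infinity>) at_top"
    and rc: "\<And>t. 0 \<le> t \<Longrightarrow> (?f \<longlongrightarrow> ?f t) (at_right t)"
    and jump: "\<And>t. 0 < t \<Longrightarrow> ?f t \<le> (SUP s\<in>{0..<t}. ?f s) + 1"
    using cp \<omega> by (auto simp: counting_process_def continuous_within)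
  have "0 \<le> arrival N n \<omega> \<and> N (arrival N n \<omega>) \<omega> = enat n \<and>
    (\<forall>t\<ge>0. arrival N n \<omega> \<le> t \<longleftrightarrow> enat n \<le> N t \<omega>)"
  proof (cases n)
    case 0
    then show ?thesis using f0 by (simp add: arrival_def zero_enat_def[symmetric])
  next
    case (Suc m)
    \<comment> \<open>This level set is upward closed and nonempty since the path tends to infinity;
      only afterwards is its infimum identified with \<open>arrival\<close>.\<close>
    define S where "S = {t. 0 \<le> t \<and> enat n \<le> ?f t}"
    define \<tau> where "\<tau> = Inf S"
    have "eventually (\<lambda>t. enat n < ?f t) at_top"
      using order_tendstoD(1)[OF lim, of "enat n"] by simp
    then obtain b where "\<And>t. b \<le> t \<Longrightarrow> enat n < ?f t"
      by (auto simp: eventually_at_top_linorder)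
    then have "enat n < ?f (max b 0)" by simp
    then have "max b 0 \<in> S" by (auto simp: S_def)
    then have ne: "S \<noteq> {}" by blast
    have bdd: "bdd_below S" by (auto simp: S_def bdd_below_def)
    have \<tau>0: "0 \<le> \<tau>" unfolding \<tau>_def by (rule cInf_greatest[OF ne]) (auto simp: S_def)
    have above: "enat n \<le> ?f t" if "\<tau> < t" for t
    proof -
      obtain s where "s \<in> S" "s < t" using \<open>\<tau> < t\<close> ne bdd unfolding \<tau>_def by (auto simp: cInf_less_iff)
      then show ?thesis using mono[of s t] by (auto simp: S_def intro: order_trans)
    qed
    have ge: "enat n \<le> ?f \<tau>"
    proof (rule ccontr)
      assume "\<not> enat n \<le> ?f \<tau>"
      then have "eventually (\<lambda>t. ?f t < enat n) (at_right \<tau>)"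
        using order_tendstoD(2)[OF rc[OF \<tau>0], of "enat n"] by simp
      moreover have "eventually (\<lambda>t. enat n \<le> ?f t) (at_right \<tau>)"
        using eventually_at_right_less[of \<tau>] by eventually_elim (rule above)
      ultimately have "eventually (\<lambda>t. False) (at_right \<tau>)" by eventually_elim simp
      then show False by simp
    qed
    have "\<tau> \<noteq> 0" using ge f0 Suc by (auto simp: zero_enat_def)
    then have pos: "0 < \<tau>" using \<tau>0 by simp
    have below: "?f s \<le> enat m" if "0 \<le> s" "s < \<tau>" for s
    proof -
      have "s \<notin> S" using that cInf_lower[OF _ bdd, of s] by (auto simp: \<tau>_def)
      then have "?f s < enat (Suc m)" using that by (auto simp: S_def Suc)
      then show ?thesis by (metis Suc_ile_eq linorder_not_less)
    qed
    have "(SUP s\<in>{0..<\<tau>}. ?f s) \<le> enat m" by (rule SUP_least) (auto intro: below)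
    then have "?f \<tau> \<le> enat m + 1" using jump[OF pos] by (meson add_right_mono order_trans)
    then have eq: "?f \<tau> = enat n" using ge by (simp add: Suc one_enat_def)
    have iff: "\<tau> \<le> t \<longleftrightarrow> enat n \<le> ?f t" if "0 \<le> t" for t
    proof
      assume "\<tau> \<le> t" then show "enat n \<le> ?f t" using mono[OF \<tau>0, of t] eq by simp
    next
      assume "enat n \<le> ?f t"
      then show "\<tau> \<le> t" unfolding \<tau>_def using that by (intro cInf_lower bdd) (auto simp: S_def)
    qed
    have "arrival N n \<omega> = \<tau>"
    proof -
      have "Inf {t. 0 \<le> t \<and> ?f t = enat n} = \<tau>"
        by (rule cInf_eq_minimum) (use \<tau>0 eq iff in auto)
      then show ?thesis by (simp add: arrival_def Suc)
    qed
    then show ?thesis using \<tau>0 eq iff by simp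
  qed
  then show "0 \<le> arrival N n \<omega>" "N (arrival N n \<omega>) \<omega> = enat n"
    "0 \<le> t \<Longrightarrow> arrival N n \<omega> \<le> t \<longleftrightarrow> enat n \<le> N t \<omega>" by auto
qed

lemma arrival_0[simp]: "arrival N 0 \<omega> = 0"
  by (simp add: arrival_def)

lemma arrival_less_Suc:
  assumes "counting_process M N" "\<omega> \<in> space M"
  shows "arrival N n \<omega> < arrival N (Suc n) \<omega>"
  using arrival_properties(1,2)[OF assms, of n]
    arrival_properties(3)[OF assms, of "arrival N n \<omega>" "Suc n"] by simp

lemma interarrival_pos:
  assumes "counting_process M N" "\<omega> \<in> space M"
  shows "0 < interarrival N (Suc n) \<omega>"
  using arrival_less_Suc[OF assms, of n] by (simp add: interarrival_def)

lemma sum_interarrival: "(\<Sum>i<n. interarrival N (Suc i) \<omega>) = arrival N n \<omega>"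
  by (induction n) (simp_all add: interarrival_def)

lemma count_eq_iff:
  assumes "counting_process M N" "\<omega> \<in> space M" "0 \<le> t"
  shows "N t \<omega> = enat k \<longleftrightarrow> arrival N k \<omega> \<le> t \<and> t < arrival N (Suc k) \<omega>"
proof -
  have "N t \<omega> = enat k \<longleftrightarrow> enat k \<le> N t \<omega> \<and> \<not> enat (Suc k) \<le> N t \<omega>"
    by (cases "N t \<omega>") auto
  then show ?thesis
    using arrival_properties(3)[OF assms, of k] arrival_properties(3)[OF assms, of "Suc k"] by auto
qed

definition gaps :: "(real \<Rightarrow> 'a \<Rightarrow> enat) \<Rightarrow> 'a \<Rightarrow> real stream" where
  "gaps N \<omega> = to_stream (\<lambda>i. interarrival N (Suc i) \<omega>)"

lemma snth_gaps[simp]: "gaps N \<omega> !! i = interarrival N (Suc i) \<omega>"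
  by (simp add: gaps_def to_stream_def)

text \<open>Positive gaps make the bound on the k-th partial sum imply the bounds on all shorter
  ones, which the recursion checks one by one.\<close>

lemma jumps_by_iff_sum:
  assumes "\<And>i. 0 < w !! i" "0 \<le> t"
  shows "jumps_by k t w \<longleftrightarrow> (\<Sum>i<k. w !! i) \<le> t \<and> t < (\<Sum>i<Suc k. w !! i)"
  using assms
proof (induction k arbitrary: t w)
  case 0
  then show ?case by simp
next
  case (Suc k)
  have pos: "0 < stl w !! i" for i using Suc.prems(1)[of "Suc i"] by simp
  then have nn: "0 \<le> (\<Sum>i<k. stl w !! i)" by (intro sum_nonneg less_imp_le)
  show ?case
  proof (cases "shd w \<le> t")
    case True
    then show ?thesis
      using Suc.IH[OF pos, of "t - shd w"]
      by (simp add: sum.lessThan_Suc_shift algebra_simps del: sum.lessThan_Suc)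
  next
    case False
    then show ?thesis using nn by (simp add: sum.lessThan_Suc_shift del: sum.lessThan_Suc)
  qed
qed

lemma count_eq_iff_jumps_by:
  assumes "counting_process M N" "\<omega> \<in> space M" "0 \<le> t"
  shows "N t \<omega> = enat k \<longleftrightarrow> jumps_by k t (gaps N \<omega>)"
proof -
  have "jumps_by k t (gaps N \<omega>) \<longleftrightarrow>
    (\<Sum>i<k. gaps N \<omega> !! i) \<le> t \<and> t < (\<Sum>i<Suc k. gaps N \<omega> !! i)"
    using interarrival_pos[OF assms(1,2)] assms(3) by (intro jumps_by_iff_sum) simp_all
  then show ?thesis
    unfolding count_eq_iff[OF assms] snth_gaps sum_interarrival by blast
qed

lemma measurable_gaps:
  assumes "\<And>i. interarrival N (Suc i) \<in> borel_measurable M"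
  shows "gaps N \<in> M \<rightarrow>\<^sub>M stream_space borel"
  by (rule measurable_stream_space2) (use assms in \<open>simp\<close>)

section \<open>The conditional law of the gap stream given \<Theta>\<close>

lemma (in prob_space) sigma_finite_generated:
  assumes "X \<in> borel_measurable M"
  shows "sigma_finite_subalgebra M (generated_sigma M X)"
proof (rule finite_measure_subalgebra_is_sigma_finite)
  have "subalgebra M (generated_sigma M X)"
    using sets_image_in_sets[OF refl assms] by (simp add: subalgebra_def)
  then show "finite_measure_subalgebra M (generated_sigma M X)"
    by (intro finite_measure_subalgebra.intro finite_measure_subalgebra_axioms.intro finite_measure_axioms)
qed

lemma prob_algebra_kernelD:
  assumes "K \<in> borel \<rightarrow>\<^sub>M prob_algebra S"
  shows "prob_space (K x)" "sets (K x) = sets S" "space (K x) = space S"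
  using measurable_space[OF assms, of x] by (auto simp: space_prob_algebra dest: sets_eq_imp_space_eq)

lemma mixed_renewal_interarrival_measurable:
  assumes "mixed_renewal_process M N \<Theta> K"
  shows "interarrival N (Suc i) \<in> borel_measurable M"
  using assms by (auto simp: mixed_renewal_process_def cond_indep_vars_def)

text \<open>Conditional independence turns the conditional probability of a cylinder into a product
  of masses of \<open>K (\<Theta> \<omega>)\<close>. Integrating it over an event of
  \<sigma>(\<Theta>) removes the conditional expectation.\<close>

lemma (in prob_space) mixed_renewal_cylinder:
  fixes \<Theta> :: "'a \<Rightarrow> 'b::topological_space"
  assumes \<Theta>[measurable]: "\<Theta> \<in> borel_measurable M" and K: "K \<in> borel \<rightarrow>\<^sub>M prob_algebra borel"
    and mrp: "mixed_renewal_process M N \<Theta> K"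
    and A: "\<And>i. A i \<in> sets borel" and B: "B \<in> sets borel"
  shows "emeasure M {\<omega>\<in>space M. (\<forall>i<n. interarrival N (Suc i) \<omega> \<in> A i) \<and> \<Theta> \<omega> \<in> B} =
    (\<integral>\<^sup>+\<omega>. (\<Prod>i<n. emeasure (K (\<Theta> \<omega>)) (A i)) * indicator B (\<Theta> \<omega>) \<partial>M)"
\<comment> \<open>Conditional independence speaks about nonempty index sets only, so the empty
  cylinder is treated directly.\<close>
proof (cases "n = 0")
  case True
  have "(\<integral>\<^sup>+\<omega>. indicator B (\<Theta> \<omega>) \<partial>M) = (\<integral>\<^sup>+\<omega>. indicator {\<omega>\<in>space M. \<Theta> \<omega> \<in> B} \<omega> \<partial>M)"
    by (intro nn_integral_cong) (auto simp: indicator_def)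
  then show ?thesis using True B by simp
next
  case False
  let ?G = "generated_sigma M \<Theta>"
  interpret G: sigma_finite_subalgebra M ?G by (rule sigma_finite_generated[OF \<Theta>])
  have [measurable]: "interarrival N (Suc i) \<in> borel_measurable M" for i
    by (rule mixed_renewal_interarrival_measurable[OF mrp])
  note A[measurable] B[measurable]
  note [measurable] = measurable_prob_algebraD[OF K]
  let ?W = "\<lambda>j. interarrival N j -` A (j - 1) \<inter> space M"
  have cp: "AE \<omega> in M. cond_prob_of M ?G (?W (Suc i)) \<omega> = measure (K (\<Theta> \<omega>)) (A i)" for i
  proof -
    have "\<exists>\<kappa>. cond_distribution M ?G borel (interarrival N (Suc i)) \<kappa> \<and>
        (AE \<omega> in restr_to_subalg M ?G. \<kappa> \<omega> = K (\<Theta> \<omega>))"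
      using mrp unfolding mixed_renewal_process_def by force
    then obtain \<kappa> where \<kappa>: "cond_distribution M ?G borel (interarrival N (Suc i)) \<kappa>"
      and eq: "AE \<omega> in restr_to_subalg M ?G. \<kappa> \<omega> = K (\<Theta> \<omega>)" by blast
    have "AE \<omega> in M. measure (\<kappa> \<omega>) (A i) = cond_prob_of M ?G (?W (Suc i)) \<omega>"
      using \<kappa> A[of i] unfolding cond_distribution_def by simp
    moreover have "AE \<omega> in M. \<kappa> \<omega> = K (\<Theta> \<omega>)" using AE_restr_to_subalg[OF G.subalg eq] .
    ultimately show ?thesis by eventually_elim simp
  qed
  let ?E = "\<Inter>j\<in>{1..n}. ?W j"
  have "AE \<omega> in M. cond_prob_of M ?G ?E \<omega> = (\<Prod>j\<in>{1..n}. cond_prob_of M ?G (?W j) \<omega>)"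
    using mrp[unfolded mixed_renewal_process_def, THEN conjunct1, unfolded cond_indep_vars_def,
        THEN conjunct2, rule_format, of "{1..n}" "\<lambda>j. A (j - 1)"] False A by auto
  moreover have "AE \<omega> in M. \<forall>i. cond_prob_of M ?G (?W (Suc i)) \<omega> = measure (K (\<Theta> \<omega>)) (A i)"
    using cp by (simp add: AE_all_countable)
  ultimately have prod: "AE \<omega> in M. cond_prob_of M ?G ?E \<omega> = (\<Prod>i<n. measure (K (\<Theta> \<omega>)) (A i))"
  proof eventually_elim
    case (elim \<omega>)
    have "(\<Prod>j\<in>{1..n}. cond_prob_of M ?G (?W j) \<omega>) = (\<Prod>i<n. cond_prob_of M ?G (?W (Suc i)) \<omega>)"
      by (rule prod.reindex_bij_witness[of _ Suc "\<lambda>j. j - 1"]) auto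
    then show ?case using elim by simp
  qed
  have E: "?E = {\<omega>\<in>space M. \<forall>i<n. interarrival N (Suc i) \<omega> \<in> A i}"
  proof (intro set_eqI iffI)
    fix \<omega> assume "\<omega> \<in> ?E"
    then show "\<omega> \<in> {\<omega>\<in>space M. \<forall>i<n. interarrival N (Suc i) \<omega> \<in> A i}"
      using False by (force simp: Suc_le_eq)
  next
    fix \<omega> assume *: "\<omega> \<in> {\<omega>\<in>space M. \<forall>i<n. interarrival N (Suc i) \<omega> \<in> A i}"
    have "interarrival N j \<omega> \<in> A (j - 1)" if "j \<in> {1..n}" for j
    proof -
      have "j - 1 < n" "Suc (j - 1) = j" using that by auto
      then show ?thesis using * by (metis (mono_tags, lifting) mem_Collect_eq)
    qed
    then show "\<omega> \<in> ?E" using * by auto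
  qed
  have Em[measurable]: "?E \<in> sets M" unfolding E by measurable
  let ?Z = "\<Theta> -` B \<inter> space M"
  have Z: "?Z \<in> sets ?G" using B by (intro in_vimage_algebra)
  have Zm[measurable]: "?Z \<in> sets M" by measurable
  have bound: "(\<Prod>i<n. measure (K (\<Theta> \<omega>)) (A i)) \<le> 1" for \<omega>
    using prob_space.prob_le_1[OF prob_algebra_kernelD(1)[OF K]] by (intro prod_le_1) auto
  have int: "integrable M (\<lambda>\<omega>. indicat_real ?Z \<omega> * (\<Prod>i<n. measure (K (\<Theta> \<omega>)) (A i)))"
  proof (rule integrable_const_bound[of _ 1])
    show "AE \<omega> in M. norm (indicat_real ?Z \<omega> * (\<Prod>i<n. measure (K (\<Theta> \<omega>)) (A i))) \<le> 1"
      using bound by (auto simp: indicator_def prod_nonneg)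
  qed measurable
  have "measure M (?E \<inter> ?Z) = (\<integral>\<omega>\<in>?Z. indicat_real ?E \<omega> \<partial>M)"
  proof -
    have "(\<integral>\<omega>\<in>?Z. indicat_real ?E \<omega> \<partial>M) = (\<integral>\<omega>. indicat_real (?E \<inter> ?Z) \<omega> \<partial>M)"
      unfolding set_lebesgue_integral_def
      by (intro Bochner_Integration.integral_cong refl) (simp only: indicator_inter_arith real_scaleR_def mult.commute)
    also have "\<dots> = measure M (?E \<inter> ?Z)"
      unfolding Bochner_Integration.integral_indicator by (rule arg_cong[where f="measure M"]) blast
    finally show ?thesis ..
  qed
  also have "\<dots> = (\<integral>\<omega>\<in>?Z. cond_prob_of M ?G ?E \<omega> \<partial>M)"
    by (rule G.real_cond_exp_intA[OF _ Z]) (rule integrable_real_indicator[OF Em], simp only: emeasure_eq_measure ennreal_less_top infinity_ennreal_def)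
  also have "\<dots> = (\<integral>\<omega>. indicat_real ?Z \<omega> * (\<Prod>i<n. measure (K (\<Theta> \<omega>)) (A i)) \<partial>M)"
    unfolding set_lebesgue_integral_def
    by (rule integral_cong_AE) (use prod in \<open>auto elim!: eventually_mono\<close>)
  finally have "emeasure M (?E \<inter> ?Z) = ennreal \<dots>"
    by (simp add: emeasure_eq_measure)
  also have "\<dots> = (\<integral>\<^sup>+\<omega>. ennreal (indicat_real ?Z \<omega> * (\<Prod>i<n. measure (K (\<Theta> \<omega>)) (A i))) \<partial>M)"
    using int by (intro nn_integral_eq_integral[symmetric]) (auto simp: prod_nonneg)
  also have "\<dots> = (\<integral>\<^sup>+\<omega>. (\<Prod>i<n. emeasure (K (\<Theta> \<omega>)) (A i)) * indicator B (\<Theta> \<omega>) \<partial>M)"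
  proof (rule nn_integral_cong)
    fix \<omega> assume "\<omega> \<in> space M"
    moreover interpret K: prob_space "K (\<Theta> \<omega>)" by (rule prob_algebra_kernelD(1)[OF K])
    have "(\<Prod>i<n. emeasure (K (\<Theta> \<omega>)) (A i)) = ennreal (\<Prod>i<n. measure (K (\<Theta> \<omega>)) (A i))"
      by (simp add: K.emeasure_eq_measure prod_ennreal)
    ultimately show "ennreal (indicat_real ?Z \<omega> * (\<Prod>i<n. measure (K (\<Theta> \<omega>)) (A i))) =
        (\<Prod>i<n. emeasure (K (\<Theta> \<omega>)) (A i)) * indicator B (\<Theta> \<omega>)"
      by (simp add: indicator_def)
  qed
  also have "?E \<inter> ?Z = {\<omega>\<in>space M. (\<forall>i<n. interarrival N (Suc i) \<omega> \<in> A i) \<and> \<Theta> \<omega> \<in> B}"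
    unfolding E by auto
  finally show ?thesis .
qed

text \<open>For fixed B both sides are finite measures in A that agree on cylinders. Keeping the
  event \<Theta> \<in> B identifies the conditional law of the gaps and not merely its
  average.\<close>

lemma (in prob_space) mixed_renewal_law:
  fixes \<Theta> :: "'a \<Rightarrow> 'b::topological_space"
  assumes \<Theta>[measurable]: "\<Theta> \<in> borel_measurable M" and K: "K \<in> borel \<rightarrow>\<^sub>M prob_algebra borel"
    and mrp: "mixed_renewal_process M N \<Theta> K"
    and A: "A \<in> sets (stream_space borel)" and B[measurable]: "B \<in> sets borel"
  shows "emeasure M {\<omega>\<in>space M. gaps N \<omega> \<in> A \<and> \<Theta> \<omega> \<in> B} =
    (\<integral>\<^sup>+\<omega>. emeasure (stream_space (K (\<Theta> \<omega>))) A * indicator B (\<Theta> \<omega>) \<partial>M)"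
proof -
  have g[measurable]: "gaps N \<in> M \<rightarrow>\<^sub>M stream_space borel"
    by (intro measurable_gaps mixed_renewal_interarrival_measurable[OF mrp])
  note kern[measurable] = measurable_prob_algebraD[OF measurable_stream_space_kernel[OF K]]
  have kern2[measurable]: "(\<lambda>\<omega>. stream_space (K (\<Theta> \<omega>))) \<in> M \<rightarrow>\<^sub>M subprob_algebra (stream_space borel)"
    by measurable
  \<comment> \<open>The restriction to \<Theta> \<in> B is moved into the base measure, which turns
    the two sides into an image measure and a mixture.\<close>
  let ?D = "density M (\<lambda>\<omega>. indicator B (\<Theta> \<omega>))"
  let ?M1 = "distr ?D (stream_space borel) (gaps N)"
  let ?M2 = "?D \<bind> (\<lambda>\<omega>. stream_space (K (\<Theta> \<omega>)))"
  let ?\<Omega> = "space (stream_space (borel :: real measure))"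
  let ?E = "{{w\<in>?\<Omega>. \<forall>i<n. w !! i \<in> A i} | n A. \<forall>i. A i \<in> sets (borel :: real measure)}"
  have ne: "space ?D \<noteq> {}" using not_empty by simp
  have kern3: "(\<lambda>\<omega>. stream_space (K (\<Theta> \<omega>))) \<in> ?D \<rightarrow>\<^sub>M subprob_algebra (stream_space borel)"
    using kern2 by simp
  have M1: "emeasure ?M1 X = emeasure M {\<omega>\<in>space M. gaps N \<omega> \<in> X \<and> \<Theta> \<omega> \<in> B}"
    if X[measurable]: "X \<in> sets (stream_space borel)" for X
  proof -
    have "emeasure ?M1 X = emeasure ?D {\<omega>\<in>space M. gaps N \<omega> \<in> X}"
      by (subst emeasure_distr) (auto simp: vimage_def Int_def conj_commute)
    also have "\<dots> = (\<integral>\<^sup>+\<omega>. indicator B (\<Theta> \<omega>) * indicator {\<omega>\<in>space M. gaps N \<omega> \<in> X} \<omega> \<partial>M)"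
      by (rule emeasure_density) measurable
    also have "\<dots> = (\<integral>\<^sup>+\<omega>. indicator {\<omega>\<in>space M. gaps N \<omega> \<in> X \<and> \<Theta> \<omega> \<in> B} \<omega> \<partial>M)"
      by (rule nn_integral_cong) (auto simp: indicator_def)
    also have "\<dots> = emeasure M {\<omega>\<in>space M. gaps N \<omega> \<in> X \<and> \<Theta> \<omega> \<in> B}"
      by (rule nn_integral_indicator) measurable
    finally show ?thesis .
  qed
  have M2: "emeasure ?M2 X = (\<integral>\<^sup>+\<omega>. emeasure (stream_space (K (\<Theta> \<omega>))) X * indicator B (\<Theta> \<omega>) \<partial>M)"
    if X[measurable]: "X \<in> sets (stream_space borel)" for X
  proof -
    have "emeasure ?M2 X = (\<integral>\<^sup>+\<omega>. emeasure (stream_space (K (\<Theta> \<omega>))) X \<partial>?D)"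
      by (rule emeasure_bind[OF ne kern3 X])
    also have "\<dots> = (\<integral>\<^sup>+\<omega>. indicator B (\<Theta> \<omega>) * emeasure (stream_space (K (\<Theta> \<omega>))) X \<partial>M)"
      by (rule nn_integral_density) measurable
    finally show ?thesis by (simp add: mult.commute)
  qed
  have "?M1 = ?M2"
  proof (rule measure_eqI_generator_eq[where E="?E" and \<Omega>="?\<Omega>" and A="\<lambda>_. ?\<Omega>"])
    show "Int_stable ?E" "?E \<subseteq> Pow ?\<Omega>" by (rule stream_space_cylinder_generator)+
    show "sets ?M1 = sigma_sets ?\<Omega> ?E" unfolding sets_distr by (rule stream_space_cylinder_generator)
    show "sets ?M2 = sigma_sets ?\<Omega> ?E"
      unfolding stream_space_cylinder_generator(3)[of borel, symmetric]
      by (rule sets_bind[OF sets_kernel[OF kern3] ne])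
    have "?\<Omega> \<in> ?E"
      unfolding mem_Collect_eq by (intro exI[of _ 0] exI[of _ "\<lambda>_. UNIV"]) simp
    then show "range (\<lambda>_. ?\<Omega>) \<subseteq> ?E" by blast
    show "emeasure ?M1 ?\<Omega> \<noteq> \<infinity>"
      by (subst M1) auto
  next
    fix X assume "X \<in> ?E"
    then obtain n A where A: "\<And>i. A i \<in> sets (borel :: real measure)"
      and X: "X = {w\<in>?\<Omega>. \<forall>i<n. w !! i \<in> A i}" by blast
    note A[measurable]
    have Xm: "X \<in> sets (stream_space borel)" unfolding X by measurable
    have "emeasure ?M1 X = emeasure M {\<omega>\<in>space M. (\<forall>i<n. interarrival N (Suc i) \<omega> \<in> A i) \<and> \<Theta> \<omega> \<in> B}"
      unfolding M1[OF Xm] by (simp add: X space_stream_space)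
    also have "\<dots> = (\<integral>\<^sup>+\<omega>. (\<Prod>i<n. emeasure (K (\<Theta> \<omega>)) (A i)) * indicator B (\<Theta> \<omega>) \<partial>M)"
      by (rule mixed_renewal_cylinder[OF \<Theta> K mrp A B])
    also have "\<dots> = emeasure ?M2 X"
      unfolding M2[OF Xm]
    proof (rule nn_integral_cong)
      fix \<omega>
      interpret K: prob_space "K (\<Theta> \<omega>)" by (rule prob_algebra_kernelD(1)[OF K])
      have "emeasure (stream_space (K (\<Theta> \<omega>))) X = (\<Prod>i<n. emeasure (K (\<Theta> \<omega>)) (A i))"
        using K.emeasure_stream_space_cylinder[of A n] A prob_algebra_kernelD(2,3)[OF K, of "\<Theta> \<omega>"]
        by (simp add: X space_stream_space)
      then show "(\<Prod>i<n. emeasure (K (\<Theta> \<omega>)) (A i)) * indicator B (\<Theta> \<omega>) =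
        emeasure (stream_space (K (\<Theta> \<omega>))) X * indicator B (\<Theta> \<omega>)" by simp
    qed
    finally show "emeasure ?M1 X = emeasure ?M2 X" .
  qed simp
  then show ?thesis using M1[OF A] M2[OF A] by simp
qed

section \<open>Characterization of the exponential law\<close>

text \<open>A right limit that is known to exist is determined by rational arguments, the only ones
  for which the almost sure identities hold simultaneously.\<close>

lemma tendsto_at_right_rational_le:
  fixes h :: "real \<Rightarrow> real"
  assumes "(h \<longlongrightarrow> L) (at_right x)" "x < c" "\<And>q. q \<in> \<rat> \<Longrightarrow> x < q \<Longrightarrow> q < c \<Longrightarrow> h q \<le> 0"
  shows "L \<le> 0"
proof (rule ccontr)
  assume "\<not> L \<le> 0"
  then have "eventually (\<lambda>y. 0 < h y) (at_right x)" using order_tendstoD(1)[OF assms(1), of 0] by simp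
  then obtain b where b: "x < b" "\<And>y. x < y \<Longrightarrow> y < b \<Longrightarrow> 0 < h y"
    by (auto simp: eventually_at_right_field)
  obtain q where "q \<in> \<rat>" "x < q" "q < min b c" using Rats_dense_in_real[of x "min b c"] b assms(2) by auto
  then show False using b(2)[of q] assms(3)[of q] by simp
qed

lemma tendsto_at_right_rational_eq:
  fixes f g :: "real \<Rightarrow> real"
  assumes f: "(f \<longlongrightarrow> A) (at_right x)" and g: "(g \<longlongrightarrow> B) (at_right x)" and "x < c"
    and "\<And>q. q \<in> \<rat> \<Longrightarrow> x < q \<Longrightarrow> q < c \<Longrightarrow> f q = g q"
  shows "A = B"
  using tendsto_at_right_rational_le[OF tendsto_diff[OF f g], of c]
    tendsto_at_right_rational_le[OF tendsto_diff[OF g f], of c] assms(3,4) by fastforce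

lemma tendsto_at_right_isCont:
  fixes f :: "real \<Rightarrow> real"
  shows "isCont f x \<Longrightarrow> (f \<longlongrightarrow> f x) (at_right x)"
  by (auto simp: isCont_def intro: filterlim_mono at_le)

text \<open>Differentiating the functional equation in u gives F'(u + v) = F'(u) (1 - F v). As u
  tends to 0 this becomes the linear equation F' = p (1 - F), so the rate is the limit of the
  density at 0.\<close>

lemma exponential_of_multiplicative:
  fixes F :: "real \<Rightarrow> real"
  assumes mult: "\<And>u v. 0 < u \<Longrightarrow> 0 < v \<Longrightarrow> 1 - F (u + v) = (1 - F u) * (1 - F v)"
    and C1: "F C1_differentiable_on {0<..}"
    and d0: "(deriv F \<longlongrightarrow> p) (at_right 0)"
    and F0: "(F \<longlongrightarrow> 0) (at_right 0)" and t: "0 < t"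
  shows "F t = 1 - exp (- (p * t))"
proof -
  obtain D where D: "\<And>x. 0 < x \<Longrightarrow> (F has_vector_derivative D x) (at x)" and cD: "continuous_on {0<..} D"
    using C1 by (auto simp: C1_differentiable_on_def)
  have dF: "(F has_real_derivative D x) (at x)" if "0 < x" for x
    using D[OF that] by (simp add: has_real_derivative_iff_has_vector_derivative)
  have derD: "deriv F x = D x" if "0 < x" for x using DERIV_imp_deriv[OF dF[OF that]] .
  have D0: "(D \<longlongrightarrow> p) (at_right 0)"
    by (rule Lim_transform_eventually[OF d0])
      (use eventually_at_right_less[of 0] derD in \<open>auto elim!: eventually_mono\<close>)
  have isD: "isCont D v" if "0 < v" for v
    using cD that by (simp add: continuous_on_eq_continuous_at)
  have ode: "D v = p * (1 - F v)" if v: "0 < v" for v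
  proof -
    have eq: "D (u + v) = D u * (1 - F v)" if u: "0 < u" for u
    proof -
      have "((\<lambda>u. 1 - F (u + v)) has_real_derivative (0 - D (u + v) * (1 + 0))) (at u)"
        using u v by (intro DERIV_diff DERIV_const DERIV_chain2[where f=F] dF DERIV_add DERIV_ident) auto
      moreover have "((\<lambda>u. (1 - F u) * (1 - F v)) has_real_derivative (0 - D u) * (1 - F v)) (at u)"
        using u by (intro DERIV_cmult_right DERIV_diff DERIV_const dF)
      then have "((\<lambda>u. 1 - F (u + v)) has_real_derivative (0 - D u) * (1 - F v)) (at u)"
        by (rule has_field_derivative_transform_within_open[where S="{0<..}"]) (use u v mult in auto)
      ultimately have "0 - D (u + v) * (1 + 0) = (0 - D u) * (1 - F v)" by (rule DERIV_unique)
      then show ?thesis by simp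
    qed
    have "isCont (\<lambda>u. D (u + v)) 0"
      using isD[OF v] by (intro isCont_o2[where f="\<lambda>u. u + v" and g=D]) auto
    then have "((\<lambda>u. D (u + v)) \<longlongrightarrow> D v) (at_right 0)"
      using tendsto_at_right_isCont[where f="\<lambda>u. D (u + v)" and x=0] by simp
    moreover have "((\<lambda>u. D u * (1 - F v)) \<longlongrightarrow> p * (1 - F v)) (at_right 0)"
      by (intro tendsto_intros D0)
    ultimately show ?thesis
      by (rule tendsto_at_right_rational_eq[where c=1]) (use eq in auto)
  qed
  \<comment> \<open>With the integrating factor exp(p v) the solution becomes constant; its limit at
    0 is 1.\<close>
  let ?G = "\<lambda>v. (1 - F v) * exp (p * v)"
  have dG: "(?G has_real_derivative 0) (at v)" if v: "0 < v" for v
  proof -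
    have "(?G has_real_derivative (0 - D v) * exp (p * v) + exp (p * v) * (p * 1) * (1 - F v)) (at v)"
      by (intro DERIV_mult DERIV_diff DERIV_const dF v DERIV_chain2[where f=exp] DERIV_exp DERIV_cmult DERIV_ident)
    moreover have "(0 - D v) * exp (p * v) + exp (p * v) * (p * 1) * (1 - F v) = 0"
      by (simp add: ode[OF v] algebra_simps)
    ultimately show ?thesis by (simp only:)
  qed
  have const: "?G v = ?G t" if v: "0 < v" for v
  proof -
    have "\<exists>c. \<forall>x\<in>{0<..}. ?G x = c"
      by (rule has_field_derivative_zero_constant) (auto intro: has_field_derivative_at_within dG)
    then show ?thesis using v t by auto
  qed
  have "(?G \<longlongrightarrow> (1 - 0) * exp (p * 0)) (at_right 0)"
    by (intro tendsto_intros F0)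
  moreover have "((\<lambda>_. ?G t) \<longlongrightarrow> ?G t) (at_right 0)" by simp
  ultimately have "1 = ?G t"
    using tendsto_at_right_rational_eq[where f="?G" and g="\<lambda>_. ?G t" and c=1 and x=0] const by simp
  then have "exp (- (p * t)) = ?G t * exp (- (p * t))" by simp
  also have "\<dots> = 1 - F t" by (simp add: mult.assoc exp_add[symmetric])
  finally show ?thesis by simp
qed

lemma exponential_law_eqI:
  assumes K: "prob_space K" "sets K = sets borel" and p: "0 < p"
    and F0: "measure K {..0} = 0" and F: "\<And>t. 0 < t \<Longrightarrow> measure K {..t} = 1 - exp (- (p * t))"
  shows "K = exponential_law p"
proof (rule cdf_unique)
  interpret K: prob_space K by (rule K)
  show "real_distribution K"
    using K by (simp add: real_distribution_def real_distribution_axioms_def)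
  show "real_distribution (exponential_law p)"
    using prob_space_exponential_density[OF p] by (simp add: real_distribution_def real_distribution_axioms_def)
  show "cdf K = cdf (exponential_law p)"
  proof
    fix x
    have E: "cdf (exponential_law p) x = enn2real (ennreal (erlang_CDF 0 p x))"
      using emeasure_erlang_density[OF p, of 0 x] by (simp add: cdf_def measure_def)
    consider "0 < x" | "x \<le> 0" by linarith
    then show "cdf K x = cdf (exponential_law p) x"
    proof cases
      case 1
      moreover from this have "0 \<le> 1 - exp (- (p * x))" using p by simp
      ultimately show ?thesis
        unfolding E by (simp add: cdf_def F erlang_CDF_def)
    next
      case 2
      then have "measure K {..x} \<le> measure K {..0}"
        using K by (intro K.finite_measure_mono) auto
      then have "measure K {..x} = 0" using F0 by (simp add: measure_le_0_iff)
      then show ?thesis using 2 unfolding E by (simp add: cdf_def erlang_CDF_def)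
    qed
  qed
qed

text \<open>For \<open>0 \<le> a\<close>, a < b and b \<le> s, and for the gaps of N, this is the
  event N a = 0 and N b = N s = 1. Under \<open>stream_space K\<close> its mass is the integral of
  S(s - x) over (a, b] with respect to K, where S is the survival function of K.\<close>

definition jump_window :: "real \<Rightarrow> real \<Rightarrow> real \<Rightarrow> real stream set" where
  "jump_window a b s = {w. a < w !! 0 \<and> w !! 0 \<le> b \<and> s < w !! 0 + w !! 1}"

lemma jump_window_sets[measurable]: "jump_window a b s \<in> sets (stream_space borel)"
proof -
  have "{w\<in>space (stream_space borel). a < w !! 0 \<and> w !! 0 \<le> b \<and> s < w !! 0 + w !! 1} \<in> sets (stream_space borel)"
    by measurable
  then show ?thesis by (simp add: jump_window_def space_stream_space)
qed

text \<open>Given a first jump x, the second gap must exceed s - x, and the probability of this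
  increases with x. The values at the end points bracket the mass, which suffices when b tends to
  a.\<close>

lemma jump_window_bounds:
  assumes K: "prob_space K" "sets K = sets borel" and ab: "a \<le> b"
  shows "measure K {a<..b} * measure K {s - a<..} \<le> measure (stream_space K) (jump_window a b s)"
    and "measure (stream_space K) (jump_window a b s) \<le> measure K {a<..b} * measure K {s - b<..}"
proof -
  interpret K: prob_space K by (rule K)
  interpret S: prob_space "stream_space K" by (rule K.prob_space_stream_space)
  have sK[measurable_cong]: "sets (stream_space K) = sets (stream_space borel)"
    using K(2) by (rule sets_stream_space_cong)
  note K(2)[measurable_cong]
  have [simp]: "space K = UNIV" using sets_eq_imp_space_eq[OF K(2)] by simp
  have [simp]: "space (stream_space K) = UNIV" by (simp add: space_stream_space)
  have "emeasure (stream_space K) (jump_window a b s) =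
    (\<integral>\<^sup>+x. emeasure (stream_space K) {w\<in>space (stream_space K). x ## w \<in> jump_window a b s} \<partial>K)"
    by (rule K.emeasure_stream_space) measurable
  also have "\<dots> = (\<integral>\<^sup>+x. indicator {a<..b} x * emeasure K {s - x<..} \<partial>K)"
  proof (rule nn_integral_cong)
    fix x
    have "{w\<in>space (stream_space K). x ## w \<in> jump_window a b s} =
      (if x \<in> {a<..b} then {w\<in>space (stream_space K). \<forall>i<Suc 0. w !! i \<in> {s - x<..}} else {})"
      by (auto simp: jump_window_def algebra_simps)
    then show "emeasure (stream_space K) {w\<in>space (stream_space K). x ## w \<in> jump_window a b s} =
      indicator {a<..b} x * emeasure K {s - x<..}"
      using K.emeasure_stream_space_cylinder[of "\<lambda>_. {s - x<..}" "Suc 0"] K(2)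
      by (auto simp: indicator_def)
  qed
  finally have eq: "emeasure (stream_space K) (jump_window a b s) = \<dots>" .
  have "ennreal (measure K {a<..b} * measure K {s - a<..}) = emeasure K {a<..b} * emeasure K {s - a<..}"
    by (simp add: K.emeasure_eq_measure ennreal_mult)
  also have "\<dots> = (\<integral>\<^sup>+x. indicator {a<..b} x * emeasure K {s - a<..} \<partial>K)"
    by (subst nn_integral_multc) (auto simp: K(2))
  also have "\<dots> \<le> (\<integral>\<^sup>+x. indicator {a<..b} x * emeasure K {s - x<..} \<partial>K)"
    by (intro nn_integral_mono) (auto simp: indicator_def K(2) intro!: emeasure_mono)
  finally show "measure K {a<..b} * measure K {s - a<..} \<le> measure (stream_space K) (jump_window a b s)"
    unfolding eq[symmetric] S.emeasure_eq_measure by simp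
  have "(\<integral>\<^sup>+x. indicator {a<..b} x * emeasure K {s - x<..} \<partial>K) \<le>
      (\<integral>\<^sup>+x. indicator {a<..b} x * emeasure K {s - b<..} \<partial>K)"
    by (intro nn_integral_mono) (auto simp: indicator_def K(2) intro!: emeasure_mono)
  also have "\<dots> = emeasure K {a<..b} * emeasure K {s - b<..}"
    by (subst nn_integral_multc) (auto simp: K(2))
  also have "\<dots> = ennreal (measure K {a<..b} * measure K {s - b<..})"
    by (simp add: K.emeasure_eq_measure ennreal_mult)
  finally show "measure (stream_space K) (jump_window a b s) \<le> measure K {a<..b} * measure K {s - b<..}"
    unfolding eq[symmetric] S.emeasure_eq_measure by simp
qed

lemma measure_interval_pos:
  fixes F :: "real \<Rightarrow> real"
  assumes K: "prob_space K" "sets K = sets borel"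
    and F: "\<And>t. 0 \<le> t \<Longrightarrow> F t = measure K {..t}"
    and C1: "F C1_differentiable_on {0<..}" and pos: "\<And>t. 0 < t \<Longrightarrow> 0 < deriv F t"
    and ab: "0 \<le> a" "a < b"
  shows "0 < measure K {a<..b}"
proof -
  interpret K: prob_space K by (rule K)
  \<comment> \<open>The midpoint stays away from 0, where F need not be differentiable.\<close>
  define c where "c = (a + b) / 2"
  have c: "a < c" "c < b" using ab by (auto simp: c_def)
  have "F c < F b"
  proof (rule DERIV_pos_imp_increasing[OF c(2)])
    fix z assume "c \<le> z" "z \<le> b"
    then have z: "0 < z" using ab c by simp
    then have "F differentiable at z" using C1 by (auto simp: C1_differentiable_on_eq)
    then show "\<exists>d. (F has_real_derivative d) (at z) \<and> 0 < d"
      using pos[OF z] DERIV_deriv_iff_real_differentiable[of F z] by blast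
  qed
  moreover have "{c<..b} = {..b} - {..c}" by auto
  then have "measure K {c<..b} = F b - F c"
    using K.finite_measure_Diff[of "{..b}" "{..c}"] K(2) ab c by (simp add: F)
  moreover have "measure K {c<..b} \<le> measure K {a<..b}"
    using K(2) c by (intro K.finite_measure_mono) auto
  ultimately show ?thesis by simp
qed

lemma jump_window_pos:
  assumes K: "prob_space K" "sets K = sets borel"
    and pos: "\<And>a b. 0 \<le> a \<Longrightarrow> a < b \<Longrightarrow> 0 < measure K {a<..b}" and t: "0 < t" "t \<le> s"
  shows "0 < measure (stream_space K) (jump_window 0 t s)"
proof -
  interpret K: prob_space K by (rule K)
  have "measure K {s<..s + 1} \<le> measure K {s<..}"
    using K(2) by (intro K.finite_measure_mono) auto
  then have "0 < measure K {0<..t} * measure K {s - 0<..}"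
    using pos[of 0 t] pos[of s "s + 1"] t by simp
  also have "\<dots> \<le> measure (stream_space K) (jump_window 0 t s)"
    by (rule jump_window_bounds[OF K]) (use t in simp)
  finally show ?thesis .
qed

text \<open>By \<open>windows\<close> the ratio of the masses for s and s' is the same for all
  windows below t. Shrinking a window to the point a turns it into S(s - a) / S(s' - a); positivity
  of the masses permits the cancellations.\<close>

lemma exponential_law_of_proportional_windows:
  fixes F :: "real \<Rightarrow> real"
  defines "m \<equiv> \<lambda>K a b s. measure (stream_space K) (jump_window a b s)"
  assumes K: "prob_space K" "sets K = sets borel"
    and K0: "measure K {..0} = 0" and F: "\<And>t. 0 \<le> t \<Longrightarrow> F t = measure K {..t}"
    and C1: "F C1_differentiable_on {0<..}" and pos: "\<And>t. 0 < t \<Longrightarrow> 0 < deriv F t"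
    and d0: "(deriv F \<longlongrightarrow> p) (at_right 0)" and p: "0 < p"
    and windows: "\<And>a b t s s'. a \<in> \<rat> \<Longrightarrow> b \<in> \<rat> \<Longrightarrow> t \<in> \<rat> \<Longrightarrow> s \<in> \<rat> \<Longrightarrow> s' \<in> \<rat> \<Longrightarrow>
      0 < a \<Longrightarrow> a < b \<Longrightarrow> b < t \<Longrightarrow> t \<le> s \<Longrightarrow> t \<le> s' \<Longrightarrow>
      m K a b s * m K 0 t s' = m K a b s' * m K 0 t s"
  shows "K = exponential_law p"
proof -
  interpret K: prob_space K by (rule K)
  interpret KR: real_distribution K
    using K by (simp add: real_distribution_def real_distribution_axioms_def)
  have [simp]: "space K = UNIV" using sets_eq_imp_space_eq[OF K(2)] by simp
  have dF: "(F has_real_derivative deriv F x) (at x)" if "0 < x" for x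
  proof -
    have "F differentiable at x"
      using C1 that by (auto simp: C1_differentiable_on_eq)
    then show ?thesis by (simp add: DERIV_deriv_iff_real_differentiable)
  qed
  have cF: "isCont F x" if "0 < x" for x using DERIV_isCont[OF dF[OF that]] .
  have limF0: "(F \<longlongrightarrow> 0) (at_right 0)"
  proof -
    have "(cdf K \<longlongrightarrow> cdf K 0) (at_right 0)"
      using KR.cdf_is_right_cont[of 0] by (simp add: continuous_within)
    moreover have "eventually (\<lambda>x. cdf K x = F x) (at_right 0)"
      using eventually_at_right_less[of 0] by eventually_elim (simp add: F cdf_def)
    ultimately have "(F \<longlongrightarrow> cdf K 0) (at_right 0)" by (rule Lim_transform_eventually)
    then show ?thesis using K0 by (simp add: cdf_def)
  qed
  have S: "measure K {u<..} = 1 - F u" if "0 \<le> u" for u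
  proof -
    have "{u<..} = UNIV - {..u}" by auto
    then show ?thesis using K.prob_compl[of "{..u}"] K(2) F[OF that] by simp
  qed
  have I: "measure K {a<..b} = F b - F a" if "0 \<le> a" "a \<le> b" for a b
  proof -
    have "{a<..b} = {..b} - {..a}" by auto
    then show ?thesis using K.finite_measure_Diff[of "{..b}" "{..a}"] K(2) that by (simp add: F)
  qed
  have ipos: "0 < measure K {a<..b}" if "0 \<le> a" "a < b" for a b
    using measure_interval_pos[OF K F C1 pos that] .
  have strict: "F x < F y" if "0 < x" "x < y" for x y
    using ipos[of x y] I[of x y] that by simp
  let ?S = "\<lambda>u. 1 - F u"
  have lower: "(F b - F a) * ?S (s - a) \<le> m K a b s"
    and upper: "b \<le> s \<Longrightarrow> m K a b s \<le> (F b - F a) * ?S (s - b)"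
    if "0 \<le> a" "a \<le> b" "a \<le> s" for a b s
    using jump_window_bounds[OF K, of a b s] that by (simp_all add: m_def I S)
  have mpos: "0 < m K 0 t s" if "0 < t" "t \<le> s" for t s
    unfolding m_def by (rule jump_window_pos[OF K ipos that])
  \<comment> \<open>The window for s is bounded from below and the one for s' from above; the common
    factor F b - F a > 0 cancels before b decreases to a. Exchanging s and s' gives the reverse
    inequality.\<close>
  have le: "?S (s - a) * m K 0 t s' \<le> ?S (s' - a) * m K 0 t s"
    if r: "a \<in> \<rat>" "t \<in> \<rat>" "s \<in> \<rat>" "s' \<in> \<rat>" and o: "0 < a" "a < t" "t \<le> s" "t \<le> s'" for a t s s'
  proof -
    have ineq: "?S (s - a) * m K 0 t s' - ?S (s' - b) * m K 0 t s \<le> 0"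
      if b: "b \<in> \<rat>" "a < b" "b < t" for b
    proof -
      have "(F b - F a) * (?S (s - a) * m K 0 t s') \<le> m K a b s * m K 0 t s'"
        using lower[of a b s] mpos[of t s'] o b by (simp add: mult.assoc[symmetric] mult_right_mono)
      also have "\<dots> = m K a b s' * m K 0 t s" by (rule windows) (use r o b in auto)
      also have "\<dots> \<le> (F b - F a) * (?S (s' - b) * m K 0 t s)"
        using upper[of a b s'] mpos[of t s] o b by (simp add: mult.assoc[symmetric] mult_right_mono)
      finally show ?thesis using strict[of a b] o b by simp
    qed
    have "isCont (\<lambda>b. F (s' - b)) a"
      using cF[of "s' - a"] o by (intro isCont_o2[where f="\<lambda>b. s' - b" and g=F]) auto
    then have "((\<lambda>b. ?S (s - a) * m K 0 t s' - ?S (s' - b) * m K 0 t s) \<longlongrightarrow>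
      ?S (s - a) * m K 0 t s' - ?S (s' - a) * m K 0 t s) (at_right a)"
      by (intro tendsto_intros tendsto_at_right_isCont[where f="\<lambda>b. F (s' - b)" and x=a])
    from tendsto_at_right_rational_le[OF this, of t] ineq o show ?thesis by simp
  qed
  have eq: "?S (s - a) * m K 0 t s' = ?S (s' - a) * m K 0 t s"
    if "a \<in> \<rat>" "t \<in> \<rat>" "s \<in> \<rat>" "s' \<in> \<rat>" "0 < a" "a < t" "t \<le> s" "t \<le> s'" for a t s s'
    using le[of a t s s'] le[of a t s' s] that by (intro antisym) auto
  \<comment> \<open>Two instances with the same t, s and s' eliminate the window masses.\<close>
  have cross: "?S (s - a) * ?S (s' - a') = ?S (s' - a) * ?S (s - a')"
    if "a \<in> \<rat>" "a' \<in> \<rat>" "t \<in> \<rat>" "s \<in> \<rat>" "s' \<in> \<rat>" "0 < a" "a < t" "0 < a'" "a' < t" "t \<le> s" "t \<le> s'"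
    for a a' t s s'
  proof -
    let ?m = "m K 0 t s" and ?m' = "m K 0 t s'"
    have 1: "?S (s - a) * ?m' = ?S (s' - a) * ?m" by (rule eq) (use that in auto)
    have 2: "?S (s - a') * ?m' = ?S (s' - a') * ?m" by (rule eq) (use that in auto)
    have "(?S (s - a) * ?S (s' - a')) * (?m * ?m') = (?S (s - a) * ?m') * (?S (s' - a') * ?m)"
      by (simp only: ac_simps)
    also have "\<dots> = (?S (s' - a) * ?m) * (?S (s - a') * ?m')" by (simp only: 1 2)
    also have "\<dots> = (?S (s' - a) * ?S (s - a')) * (?m * ?m')" by (simp only: ac_simps)
    finally show ?thesis using mpos[of t s] mpos[of t s'] that by simp
  qed
  have mult_rat: "?S (u + v) = ?S u * ?S v" if uv: "u \<in> \<rat>" "v \<in> \<rat>" "0 < u" "0 < v" for u v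
  proof -
    \<comment> \<open>Taking t = s' = v + 1 and s = v + 1 + u, the points 1 and v + 1 - e lie below
      t and yield exactly these four arguments. As e tends to 0, S e tends to 1.\<close>
    have eqs: "?S (u + v) * ?S e = ?S v * ?S (u + e)" if e: "e \<in> \<rat>" "0 < e" "e < 1" for e
    proof -
      have "?S ((v + 1 + u) - 1) * ?S ((v + 1) - (v + 1 - e)) =
          ?S ((v + 1) - 1) * ?S ((v + 1 + u) - (v + 1 - e))"
        by (rule cross[of _ _ "v + 1"]) (use uv e in auto)
      moreover have "v + 1 + u - 1 = u + v" "v + 1 - (v + 1 - e) = e" "v + 1 - 1 = v" "v + 1 + u - (v + 1 - e) = u + e"
        by simp_all
      ultimately show ?thesis by (simp only:)
    qed
    have l1: "((\<lambda>e. ?S (u + v) * ?S e) \<longlongrightarrow> ?S (u + v) * (1 - 0)) (at_right 0)"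
      by (intro tendsto_intros limF0)
    have "isCont (\<lambda>e. F (u + e)) 0"
      using cF[of u] uv by (intro isCont_o2[where f="\<lambda>e. u + e" and g=F]) auto
    then have l2: "((\<lambda>e. ?S v * ?S (u + e)) \<longlongrightarrow> ?S v * ?S (u + 0)) (at_right 0)"
      by (intro tendsto_intros tendsto_at_right_isCont[where f="\<lambda>e. F (u + e)" and x=0])
    have "?S (u + v) * (1 - 0) = ?S v * ?S (u + 0)"
      by (rule tendsto_at_right_rational_eq[OF l1 l2 zero_less_one eqs])
    then show ?thesis by (simp add: mult.commute)
  qed
  have lim1: "((\<lambda>q. ?S (q + v)) \<longlongrightarrow> ?S (u + v)) (at_right u)" if "0 < u" "0 < v" for u v
  proof -
    have "isCont (\<lambda>q. F (q + v)) u"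
      using cF[of "u + v"] that by (intro isCont_o2[where f="\<lambda>q. q + v" and g=F]) auto
    then show ?thesis by (intro tendsto_intros tendsto_at_right_isCont[where f="\<lambda>q. F (q + v)" and x=u])
  qed
  have lim2: "((\<lambda>q. ?S q * c) \<longlongrightarrow> ?S u * c) (at_right u)" if "0 < u" for u c
    using cF[OF that] by (intro tendsto_intros tendsto_at_right_isCont)
  \<comment> \<open>Right limits pass from rational to real arguments, one variable at a
    time.\<close>
  have mult1: "?S (u + v) = ?S u * ?S v" if "0 < u" "v \<in> \<rat>" "0 < v" for u v
    by (rule tendsto_at_right_rational_eq[OF lim1 lim2, where c="u + 1"]) (use that mult_rat in auto)
  have mult: "?S (u + v) = ?S u * ?S v" if "0 < u" "0 < v" for u v
  proof -
    have "?S (v + u) = ?S v * ?S u"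
      by (rule tendsto_at_right_rational_eq[OF lim1 lim2, where c="v + 1"])
        (use that mult1[of u] in \<open>auto simp: add.commute mult.commute\<close>)
    then show ?thesis by (simp add: add.commute mult.commute)
  qed
  show ?thesis
  proof (rule exponential_law_eqI[OF K p K0])
    fix t :: real assume "0 < t"
    then show "measure K {..t} = 1 - exp (- (p * t))"
      using exponential_of_multiplicative[OF mult C1 d0 limF0, of t] F[of t] by simp
  qed
qed

section \<open>Past and future of a Markov counting process\<close>

text \<open>The prescribed counts are indexed by time and not by position, so two compatible
  prescriptions can be united without sorting their times.\<close>

definition count_event :: "'a measure \<Rightarrow> (real \<Rightarrow> 'a \<Rightarrow> enat) \<Rightarrow> real set \<Rightarrow> (real \<Rightarrow> nat) \<Rightarrow> 'a set" where
  "count_event M N J k = {\<omega>\<in>space M. \<forall>v\<in>J. N v \<omega> = enat (k v)}"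

lemma count_event_sets[measurable]:
  assumes "counting_process M N" "finite J" "J \<subseteq> {0..}"
  shows "count_event M N J k \<in> sets M"
proof -
  have "Measurable.pred M (\<lambda>\<omega>. \<forall>v\<in>J. N v \<omega> = enat (k v))"
  proof (rule pred_intros_finite(3)[OF assms(2)])
    fix v assume "v \<in> J"
    then have [measurable]: "N v \<in> M \<rightarrow>\<^sub>M count_space UNIV"
      using counting_processD(1)[OF assms(1), of v] assms(3) by auto
    show "Measurable.pred M (\<lambda>\<omega>. N v \<omega> = enat (k v))" by measurable
  qed
  then show ?thesis by (simp add: count_event_def pred_def)
qed

text \<open>The product form avoids division and thereby also covers conditioning events of
  probability zero. A finite set of times with maximum t replaces the enumeration used in
  \<open>markov_property\<close>.\<close>

lemma (in prob_space) markov_property_finite_set: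
  assumes cp: "counting_process M N" and mp: "markov_property M N"
    and J: "finite J" "J \<subseteq> {0<..}" "t \<in> J" "\<And>v. v \<in> J \<Longrightarrow> v \<le> t" and u: "t < u"
  shows "prob (count_event M N (insert u J) k) * prob (count_event M N {t} k) =
    prob (count_event M N J k) * prob (count_event M N {t, u} k)"
proof (cases "prob (count_event M N J k) = 0")
  case True
  have "J \<subseteq> {0..}" using J(2) by auto
  then have "prob (count_event M N (insert u J) k) \<le> prob (count_event M N J k)"
    by (intro finite_measure_mono count_event_sets cp J(1)) (auto simp: count_event_def)
  then show ?thesis using True by (simp add: measure_le_0_iff)
next
  case False
  define xs where "xs = sorted_list_of_set J"
  have xs: "sorted_wrt (<) xs" "set xs = J" using J(1) by (simp_all add: xs_def)
  define m where "m = length xs"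
  have m: "1 \<le> m" using J(3) xs(2) by (cases xs) (auto simp: m_def)
  \<comment> \<open>The increasing enumeration of J, shifted to start at index 1, followed by
    u.\<close>
  define T where "T = (\<lambda>j. if j \<le> m then xs ! (j - 1) else u)"
  have T: "T ` {1..m} = J"
  proof -
    have "T ` {1..m} = (!) xs ` {..<m}"
    proof (intro set_eqI iffI)
      fix x assume "x \<in> T ` {1..m}"
      then obtain j where "j \<in> {1..m}" "x = T j" by blast
      then show "x \<in> (!) xs ` {..<m}" by (intro image_eqI[of _ _ "j - 1"]) (auto simp: T_def)
    next
      fix x assume "x \<in> (!) xs ` {..<m}"
      then obtain j where "j < m" "x = xs ! j" by blast
      then show "x \<in> T ` {1..m}" by (intro image_eqI[of _ _ "Suc j"]) (auto simp: T_def)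
    qed
    also have "\<dots> = J" using xs(2) by (auto simp: m_def set_conv_nth)
    finally show ?thesis .
  qed
  have mono1: "T i < T j" if "i \<in> {1..m}" "j \<in> {1..m}" "i < j" for i j
    using sorted_wrt_nth_less[OF xs(1), of "i - 1" "j - 1"] that by (auto simp: T_def m_def)
  have Tm: "T m = t"
  proof -
    obtain i where i: "i \<in> {1..m}" "T i = t" using T J(3) by blast
    have "T m \<in> J" using T m by auto
    then have "T m \<le> t" by (rule J(4))
    moreover have "i = m \<or> i < m" using i(1) by auto
    ultimately show ?thesis using mono1[OF i(1), of m] i m by auto
  qed
  have Tu: "T (m + 1) = u" by (simp add: T_def)
  have "strict_mono_on {1..m + 1} T"
  proof (rule strict_mono_onI)
    fix i j assume ij: "i \<in> {1..m + 1}" "j \<in> {1..m + 1}" "i < j"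
    show "T i < T j"
    proof (cases "j = m + 1")
      case True
      have "T i \<in> J" using T ij True by auto
      then show ?thesis using J(4)[of "T i"] u True Tu by simp
    next
      case False
      then show ?thesis using ij by (intro mono1) auto
    qed
  qed
  moreover have "0 < T 1" using T m J(2) by (force simp: subset_iff)
  moreover have ev: "{\<omega>\<in>space M. \<forall>j\<in>{1..m}. N (T j) \<omega> = enat (k (T j))} = count_event M N J k"
    unfolding count_event_def T[symmetric] by auto
  ultimately have "\<P>(\<omega> in M. N (T (m + 1)) \<omega> = enat (k (T (m + 1))) \<bar> \<forall>j\<in>{1..m}. N (T j) \<omega> = enat (k (T j))) =
      \<P>(\<omega> in M. N (T (m + 1)) \<omega> = enat (k (T (m + 1))) \<bar> N (T m) \<omega> = enat (k (T m)))"
    using mp[unfolded markov_property_def, rule_format, of m T "\<lambda>j. k (T j)"] m False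
    by (simp add: zero_less_measure_iff)
  moreover have "{\<omega>\<in>space M. N u \<omega> = enat (k u) \<and> (\<forall>j\<in>{1..m}. N (T j) \<omega> = enat (k (T j)))} =
      count_event M N (insert u J) k"
    unfolding count_event_def T[symmetric] by auto
  moreover have "{\<omega>\<in>space M. N u \<omega> = enat (k u) \<and> N t \<omega> = enat (k t)} = count_event M N {t, u} k"
    "{\<omega>\<in>space M. N t \<omega> = enat (k t)} = count_event M N {t} k"
    by (auto simp: count_event_def)
  ultimately have "prob (count_event M N (insert u J) k) / prob (count_event M N J k) =
    prob (count_event M N {t, u} k) / prob (count_event M N {t} k)"
    unfolding cond_prob_def Tu Tm ev by simp
  moreover have "prob (count_event M N J k) \<le> prob (count_event M N {t} k)"
    using J by (intro finite_measure_mono count_event_sets cp) (auto simp: count_event_def)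
  then have "prob (count_event M N {t} k) \<noteq> 0"
    using False by (metis measure_le_0_iff)
  ultimately show ?thesis using False by (simp add: frac_eq_eq mult.commute)
qed

text \<open>Induction adds a new latest time b. The one-step property produces the same transition
  from the preceding time t' to b whether the past is I or only {t}, so the identity for the earlier
  times is preserved.\<close>

lemma (in prob_space) markov_past_future_finite:
  assumes cp: "counting_process M N" and mp: "markov_property M N"
    and I: "finite I" "I \<subseteq> {0<..}" "t \<in> I" "\<And>v. v \<in> I \<Longrightarrow> v \<le> t"
    and J: "finite J" "J \<subseteq> {t..}"
  shows "prob (count_event M N I c \<inter> count_event M N J k) * prob (count_event M N {t} c) =
    prob (count_event M N I c) * prob (count_event M N {t} c \<inter> count_event M N J k)"
  using J
proof (induction J rule: finite_linorder_max_induct)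
  case empty
  have "count_event M N A c \<inter> count_event M N {} k = count_event M N A c" for A
    by (auto simp: count_event_def)
  then show ?case by simp
next
  case (insert b A)
  have t: "0 < t" using I(2,3) by auto
  have A: "A \<subseteq> {t..}" and b: "t \<le> b" using insert.prems by auto
  have sets[measurable]: "finite X \<Longrightarrow> X \<subseteq> {0..} \<Longrightarrow> count_event M N X x \<in> events" for X x
    by (rule count_event_sets[OF cp])
  have sub0: "A \<subseteq> {0..}" "insert b A \<subseteq> {0..}" "I \<subseteq> {0..}" using A b t I(2) by force+
  show ?case
  \<comment> \<open>Past and future can share only the time t. Conflicting counts there make both
    sides zero; otherwise the prescriptions merge into a single r.\<close>
  proof (cases "t \<in> insert b A \<and> k t \<noteq> c t")
    case True
    then have "count_event M N X c \<inter> count_event M N (insert b A) k = {}" if "t \<in> X" for X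
      using that by (auto simp: count_event_def)
    then show ?thesis using I(3) by simp
  next
    case False
    show ?thesis
    proof (cases "b = t")
      case True
      then have "A = {}" using insert.hyps(2) A by force
      then have "count_event M N X c \<inter> count_event M N (insert b A) k = count_event M N X c" if "t \<in> X" for X
        using that True False by (auto simp: count_event_def)
      then show ?thesis using I(3) by simp
    next
      case bt: False
      define r where "r = (\<lambda>v. if v \<le> t then c v else k v)"
      have join: "count_event M N X c \<inter> count_event M N Y k = count_event M N (X \<union> Y) r"
        if X: "X \<subseteq> I" "t \<in> X" and Y: "Y \<subseteq> insert b A" for X Y
      proof -
        have "r v = c v" if "v \<in> X" for v using that X(1) I(4) by (auto simp: r_def)
        moreover have "r v = k v" if "v \<in> Y" for v
        proof (cases "v \<le> t")
          case True
          then have "v = t" using that Y A b by force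
          then show ?thesis using False that Y by (auto simp: r_def)
        qed (simp add: r_def)
        ultimately show ?thesis by (auto simp: count_event_def)
      qed
      define t' where "t' = Max (insert t A)"
      have fin: "finite (insert t A)" using insert.hyps(1) by simp
      have t': "t' \<in> insert t A" "\<And>v. v \<in> insert t A \<Longrightarrow> v \<le> t'"
        unfolding t'_def using Max_in[OF fin] Max_ge[OF fin] by blast+
      have t'b: "t' < b" using t'(1) insert.hyps(2) b bt by auto
      \<comment> \<open>The factor for {t', b} does not depend on X, so the instances X = I and X =
        {t} can be compared.\<close>
      have step: "prob (count_event M N X c \<inter> count_event M N (insert b A) k) * prob (count_event M N {t'} r) =
        prob (count_event M N X c \<inter> count_event M N A k) * prob (count_event M N {t', b} r)"
        if X: "X \<subseteq> I" "t \<in> X" for X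
      proof -
        have "prob (count_event M N (insert b (X \<union> A)) r) * prob (count_event M N {t'} r) =
            prob (count_event M N (X \<union> A) r) * prob (count_event M N {t', b} r)"
        proof (rule markov_property_finite_set[OF cp mp _ _ _ _ t'b])
          show "finite (X \<union> A)" using X(1) I(1) insert.hyps(1) by (auto intro: finite_subset)
          show "X \<union> A \<subseteq> {0<..}" using X(1) I(2) A t by force
          show "t' \<in> X \<union> A" using t'(1) X(2) by auto
          fix v assume "v \<in> X \<union> A"
          then show "v \<le> t'" using X(1) I(4)[of v] t'(2)[of v] t'(2)[of t] by force
        qed
        then show ?thesis
          using join[OF X, of "insert b A"] join[OF X, of A] by (simp add: subset_insertI)
      qed
      have sI: "I \<subseteq> I" "t \<in> I" and st: "{t} \<subseteq> I" "t \<in> {t}" using I(3) by auto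
      note s1 = step[OF sI] and s2 = step[OF st]
      have IH: "prob (count_event M N I c \<inter> count_event M N A k) * prob (count_event M N {t} c) =
        prob (count_event M N I c) * prob (count_event M N {t} c \<inter> count_event M N A k)"
        by (rule insert.IH[OF A])
      let ?a = "prob (count_event M N {t'} r)"
      show ?thesis
      proof (cases "?a = 0")
        case True
        have "prob (count_event M N X c \<inter> count_event M N (insert b A) k) = 0" if X: "X \<subseteq> I" "t \<in> X" for X
        proof -
          have "count_event M N X c \<inter> count_event M N (insert b A) k \<subseteq> count_event M N {t'} r"
            unfolding join[OF X order_refl] using t'(1) X(2) by (auto simp: count_event_def)
          moreover have "count_event M N {t'} r \<in> events" using t'(2)[of t] t by (intro sets) auto
          ultimately have "prob (count_event M N X c \<inter> count_event M N (insert b A) k) \<le> ?a"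
            by (rule finite_measure_mono)
          then show ?thesis using True by (simp add: measure_le_0_iff)
        qed
        from this[OF sI] this[OF st] show ?thesis by simp
      next
        case False
        let ?X1 = "prob (count_event M N I c \<inter> count_event M N (insert b A) k)"
          and ?Y1 = "prob (count_event M N {t} c \<inter> count_event M N (insert b A) k)"
          and ?q = "prob (count_event M N {t} c)" and ?P = "prob (count_event M N I c)"
        have "(?X1 * ?q) * ?a = (?X1 * ?a) * ?q" by simp
        also have "\<dots> = (prob (count_event M N I c \<inter> count_event M N A k) * ?q) * prob (count_event M N {t', b} r)"
          unfolding s1 by simp
        also have "\<dots> = ?P * (prob (count_event M N {t} c \<inter> count_event M N A k) * prob (count_event M N {t', b} r))"
          unfolding IH by simp
        also have "\<dots> = (?P * ?Y1) * ?a" unfolding s2[symmetric] by simp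
        finally show ?thesis using False by simp
      qed
    qed
  qed
qed

text \<open>Events about later arrival times are not determined by counts at finitely many times,
  hence the generated \<sigma>-algebra. The empty set is included because contradictory
  prescriptions intersect in it, which keeps the generator intersection-stable.\<close>

definition future_algebra :: "'a measure \<Rightarrow> (real \<Rightarrow> 'a \<Rightarrow> enat) \<Rightarrow> real \<Rightarrow> 'a measure" where
  "future_algebra M N t = sigma (space M) ({count_event M N J k | J k. finite J \<and> J \<subseteq> {t..}} \<union> {{}})"

lemma space_future_algebra[simp]: "space (future_algebra M N t) = space M"
  by (auto simp: future_algebra_def space_measure_of_conv)

lemma sets_future_algebra:
  "sets (future_algebra M N t) =
    sigma_sets (space M) ({count_event M N J k | J k. finite J \<and> J \<subseteq> {t..}} \<union> {{}})"
  by (auto simp: future_algebra_def sets_measure_of_conv count_event_def)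

text \<open>Both sides are \<sigma>-additive in B and agree on the intersection-stable
  generator.\<close>

lemma (in prob_space) markov_past_future:
  assumes cp: "counting_process M N" and mp: "markov_property M N"
    and I: "finite I" "I \<subseteq> {0<..}" "t \<in> I" "\<And>v. v \<in> I \<Longrightarrow> v \<le> t"
    and B: "B \<in> sets (future_algebra M N t)"
  shows "B \<in> events" (is ?m)
    and "prob (count_event M N I c \<inter> B) * prob (count_event M N {t} c) =
      prob (count_event M N I c) * prob (count_event M N {t} c \<inter> B)" (is ?eq)
proof -
  let ?G = "{count_event M N J k | J k. finite J \<and> J \<subseteq> {t..}} \<union> {{}}"
  have t: "0 < t" using I(2,3) by auto
  have "I \<subseteq> {0..}" using I(2) by force
  then have C[measurable]: "count_event M N I c \<in> events" by (intro count_event_sets cp I(1))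
  have Q[measurable]: "count_event M N {t} c \<in> events" using t by (intro count_event_sets cp) auto
  have Gm: "?G \<subseteq> events"
  proof
    fix X assume "X \<in> ?G"
    then consider J k where "X = count_event M N J k" "finite J" "J \<subseteq> {t..}" | "X = {}" by blast
    then show "X \<in> events"
    proof cases
      case 1
      then have "J \<subseteq> {0..}" using t by force
      then show ?thesis using 1 by (auto intro: count_event_sets[OF cp])
    qed simp
  qed
  then have sub: "sigma_sets (space M) ?G \<subseteq> events" by (rule sets.sigma_sets_subset)
  then show ?m using B by (auto simp: sets_future_algebra)
  have stable: "Int_stable ?G"
  proof (rule Int_stableI)
    fix X Y assume X: "X \<in> ?G" and Y: "Y \<in> ?G"
    show "X \<inter> Y \<in> ?G"
    proof (cases "X = {} \<or> Y = {}")
      case False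
      then obtain J k J' k' where J: "X = count_event M N J k" "finite J" "J \<subseteq> {t..}"
        and J': "Y = count_event M N J' k'" "finite J'" "J' \<subseteq> {t..}"
        using X Y by blast
      show ?thesis
      proof (cases "\<exists>v\<in>J \<inter> J'. k v \<noteq> k' v")
        case True
        then have "X \<inter> Y = {}" by (auto simp: J(1) J'(1) count_event_def)
        then show ?thesis by simp
      next
        case False
        then have "X \<inter> Y = count_event M N (J \<union> J') (\<lambda>v. if v \<in> J then k v else k' v)"
          by (auto simp: J(1) J'(1) count_event_def)
        then show ?thesis using J J' by blast
      qed
    qed auto
  qed
  have "?G \<subseteq> Pow (space M)" by (auto simp: count_event_def)
  from stable this B[unfolded sets_future_algebra] show ?eq
  proof (induction rule: sigma_sets_induct_disjoint)
    case (basic A)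
    then show ?case using markov_past_future_finite[OF cp mp I] by auto
  next
    case empty
    show ?case by simp
  next
    case (compl A)
    then have Am: "A \<in> events" using sub by blast
    have diff: "prob (X \<inter> (space M - A)) = prob X - prob (X \<inter> A)" if X: "X \<in> events" for X
    proof -
      have "X \<inter> (space M - A) = X - X \<inter> A" using sets.sets_into_space[OF X] by auto
      then show ?thesis using finite_measure_Diff[of X "X \<inter> A"] X Am by simp
    qed
    show ?case unfolding diff[OF C] diff[OF Q] using compl.IH by (simp add: algebra_simps)
  next
    case (union A)
    have Am: "range A \<subseteq> events" using union.hyps(2) sub by blast
    have sums: "(\<lambda>i. prob (X \<inter> A i)) sums prob (X \<inter> (\<Union>i. A i))" if X: "X \<in> events" for X
    proof -
      have "(\<lambda>i. prob (X \<inter> A i)) sums prob (\<Union>i. X \<inter> A i)"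
        using X Am union.hyps(1) by (intro finite_measure_UNION) (auto simp: disjoint_family_on_def)
      then show ?thesis by simp
    qed
    have "(\<lambda>i. prob (count_event M N I c \<inter> A i) * prob (count_event M N {t} c)) sums
        (prob (count_event M N I c \<inter> (\<Union>i. A i)) * prob (count_event M N {t} c))"
      by (intro sums_mult2 sums C)
    moreover have "(\<lambda>i. prob (count_event M N I c \<inter> A i) * prob (count_event M N {t} c)) sums
        (prob (count_event M N I c) * prob (count_event M N {t} c \<inter> (\<Union>i. A i)))"
      unfolding union.IH by (intro sums_mult sums Q)
    ultimately show ?case by (rule sums_unique2)
  qed
qed

lemma measurable_future_count:
  assumes "t \<le> u"
  shows "N u \<in> future_algebra M N t \<rightarrow>\<^sub>M count_space UNIV"
proof -
  have fin: "N u -` {enat n} \<inter> space M \<in> sets (future_algebra M N t)" for n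
  proof -
    have "N u -` {enat n} \<inter> space M = count_event M N {u} (\<lambda>_. n)" by (auto simp: count_event_def)
    then show ?thesis
      unfolding sets_future_algebra using assms by (intro sigma_sets.Basic) blast
  qed
  have inf: "N u -` {\<infinity>} \<inter> space M \<in> sets (future_algebra M N t)"
  proof -
    have "N u -` {\<infinity>} \<inter> space M = space (future_algebra M N t) - (\<Union>n. N u -` {enat n} \<inter> space M)"
      by auto
    also have "\<dots> \<in> sets (future_algebra M N t)"
      by (intro sets.Diff sets.top sets.countable_UN) (use fin in auto)
    finally show ?thesis .
  qed
  have "N u -` {x} \<inter> space (future_algebra M N t) \<in> sets (future_algebra M N t)" for x
    using fin inf by (cases x) auto
  then show ?thesis by (subst measurable_count_space_eq_countable) auto
qed

text \<open>Counts from t on do not locate arrivals before t, so arrival times are truncated below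
  at t. For u \<ge> t the truncated time is at most u exactly if N u \<ge> n.\<close>

lemma measurable_future_arrival:
  assumes cp: "counting_process M N" and t: "0 \<le> t"
  shows "(\<lambda>\<omega>. max (arrival N n \<omega>) t) \<in> borel_measurable (future_algebra M N t)"
proof (rule borel_measurable_iff_le[THEN iffD2], rule allI)
  fix u
  show "{\<omega>\<in>space (future_algebra M N t). max (arrival N n \<omega>) t \<le> u} \<in> sets (future_algebra M N t)"
  proof (cases "t \<le> u")
    case True
    note [measurable] = measurable_future_count[OF True, of N M]
    have "{\<omega>\<in>space (future_algebra M N t). max (arrival N n \<omega>) t \<le> u} =
        N u -` {enat n..} \<inter> space (future_algebra M N t)"
      using True t arrival_properties(3)[OF cp, of _ u n] by auto
    also have "\<dots> \<in> sets (future_algebra M N t)" by measurable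
    finally show ?thesis .
  qed simp
qed

text \<open>A window concerns only the first two gaps, hence is independent of the stream without
  them. With a second window as X this gives a product of two window masses.\<close>

lemma emeasure_jump_window_sdrop:
  assumes "prob_space M" and K: "sets M = sets borel" and X: "X \<in> sets (stream_space borel)"
  shows "emeasure (stream_space M) (jump_window a b s \<inter> sdrop 2 -` X) =
    emeasure (stream_space M) (jump_window a b s) * emeasure (stream_space M) X"
proof -
  interpret prob_space M by fact
  interpret S: prob_space "stream_space M" by (rule prob_space_stream_space)
  have sM[measurable_cong]: "sets (stream_space M) = sets (stream_space borel)"
    using K by (rule sets_stream_space_cong)
  note K[measurable_cong] X[measurable]
  have [simp]: "space M = UNIV" using sets_eq_imp_space_eq[OF K] by simp
  have [simp]: "space (stream_space M) = UNIV" by (simp add: space_stream_space)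
  let ?f = "\<lambda>x y. indicator {(x, y). a < x \<and> x \<le> b \<and> s < x + y} (x, y) :: ennreal"
  \<comment> \<open>The choice g = 1 gives the window mass itself, and the indicator of X gives the
    intersection.\<close>
  have dbl: "(\<integral>\<^sup>+w. ?f (w !! 0) (w !! 1) * g (sdrop 2 w) \<partial>stream_space M) =
    (\<integral>\<^sup>+x. \<integral>\<^sup>+y. ?f x y \<partial>M \<partial>M) * (\<integral>\<^sup>+w. g w \<partial>stream_space M)"
    if g[measurable]: "g \<in> borel_measurable (stream_space borel)" for g
  proof -
    have f[measurable]: "(\<lambda>z. ?f (fst z) (snd z)) \<in> borel_measurable (borel \<Otimes>\<^sub>M borel)"
    proof -
      have "(\<lambda>z::real \<times> real. ?f (fst z) (snd z)) =
        (\<lambda>z. if a < fst z \<and> fst z \<le> b \<and> s < fst z + snd z then 1 else 0)"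
        by (auto simp: indicator_def)
      also have "\<dots> \<in> borel_measurable (borel \<Otimes>\<^sub>M borel)" by measurable
      finally show ?thesis .
    qed
    have f1: "(\<lambda>w. ?f (h w) (k w)) \<in> borel_measurable L"
      if "h \<in> borel_measurable L" "k \<in> borel_measurable L" for h k :: "'c \<Rightarrow> real" and L
      using measurable_compose[OF measurable_Pair[OF that] f] by simp
    have "(\<integral>\<^sup>+w. ?f (w !! 0) (w !! 1) * g (sdrop 2 w) \<partial>stream_space M) =
      (\<integral>\<^sup>+x. \<integral>\<^sup>+w. ?f x (w !! 0) * g (stl w) \<partial>stream_space M \<partial>M)"
      by (subst nn_integral_stream_space) (auto intro!: borel_measurable_times_ennreal f1 simp: numeral_2_eq_2)
    also have "\<dots> = (\<integral>\<^sup>+x. \<integral>\<^sup>+y. \<integral>\<^sup>+w. ?f x y * g w \<partial>stream_space M \<partial>M \<partial>M)"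
      by (intro nn_integral_cong, subst nn_integral_stream_space)
        (auto intro!: borel_measurable_times_ennreal f1)
    also have "\<dots> = (\<integral>\<^sup>+x. \<integral>\<^sup>+y. ?f x y * (\<integral>\<^sup>+w. g w \<partial>stream_space M) \<partial>M \<partial>M)"
      by (intro nn_integral_cong nn_integral_cmult) simp
    also have "\<dots> = (\<integral>\<^sup>+x. (\<integral>\<^sup>+y. ?f x y \<partial>M) * (\<integral>\<^sup>+w. g w \<partial>stream_space M) \<partial>M)"
      by (intro nn_integral_cong nn_integral_multc f1) auto
    also have "\<dots> = (\<integral>\<^sup>+x. \<integral>\<^sup>+y. ?f x y \<partial>M \<partial>M) * (\<integral>\<^sup>+w. g w \<partial>stream_space M)"
    proof (rule nn_integral_multc)
      have "(\<lambda>z. ?f (fst z) (snd z)) \<in> borel_measurable (M \<Otimes>\<^sub>M M)"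
        by (rule f1) measurable
      then have "(\<lambda>(x, y). ?f x y) \<in> borel_measurable (M \<Otimes>\<^sub>M M)" by (simp add: case_prod_beta)
      then show "(\<lambda>x. \<integral>\<^sup>+y. ?f x y \<partial>M) \<in> borel_measurable M"
        by (rule borel_measurable_nn_integral)
    qed
    finally show ?thesis .
  qed
  have Xs: "sdrop 2 -` X \<in> sets (stream_space borel)"
    using measurable_sets[OF measurable_sdrop X, of 2] by (simp add: space_stream_space)
  have ind: "?f (w !! 0) (w !! 1) = indicator (jump_window a b s) w" for w
    by (simp add: jump_window_def indicator_def)
  have "emeasure (stream_space M) (jump_window a b s) =
      (\<integral>\<^sup>+w. ?f (w !! 0) (w !! 1) * 1 \<partial>stream_space M)"
    unfolding ind mult_1_right by (rule nn_integral_indicator[symmetric]) (simp add: sM jump_window_sets)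
  also have "\<dots> = (\<integral>\<^sup>+x. \<integral>\<^sup>+y. ?f x y \<partial>M \<partial>M)"
    using dbl[of "\<lambda>_. 1"] S.emeasure_space_1 by simp
  finally have 1: "emeasure (stream_space M) (jump_window a b s) = \<dots>" .
  have "emeasure (stream_space M) (jump_window a b s \<inter> sdrop 2 -` X) =
      (\<integral>\<^sup>+w. ?f (w !! 0) (w !! 1) * indicator X (sdrop 2 w) \<partial>stream_space M)"
  proof -
    have "(\<integral>\<^sup>+w. ?f (w !! 0) (w !! 1) * indicator X (sdrop 2 w) \<partial>stream_space M) =
      (\<integral>\<^sup>+w. indicator (jump_window a b s \<inter> sdrop 2 -` X) w \<partial>stream_space M)"
      unfolding ind by (intro nn_integral_cong) (auto simp: indicator_def)
    also have "\<dots> = emeasure (stream_space M) (jump_window a b s \<inter> sdrop 2 -` X)"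
      using Xs by (intro nn_integral_indicator) (simp add: sM jump_window_sets sets.Int)
    finally show ?thesis ..
  qed
  also have "\<dots> = (\<integral>\<^sup>+x. \<integral>\<^sup>+y. ?f x y \<partial>M \<partial>M) * emeasure (stream_space M) X"
    by (subst dbl) (auto simp: sM)
  finally show ?thesis unfolding 1 .
qed

text \<open>The past is N a = 0, N b = 1, N t = 1, the present is N t = 1, and the future is N s = 1
  together with a window for the third and fourth gaps.\<close>

lemma (in prob_space) markov_jump_windows:
  assumes cp: "counting_process M N" and mp: "markov_property M N"
    and o: "0 < a" "a < b" "b < t" "t \<le> s"
  defines "E \<equiv> \<lambda>a b s X. {\<omega>\<in>space M. gaps N \<omega> \<in> jump_window a b s \<inter> sdrop 2 -` X}"
  shows "prob (E a b s (jump_window a' b' s')) * prob (E 0 t t UNIV) =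
    prob (E a b t UNIV) * prob (E 0 t s (jump_window a' b' s'))"
proof -
  define c where "c = (\<lambda>v. if v = a then 0 else (1 :: nat))"
  let ?R = "future_algebra M N t"
  let ?T = "\<lambda>n \<omega>. max (arrival N n \<omega>) t"
  have t: "0 < t" using o by simp
  \<comment> \<open>When N t = 1 the second and later arrivals come after t, so truncation is
    invisible and the differences are W 3 and W 3 + W 4.\<close>
  define B where "B = {\<omega>\<in>space ?R. N s \<omega> = enat 1 \<and> a' < ?T 3 \<omega> - ?T 2 \<omega> \<and> ?T 3 \<omega> - ?T 2 \<omega> \<le> b' \<and> s' < ?T 4 \<omega> - ?T 2 \<omega>}"
  have [measurable]: "N s \<in> ?R \<rightarrow>\<^sub>M count_space UNIV" "?T n \<in> borel_measurable ?R" for n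
    using measurable_future_count[OF o(4)] measurable_future_arrival[OF cp, of t n] t by auto
  have B: "B \<in> sets ?R" unfolding B_def by measurable
  have one: "N v \<omega> = enat 1 \<longleftrightarrow> interarrival N 1 \<omega> \<le> v \<and> v < interarrival N 1 \<omega> + interarrival N 2 \<omega>"
    and zero: "N v \<omega> = enat 0 \<longleftrightarrow> v < interarrival N 1 \<omega>"
    if "\<omega> \<in> space M" "0 \<le> v" for \<omega> v
    using count_eq_iff[OF cp that, of 1] count_eq_iff[OF cp that, of 0] that
    by (simp_all add: interarrival_def numeral_2_eq_2)
  have future: "\<omega> \<in> B \<longleftrightarrow> N s \<omega> = enat 1 \<and> sdrop 2 (gaps N \<omega>) \<in> jump_window a' b' s'"
    if \<omega>: "\<omega> \<in> space M" "N t \<omega> = enat 1" for \<omega>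
  proof -
    have lt: "t < arrival N 2 \<omega>"
      using count_eq_iff[OF cp \<omega>(1), of t 1] \<omega>(2) t by (simp add: numeral_2_eq_2)
    moreover have "arrival N 2 \<omega> < arrival N 3 \<omega>" "arrival N 3 \<omega> < arrival N 4 \<omega>"
      using arrival_less_Suc[OF cp \<omega>(1), of 2] arrival_less_Suc[OF cp \<omega>(1), of 3] by simp_all
    ultimately have "?T 2 \<omega> = arrival N 2 \<omega>" "?T 3 \<omega> = arrival N 3 \<omega>" "?T 4 \<omega> = arrival N 4 \<omega>" by simp_all
    then show ?thesis
      using \<omega>(1) by (simp add: B_def jump_window_def sdrop_snth interarrival_def)
  qed
  have pos: "0 < interarrival N 1 \<omega>" if "\<omega> \<in> space M" for \<omega>
    using interarrival_pos[OF cp that, of 0] by simp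
  have win: "gaps N \<omega> \<in> jump_window x y z \<longleftrightarrow>
      x < interarrival N 1 \<omega> \<and> interarrival N 1 \<omega> \<le> y \<and> z < interarrival N 1 \<omega> + interarrival N 2 \<omega>" for \<omega> x y z
    using snth_gaps[of N \<omega> 0] snth_gaps[of N \<omega> 1]
    by (simp add: jump_window_def numeral_2_eq_2 del: snth_gaps)
  have C: "count_event M N {a, b, t} c = {\<omega>\<in>space M. gaps N \<omega> \<in> jump_window a b t}"
    using o zero[of _ a] one[of _ b] one[of _ t] by (auto simp: count_event_def c_def win)
  have Q: "count_event M N {t} c = {\<omega>\<in>space M. gaps N \<omega> \<in> jump_window 0 t t}"
    using o one[of _ t] pos by (auto simp: count_event_def c_def win)
  have CB: "count_event M N {a, b, t} c \<inter> B = E a b s (jump_window a' b' s')"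
  proof (intro set_eqI)
    fix \<omega>
    show "\<omega> \<in> count_event M N {a, b, t} c \<inter> B \<longleftrightarrow> \<omega> \<in> E a b s (jump_window a' b' s')"
    proof (cases "\<omega> \<in> space M \<and> N t \<omega> = enat 1")
      case True
      then show ?thesis
        using future[of \<omega>] one[of \<omega> s] one[of \<omega> t] o unfolding C E_def by (auto simp: win)
    next
      case False
      then show ?thesis
        using one[of \<omega> t] o unfolding C E_def by (auto simp: win)
    qed
  qed
  have QB: "count_event M N {t} c \<inter> B = E 0 t s (jump_window a' b' s')"
  proof (intro set_eqI)
    fix \<omega>
    show "\<omega> \<in> count_event M N {t} c \<inter> B \<longleftrightarrow> \<omega> \<in> E 0 t s (jump_window a' b' s')"
    proof (cases "\<omega> \<in> space M \<and> N t \<omega> = enat 1")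
      case True
      then show ?thesis
        using future[of \<omega>] one[of \<omega> s] one[of \<omega> t] o unfolding Q E_def by (auto simp: win)
    next
      case False
      then show ?thesis
        using one[of \<omega> t] o unfolding Q E_def by (auto simp: win)
    qed
  qed
  have "prob (count_event M N {a, b, t} c \<inter> B) * prob (count_event M N {t} c) =
      prob (count_event M N {a, b, t} c) * prob (count_event M N {t} c \<inter> B)"
    by (rule markov_past_future(2)[OF cp mp _ _ _ _ B]) (use o in auto)
  moreover have "E x y z UNIV = {\<omega>\<in>space M. gaps N \<omega> \<in> jump_window x y z}" for x y z
    by (simp add: E_def)
  ultimately show ?thesis unfolding CB QB unfolding C Q by simp
qed

section \<open>Markov mixed renewal processes have exponential gaps\<close>

lemma (in prob_space) mixed_renewal_prob:
  fixes \<Theta> :: "'a \<Rightarrow> 'b::topological_space"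
  assumes \<Theta>[measurable]: "\<Theta> \<in> borel_measurable M" and K: "K \<in> borel \<rightarrow>\<^sub>M prob_algebra borel"
    and mrp: "mixed_renewal_process M N \<Theta> K" and A: "A \<in> sets (stream_space borel)"
  shows "(\<lambda>\<omega>. measure (stream_space (K (\<Theta> \<omega>))) A) \<in> borel_measurable M"
    and "prob {\<omega>\<in>space M. gaps N \<omega> \<in> A} = (\<integral>\<omega>. measure (stream_space (K (\<Theta> \<omega>))) A \<partial>M)"
proof -
  note kern[measurable] = measurable_prob_algebraD[OF measurable_stream_space_kernel[OF K]] and A[measurable]
  show m[measurable]: "(\<lambda>\<omega>. measure (stream_space (K (\<Theta> \<omega>))) A) \<in> borel_measurable M"
    by measurable
  interpret S: prob_space "stream_space (K x)" for x
    by (rule prob_algebra_kernelD(1)[OF measurable_stream_space_kernel[OF K]])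
  have "(\<integral>\<omega>. measure (stream_space (K (\<Theta> \<omega>))) A \<partial>M) =
      enn2real (\<integral>\<^sup>+\<omega>. ennreal (measure (stream_space (K (\<Theta> \<omega>))) A) \<partial>M)"
    by (rule integral_eq_nn_integral) auto
  moreover have "ennreal (prob {\<omega>\<in>space M. gaps N \<omega> \<in> A}) = (\<integral>\<^sup>+\<omega>. ennreal (measure (stream_space (K (\<Theta> \<omega>))) A) \<partial>M)"
    using mixed_renewal_law[OF \<Theta> K mrp A, of UNIV] by (simp add: emeasure_eq_measure S.emeasure_eq_measure)
  ultimately show "prob {\<omega>\<in>space M. gaps N \<omega> \<in> A} = (\<integral>\<omega>. measure (stream_space (K (\<Theta> \<omega>))) A \<partial>M)"
    by (metis enn2real_ennreal measure_nonneg)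
qed

text \<open>
  By the Markov property the window events at time \<open>t\<close> are, given \<open>N t = 1\<close>, independent of
  \<open>(W 3, W 4)\<close>, which under the conditional law given \<open>\<Theta>\<close> is a copy of \<open>(W 1, W 2)\<close>.
  Hence \<open>h = c\<^sub>1 e\<^sub>1 - c\<^sub>2 e\<^sub>2\<close> is orthogonal to \<open>e\<^sub>1\<close> and to \<open>e\<^sub>2\<close>, so that \<open>E (h\<^sup>2) = 0\<close>.
\<close>

lemma (in prob_space) markov_mixed_renewal_windows:
  fixes \<Theta> :: "'a \<Rightarrow> 'b::topological_space"
  assumes cp: "counting_process M N" and mp: "markov_property M N"
    and \<Theta>: "\<Theta> \<in> borel_measurable M" and K: "K \<in> borel \<rightarrow>\<^sub>M prob_algebra borel"
    and mrp: "mixed_renewal_process M N \<Theta> K" and o: "0 < a" "a < b" "b < t" "t \<le> s"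
  defines "m \<equiv> \<lambda>a b s \<omega>. measure (stream_space (K (\<Theta> \<omega>))) (jump_window a b s)"
  shows "AE \<omega> in M. (\<integral>\<omega>. m 0 t t \<omega> \<partial>M) * m a b s \<omega> = (\<integral>\<omega>. m a b t \<omega> \<partial>M) * m 0 t s \<omega>"
proof -
  interpret S: prob_space "stream_space (K x)" for x
    by (rule prob_algebra_kernelD(1)[OF measurable_stream_space_kernel[OF K]])
  have m[measurable]: "m a b s \<in> borel_measurable M" for a b s
    unfolding m_def by (rule mixed_renewal_prob(1)[OF \<Theta> K mrp jump_window_sets])
  have int[simp]: "integrable M (\<lambda>\<omega>. m a b s \<omega> * m a' b' s' \<omega>)" for a b s a' b' s'
    by (rule integrable_const_bound[of _ 1]) (simp add: m_def mult_le_one, measurable)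
  \<comment> \<open>By \<open>single\<close>, c1 is the probability of N t = 1 and c2 that of N a =
    0, N b = N t = 1. Neither constant involves s or a single value of \<Theta>.\<close>
  define c1 where "c1 = (\<integral>\<omega>. m 0 t t \<omega> \<partial>M)"
  define c2 where "c2 = (\<integral>\<omega>. m a b t \<omega> \<partial>M)"
  have single: "prob {\<omega>\<in>space M. gaps N \<omega> \<in> jump_window a b s \<inter> sdrop 2 -` UNIV} = (\<integral>\<omega>. m a b s \<omega> \<partial>M)" for a b s
    using mixed_renewal_prob(2)[OF \<Theta> K mrp jump_window_sets, of a b s] by (simp add: m_def)
  have double: "prob {\<omega>\<in>space M. gaps N \<omega> \<in> jump_window a b s \<inter> sdrop 2 -` jump_window a' b' s'} =
      (\<integral>\<omega>. m a b s \<omega> * m a' b' s' \<omega> \<partial>M)" for a b s a' b' s'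
  proof -
    have [measurable]: "sdrop 2 -` jump_window a' b' s' \<in> sets (stream_space borel)"
      using measurable_sets[OF measurable_sdrop jump_window_sets, of 2 a' b' s'] by (simp add: space_stream_space)
    have "measure (stream_space (K (\<Theta> \<omega>))) (jump_window a b s \<inter> sdrop 2 -` jump_window a' b' s') =
        m a b s \<omega> * m a' b' s' \<omega>" for \<omega>
      using emeasure_jump_window_sdrop[OF prob_algebra_kernelD(1,2)[OF K] jump_window_sets, of "\<Theta> \<omega>" a b s a' b' s']
      by (simp add: m_def measure_def enn2real_mult)
    then show ?thesis
      using mixed_renewal_prob(2)[OF \<Theta> K mrp, of "jump_window a b s \<inter> sdrop 2 -` jump_window a' b' s'"] by simp
  qed
  have key: "(\<integral>\<omega>. m a b s \<omega> * m a' b' s' \<omega> \<partial>M) * c1 = c2 * (\<integral>\<omega>. m 0 t s \<omega> * m a' b' s' \<omega> \<partial>M)" for a' b' s'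
    using markov_jump_windows[OF cp mp o, of a' b' s'] unfolding single double c1_def c2_def .
  let ?h = "\<lambda>\<omega>. (c1 * m a b s \<omega> - c2 * m 0 t s \<omega>)\<^sup>2"
  have eq: "?h \<omega> = c1\<^sup>2 * (m a b s \<omega> * m a b s \<omega>) - 2 * c1 * c2 * (m a b s \<omega> * m 0 t s \<omega>) + c2\<^sup>2 * (m 0 t s \<omega> * m 0 t s \<omega>)" for \<omega>
    by (simp add: power2_eq_square algebra_simps)
  let ?A = "\<integral>\<omega>. m a b s \<omega> * m a b s \<omega> \<partial>M" and ?B = "\<integral>\<omega>. m a b s \<omega> * m 0 t s \<omega> \<partial>M"
    and ?C = "\<integral>\<omega>. m 0 t s \<omega> * m 0 t s \<omega> \<partial>M"
  have k1: "?A * c1 = c2 * ?B" using key[of a b s] by (simp add: mult.commute)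
  have k2: "?B * c1 = c2 * ?C" using key[of 0 t s] .
  have "(\<integral>\<omega>. ?h \<omega> \<partial>M) = c1\<^sup>2 * ?A - 2 * c1 * c2 * ?B + c2\<^sup>2 * ?C"
    unfolding eq by simp
  also have "\<dots> = c1 * (?A * c1 - c2 * ?B) - c2 * (?B * c1 - c2 * ?C)"
    by (simp add: power2_eq_square algebra_simps)
  also have "\<dots> = 0" using k1 k2 by simp
  finally have "(\<integral>\<omega>. ?h \<omega> \<partial>M) = 0" .
  moreover have "integrable M ?h" unfolding eq by simp
  ultimately have "AE \<omega> in M. ?h \<omega> = 0"
    by (subst (asm) integral_nonneg_eq_0_iff_AE) auto
  then show ?thesis by (auto simp: c1_def c2_def)
qed

text \<open>Outside one null set the window identities hold for all rational parameters. The
  averaged constants in them are then eliminated, which leaves a statement on the single law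
  \<open>K (\<Theta> \<omega>)\<close>.\<close>

lemma (in prob_space) markov_mixed_renewal_exponential:
  fixes \<Theta> :: "'a \<Rightarrow> 'b::topological_space" and F :: "'b \<Rightarrow> real \<Rightarrow> real"
  assumes cp: "counting_process M N" and mp: "markov_property M N"
    and \<Theta>: "\<Theta> \<in> borel_measurable M" and K: "K \<in> borel \<rightarrow>\<^sub>M prob_algebra borel"
    and mrp: "mixed_renewal_process M N \<Theta> K"
    and K0: "\<And>\<theta>. measure (K \<theta>) {..0} = 0" and F: "\<And>\<theta> t. 0 \<le> t \<Longrightarrow> F \<theta> t = measure (K \<theta>) {..t}"
    and L: "AE \<omega> in M. \<Theta> \<omega> \<notin> L"
    and C1: "\<And>\<theta>. \<theta> \<notin> L \<Longrightarrow> F \<theta> C1_differentiable_on {0<..}"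
    and pos: "\<And>\<theta> t. \<theta> \<notin> L \<Longrightarrow> 0 < t \<Longrightarrow> 0 < deriv (F \<theta>) t"
    and d0: "\<And>\<theta>. \<theta> \<notin> L \<Longrightarrow> (deriv (F \<theta>) \<longlongrightarrow> p \<theta>) (at_right 0)"
    and p: "\<And>\<theta>. \<theta> \<notin> L \<Longrightarrow> 0 < p \<theta>"
  shows "AE \<omega> in M. K (\<Theta> \<omega>) = exponential_law (p (\<Theta> \<omega>))"
proof -
  define m where "m = (\<lambda>a b s \<omega>. measure (stream_space (K (\<Theta> \<omega>))) (jump_window a b s))"
  define c where "c = (\<lambda>a b t. \<integral>\<omega>. m a b t \<omega> \<partial>M)"
  interpret S: prob_space "stream_space (K x)" for x
    by (rule prob_algebra_kernelD(1)[OF measurable_stream_space_kernel[OF K]])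
  note KP = prob_algebra_kernelD(1,2)[OF K]
  have mpos: "0 < m 0 t s \<omega>" if "\<Theta> \<omega> \<notin> L" "0 < t" "t \<le> s" for \<omega> t s
    unfolding m_def
    by (rule jump_window_pos[OF KP measure_interval_pos[OF KP F C1 pos]]) (use that in auto)
  have meas[measurable]: "m a b s \<in> borel_measurable M" for a b s
    unfolding m_def by (rule mixed_renewal_prob(1)[OF \<Theta> K mrp jump_window_sets])
  \<comment> \<open>The average of an almost surely positive function is positive, so this constant
    can be cancelled.\<close>
  have cpos: "0 < c 0 t t" if t: "0 < t" for t
  proof (rule ccontr)
    assume "\<not> 0 < c 0 t t"
    moreover have "0 \<le> c 0 t t" unfolding c_def by (rule integral_nonneg_AE) (simp add: m_def)
    ultimately have "(\<integral>\<omega>. m 0 t t \<omega> \<partial>M) = 0" by (simp add: c_def)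
    moreover have "integrable M (m 0 t t)"
      by (rule integrable_const_bound[of _ 1]) (simp add: m_def, measurable)
    ultimately have "AE \<omega> in M. m 0 t t \<omega> = 0"
      by (subst (asm) integral_nonneg_eq_0_iff_AE) (auto simp: m_def)
    with L have "AE \<omega> in M. False"
      by eventually_elim (use mpos[of _ t t] t in force)
    then show False by simp
  qed
  \<comment> \<open>The parameters range over the countable type \<open>rat\<close>, so the
    exceptional sets can be united.\<close>
  have "AE \<omega> in M. 0 < real_of_rat a \<and> a < b \<and> b < t \<and> t \<le> s \<longrightarrow>
      c 0 (of_rat t) (of_rat t) * m (of_rat a) (of_rat b) (of_rat s) \<omega> =
      c (of_rat a) (of_rat b) (of_rat t) * m 0 (of_rat t) (of_rat s) \<omega>" for a b t s
  proof (cases "0 < real_of_rat a \<and> a < b \<and> b < t \<and> t \<le> s")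
    case True
    then show ?thesis
      using markov_mixed_renewal_windows[OF cp mp \<Theta> K mrp, of "of_rat a" "of_rat b" "of_rat t" "of_rat s"]
      by (simp add: m_def c_def of_rat_less of_rat_less_eq)
  qed auto
  then have "AE \<omega> in M. \<forall>a b t s. 0 < real_of_rat a \<and> a < b \<and> b < t \<and> t \<le> s \<longrightarrow>
      c 0 (of_rat t) (of_rat t) * m (of_rat a) (of_rat b) (of_rat s) \<omega> =
      c (of_rat a) (of_rat b) (of_rat t) * m 0 (of_rat t) (of_rat s) \<omega>"
    by (simp only: AE_all_countable) blast
  with L show ?thesis
  proof eventually_elim
    case (elim \<omega>)
    have window_eq: "c 0 t t * m a b s \<omega> = c a b t * m 0 t s \<omega>"
      if r: "a \<in> \<rat>" "b \<in> \<rat>" "t \<in> \<rat>" "s \<in> \<rat>" and o: "0 < a" "a < b" "b < t" "t \<le> s" for a b t s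
    proof -
      obtain a' b' t' s' where "a = of_rat a'" "b = of_rat b'" "t = of_rat t'" "s = of_rat s'"
        using r by (auto elim!: Rats_cases)
      then show ?thesis using elim(2) o by (auto simp: of_rat_less of_rat_less_eq)
    qed
    show ?case
    proof (rule exponential_law_of_proportional_windows[OF KP K0 F
          C1[OF elim(1)] pos[OF elim(1)] d0[OF elim(1)] p[OF elim(1)]])
      fix a b t s s' :: real
      assume r: "a \<in> \<rat>" "b \<in> \<rat>" "t \<in> \<rat>" "s \<in> \<rat>" "s' \<in> \<rat>" and o: "0 < a" "a < b" "b < t" "t \<le> s" "t \<le> s'"
      have 1: "c 0 t t * m a b s \<omega> = c a b t * m 0 t s \<omega>" "c 0 t t * m a b s' \<omega> = c a b t * m 0 t s' \<omega>"
        using window_eq r o by blast+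
      \<comment> \<open>The constant \<open>c a b t\<close> depends on the window but not on s;
        comparing s with s' removes it.\<close>
      have "c 0 t t * (m a b s \<omega> * m 0 t s' \<omega>) = (c 0 t t * m a b s \<omega>) * m 0 t s' \<omega>" by simp
      also have "\<dots> = (c a b t * m 0 t s' \<omega>) * m 0 t s \<omega>" unfolding 1 by simp
      also have "\<dots> = c 0 t t * (m a b s' \<omega> * m 0 t s \<omega>)" unfolding 1[symmetric] by simp
      finally have "m a b s \<omega> * m 0 t s' \<omega> = m a b s' \<omega> * m 0 t s \<omega>" using cpos[of t] o by simp
      then show "measure (stream_space (K (\<Theta> \<omega>))) (jump_window a b s) * measure (stream_space (K (\<Theta> \<omega>))) (jump_window 0 t s') =
          measure (stream_space (K (\<Theta> \<omega>))) (jump_window a b s') * measure (stream_space (K (\<Theta> \<omega>))) (jump_window 0 t s)"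
        by (simp add: m_def)
    qed auto
  qed
qed

section \<open>Mixed renewal processes with exponential gaps\<close>

lemma restart_restart: "restart l u (restart k s w) = restart (k + l) (s + u) w"
proof (induction k arbitrary: s w)
  case 0
  show ?case by (cases l) (simp_all add: algebra_simps)
next
  case (Suc k)
  show ?case using Suc.IH[of "s - shd w" "stl w"] by (simp add: algebra_simps)
qed

text \<open>Finiteness is required because \<open>increments_in\<close> never matches an infinite
  increment, while a set \<open>B j\<close> may contain \<infinity>.\<close>

lemma increments_in_iff:
  assumes cp: "counting_process M N" and \<omega>: "\<omega> \<in> space M" and t0: "t 0 = (0 :: real)"
    and mono: "strict_mono_on {0..m} t" and fin: "\<And>j. j \<le> m \<Longrightarrow> N (t j) \<omega> \<noteq> \<infinity>"
  shows "increments_in (map (\<lambda>j. (t j - t (j - 1), B j)) [1..<Suc m]) (gaps N \<omega>) \<longleftrightarrow>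
    (\<forall>j\<in>{1..m}. N (t j) \<omega> - N (t (j - 1)) \<omega> \<in> B j)"
proof -
  have less: "t i < t j" if "i < j" "j \<le> m" for i j
    using mono that by (auto simp: strict_mono_on_def)
  have nn: "0 \<le> t i" if "i \<le> m" for i
    using less[of 0 i] that t0 by (cases "i = 0") auto
  \<comment> \<open>The claim is generalized to start at time t i with k jumps already made, and the
    induction descends from i = m.\<close>
  have "increments_in (map (\<lambda>j. (t j - t (j - 1), B j)) [Suc i..<Suc m]) (restart k (t i) (gaps N \<omega>)) \<longleftrightarrow>
    (\<forall>j\<in>{Suc i..m}. N (t j) \<omega> - N (t (j - 1)) \<omega> \<in> B j)" if "i \<le> m" "N (t i) \<omega> = enat k" for i k
    using that
  proof (induction i arbitrary: k rule: inc_induct)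
    case base
    then show ?case by simp
  next
    case (step i)
    let ?w = "restart k (t i) (gaps N \<omega>)"
    let ?rest = "map (\<lambda>j. (t j - t (j - 1), B j)) [Suc (Suc i)..<Suc m]"
    have i: "i < m" "0 \<le> t i" "t i < t (Suc i)" "0 \<le> t (Suc i)"
      using step.hyps nn[of i] nn[of "Suc i"] less[of i "Suc i"] by auto
    obtain n where n: "N (t (Suc i)) \<omega> = enat n" using fin[of "Suc i"] i(1) by auto
    have "enat k \<le> enat n"
      using counting_processD(3)[OF cp \<omega> i(2), of "t (Suc i)"] i(3) n step.prems by simp
    then have kn: "k \<le> n" by simp
    have k: "jumps_by k (t i) (gaps N \<omega>)"
      using step.prems count_eq_iff_jumps_by[OF cp \<omega> i(2)] by simp
    have jumps: "jumps_by l (t (Suc i) - t i) ?w \<longleftrightarrow> n = k + l" for l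
    proof -
      have "jumps_by l (t (Suc i) - t i) ?w \<longleftrightarrow> jumps_by (k + l) (t i + (t (Suc i) - t i)) (gaps N \<omega>)"
        using jumps_by_add_iff[of "t (Suc i) - t i" k "t i" "gaps N \<omega>" "k + l"] k i(3) by auto
      also have "\<dots> \<longleftrightarrow> N (t (Suc i)) \<omega> = enat (k + l)"
        using count_eq_iff_jumps_by[OF cp \<omega> i(4)] by simp
      finally show ?thesis by (simp add: n)
    qed
    have upt: "[Suc i..<Suc m] = Suc i # [Suc (Suc i)..<Suc m]" using i(1) by (simp add: upt_conv_Cons)
    have "increments_in (map (\<lambda>j. (t j - t (j - 1), B j)) [Suc i..<Suc m]) ?w \<longleftrightarrow>
        (\<exists>l. enat l \<in> B (Suc i) \<and> n = k + l \<and> increments_in ?rest (restart l (t (Suc i) - t i) ?w))"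
      unfolding upt by (simp add: jumps del: upt_Suc)
    also have "\<dots> \<longleftrightarrow> enat (n - k) \<in> B (Suc i) \<and> increments_in ?rest (restart n (t (Suc i)) (gaps N \<omega>))"
    proof -
      have "restart l (t (Suc i) - t i) ?w = restart n (t (Suc i)) (gaps N \<omega>)" if "n = k + l" for l
        using that by (simp add: restart_restart)
      then show ?thesis using kn by (auto simp del: upt_Suc)
    qed
    also have "\<dots> \<longleftrightarrow> N (t (Suc i)) \<omega> - N (t i) \<omega> \<in> B (Suc i) \<and>
        (\<forall>j\<in>{Suc (Suc i)..m}. N (t j) \<omega> - N (t (j - 1)) \<omega> \<in> B j)"
      using step.IH[OF n] by (simp add: n step.prems del: upt_Suc)
    also have "\<dots> \<longleftrightarrow> (\<forall>j\<in>{Suc i..m}. N (t j) \<omega> - N (t (j - 1)) \<omega> \<in> B j)"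
    proof -
      have "{Suc i..m} = insert (Suc i) {Suc (Suc i)..m}" using i(1) by auto
      then show ?thesis by simp
    qed
    finally show ?case .
  qed
  from this[of 0 0] show ?thesis
    using counting_processD(2)[OF cp \<omega>] by (simp add: t0 zero_enat_def del: upt_Suc)
qed

text \<open>The rate is replaced by 1 where it is not positive, as \<^term>\<open>poisson_pmf\<close> is unspecified there.\<close>

definition poisson_law :: "real \<Rightarrow> real \<Rightarrow> enat measure" where
  "poisson_law u r = measure_pmf (map_pmf enat (poisson_pmf (u * (if 0 < r then r else 1))))"

lemma poisson_law_pos: "0 < r \<Longrightarrow> poisson_law u r = measure_pmf (map_pmf enat (poisson_pmf (u * r)))"
  by (simp add: poisson_law_def)

lemma prob_space_poisson_law: "prob_space (poisson_law u r)"
  unfolding poisson_law_def by (rule prob_space_measure_pmf)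

lemma sets_poisson_law[simp]: "sets (poisson_law u r) = UNIV"
  by (simp add: poisson_law_def)

lemma measurable_poisson_law:
  assumes "0 < u"
  shows "(\<lambda>r. measure (poisson_law u r) B) \<in> borel_measurable borel"
proof -
  have "emeasure (poisson_law u r) B =
      (\<Sum>k. indicator B (enat k) * ennreal (poisson_weight (u * (if 0 < r then r else 1)) k))" for r
    unfolding poisson_law_def using assms by (intro emeasure_poisson_pmf_enat) auto
  moreover have "(\<lambda>r. \<Sum>k. indicator B (enat k) * ennreal (poisson_weight (u * (if 0 < r then r else 1)) k))
      \<in> borel_measurable borel" by measurable
  ultimately have m: "(\<lambda>r. emeasure (poisson_law u r) B) \<in> borel_measurable borel" by simp
  show "(\<lambda>r. measure (poisson_law u r) B) \<in> borel_measurable borel"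
    unfolding measure_def using m by measurable
qed

lemma measurable_count_increment:
  assumes "counting_process M N" "0 \<le> s" "0 \<le> t"
  shows "(\<lambda>\<omega>. N t \<omega> - N s \<omega>) \<in> M \<rightarrow>\<^sub>M count_space UNIV"
proof (rule measurable_compose_countable[where f="\<lambda>i \<omega>. i - N s \<omega>"])
  show "N t \<in> M \<rightarrow>\<^sub>M count_space UNIV" by (rule counting_processD(1)[OF assms(1,3)])
  fix i :: enat
  show "(\<lambda>\<omega>. i - N s \<omega>) \<in> M \<rightarrow>\<^sub>M count_space UNIV"
    by (rule measurable_compose[OF counting_processD(1)[OF assms(1,2)]]) simp
qed

lemma ennreal_prod_list_measure_poisson:
  "(\<Prod>(u, B)\<leftarrow>xs. emeasure (poisson_law u r) B) = ennreal (\<Prod>(u, B)\<leftarrow>xs. measure (poisson_law u r) B)"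
proof (induction xs)
  case (Cons x xs)
  interpret prob_space "poisson_law (fst x) r" by (rule prob_space_poisson_law)
  have "0 \<le> (\<Prod>(u, B)\<leftarrow>xs. measure (poisson_law u r) B)"
    by (intro prod_list_nonneg) auto
  then show ?case using Cons.IH by (simp add: case_prod_unfold emeasure_eq_measure ennreal_mult)
qed simp

text \<open>The rate \<Psi> is tied to \<Theta> only almost surely, which accommodates an arbitrary
  measurable extension of p(\<Theta>) to the null event \<Theta> \<in> L.\<close>

locale exponential_mixed_renewal = prob_space M for M :: "'a measure" +
  fixes N :: "real \<Rightarrow> 'a \<Rightarrow> enat" and \<Theta> :: "'a \<Rightarrow> 'b::topological_space"
    and K :: "'b \<Rightarrow> real measure" and \<Psi> :: "'a \<Rightarrow> real"
  assumes cp: "counting_process M N" and \<Theta>[measurable]: "\<Theta> \<in> borel_measurable M"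
    and K: "K \<in> borel \<rightarrow>\<^sub>M prob_algebra borel" and mrp: "mixed_renewal_process M N \<Theta> K"
    and \<Psi>[measurable]: "\<Psi> \<in> borel_measurable M" and \<Psi>_pos: "AE \<omega> in M. 0 < \<Psi> \<omega>"
    and K_exp: "AE \<omega> in M. K (\<Theta> \<omega>) = exponential_law (\<Psi> \<omega>)"
begin

abbreviation "G \<equiv> generated_sigma M \<Psi>"

sublocale G: sigma_finite_subalgebra M G
  by (rule sigma_finite_generated[OF \<Psi>])

lemma gaps_measurable[measurable]: "gaps N \<in> M \<rightarrow>\<^sub>M stream_space borel"
  by (intro measurable_gaps mixed_renewal_interarrival_measurable[OF mrp])

lemma \<Psi>_measurable_G: "\<Psi> \<in> borel_measurable G"
  by (rule measurable_vimage_algebra1) auto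

text \<open>
  The rate is the function \<open>-ln (1 - K \<theta> {..1})\<close> of \<open>\<Theta>\<close>, which is Borel measurable, so that
  every event of \<open>\<sigma>(\<Psi>)\<close> is almost surely an event of \<open>\<sigma>(\<Theta>)\<close>.
\<close>

lemma emeasure_increments:
  assumes xs: "\<And>u B. (u, B) \<in> set xs \<Longrightarrow> 0 < u" and B[measurable]: "B \<in> sets borel"
  shows "emeasure M {\<omega>\<in>space M. increments_in xs (gaps N \<omega>) \<and> \<Psi> \<omega> \<in> B} =
    (\<integral>\<^sup>+\<omega>. (\<Prod>(u, B)\<leftarrow>xs. emeasure (poisson_law u (\<Psi> \<omega>)) B) * indicator B (\<Psi> \<omega>) \<partial>M)"
proof -
  define q where "q = (\<lambda>\<theta>. - ln (1 - measure (K \<theta>) {..1}))"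
  note [measurable] = measurable_prob_algebraD[OF K]
  have q[measurable]: "q \<in> borel_measurable borel"
    unfolding q_def by measurable
  have q\<Psi>: "AE \<omega> in M. q (\<Theta> \<omega>) = \<Psi> \<omega>"
    using K_exp \<Psi>_pos
  proof eventually_elim
    case (elim \<omega>)
    have "emeasure (exponential_law (\<Psi> \<omega>)) {..1} = ennreal (1 - exp (- \<Psi> \<omega>))"
      using emeasure_erlang_density[OF elim(2), of 0 1] by (simp add: erlang_CDF_def)
    then have "measure (K (\<Theta> \<omega>)) {..1} = 1 - exp (- \<Psi> \<omega>)"
      using elim by (simp add: measure_def)
    then show ?case by (simp add: q_def)
  qed
  have A: "{w. increments_in xs w} \<in> sets (stream_space borel)"
    using predE[OF measurable_increments_in[of "\<lambda>w. w" "stream_space borel" xs]]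
    by (simp add: space_stream_space)
  have qB[measurable]: "q -` B \<in> sets borel"
    using measurable_sets[OF q B] by simp
  have "emeasure M {\<omega>\<in>space M. increments_in xs (gaps N \<omega>) \<and> \<Psi> \<omega> \<in> B} =
      emeasure M {\<omega>\<in>space M. gaps N \<omega> \<in> {w. increments_in xs w} \<and> \<Theta> \<omega> \<in> q -` B}"
    by (rule emeasure_eq_AE) (use q\<Psi> in \<open>auto elim!: eventually_mono\<close>)
  also have "\<dots> = (\<integral>\<^sup>+\<omega>. emeasure (stream_space (K (\<Theta> \<omega>))) {w. increments_in xs w} * indicator (q -` B) (\<Theta> \<omega>) \<partial>M)"
    by (rule mixed_renewal_law[OF \<Theta> K mrp A qB])
  also have "\<dots> = (\<integral>\<^sup>+\<omega>. (\<Prod>(u, B)\<leftarrow>xs. emeasure (poisson_law u (\<Psi> \<omega>)) B) * indicator B (\<Psi> \<omega>) \<partial>M)"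
  proof (rule nn_integral_cong_AE)
    show "AE \<omega> in M. emeasure (stream_space (K (\<Theta> \<omega>))) {w. increments_in xs w} * indicator (q -` B) (\<Theta> \<omega>) =
        (\<Prod>(u, B)\<leftarrow>xs. emeasure (poisson_law u (\<Psi> \<omega>)) B) * indicator B (\<Psi> \<omega>)"
      using K_exp \<Psi>_pos q\<Psi>
    proof eventually_elim
      case (elim \<omega>)
      have "emeasure (stream_space (exponential_law (\<Psi> \<omega>))) {w. increments_in xs w} =
          (\<Prod>(u, B)\<leftarrow>xs. emeasure (measure_pmf (map_pmf enat (poisson_pmf (\<Psi> \<omega> * u)))) B)"
        by (rule emeasure_increments_in_exponential[OF elim(2) xs])
      also have "\<dots> = (\<Prod>(u, B)\<leftarrow>xs. emeasure (poisson_law u (\<Psi> \<omega>)) B)"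
        using elim(2) by (simp add: poisson_law_def mult.commute)
      finally show ?case using elim by (simp add: indicator_def)
    qed
  qed
  finally show ?thesis .
qed

text \<open>Every event of \<sigma>(\<Psi>) has the form \<Psi> \<in> B, and
  \<open>emeasure_increments\<close> evaluates the defining integral over it.\<close>

lemma cond_prob_increments_in:
  assumes xs: "\<And>u B. (u, B) \<in> set xs \<Longrightarrow> 0 < u"
  shows "AE \<omega> in M. cond_prob_of M G {\<omega>\<in>space M. increments_in xs (gaps N \<omega>)} \<omega> =
    (\<Prod>(u, B)\<leftarrow>xs. measure (poisson_law u (\<Psi> \<omega>)) B)"
proof (rule G.real_cond_exp_charact)
  let ?E = "{\<omega>\<in>space M. increments_in xs (gaps N \<omega>)}"
  let ?g = "\<lambda>r. \<Prod>(u, B)\<leftarrow>xs. measure (poisson_law u r) B"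
  have Em[measurable]: "?E \<in> events" by measurable
  have nn: "0 \<le> ?g r" for r by (intro prod_list_nonneg) auto
  have le1: "?g r \<le> 1" for r
  proof (induction xs)
    case (Cons x xs)
    interpret P: prob_space "poisson_law (fst x) r" by (rule prob_space_poisson_law)
    have "0 \<le> (\<Prod>(u, B)\<leftarrow>xs. measure (poisson_law u r) B)" by (intro prod_list_nonneg) auto
    then show ?case using Cons.IH P.prob_le_1 by (simp add: case_prod_unfold mult_le_one)
  qed simp
  have g[measurable]: "?g \<in> borel_measurable borel"
    using xs
  proof (induction xs)
    case (Cons x xs)
    obtain u B where x: "x = (u, B)" by (cases x)
    have [measurable]: "(\<lambda>r. measure (poisson_law u r) B) \<in> borel_measurable borel"
      using Cons.prems[of u B] by (intro measurable_poisson_law) (simp add: x)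
    have [measurable]: "(\<lambda>r. \<Prod>(u, B)\<leftarrow>xs. measure (poisson_law u r) B) \<in> borel_measurable borel"
      using Cons.prems by (intro Cons.IH) auto
    show ?case by (simp add: x)
  qed simp
  show int: "integrable M (\<lambda>\<omega>. ?g (\<Psi> \<omega>))"
    by (rule integrable_const_bound[of _ 1]) (simp add: nn le1, measurable)
  show "integrable M (indicat_real ?E)"
    by (rule integrable_real_indicator[OF Em]) (simp only: emeasure_eq_measure ennreal_less_top infinity_ennreal_def)
  show "(\<lambda>\<omega>. ?g (\<Psi> \<omega>)) \<in> borel_measurable G"
    by (rule measurable_compose[OF \<Psi>_measurable_G g])
  fix A assume "A \<in> sets G"
  then obtain B where B[measurable]: "B \<in> sets borel" and A: "A = \<Psi> -` B \<inter> space M"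
    by (auto simp: sets_vimage_algebra2)
  have "(\<integral>\<omega>\<in>A. indicat_real ?E \<omega> \<partial>M) = (\<integral>\<omega>. indicat_real {\<omega>\<in>space M. increments_in xs (gaps N \<omega>) \<and> \<Psi> \<omega> \<in> B} \<omega> \<partial>M)"
    unfolding set_lebesgue_integral_def A by (intro Bochner_Integration.integral_cong) (auto simp: indicator_def)
  also have "\<dots> = prob {\<omega>\<in>space M. increments_in xs (gaps N \<omega>) \<and> \<Psi> \<omega> \<in> B}"
    by simp
  finally have "ennreal (\<integral>\<omega>\<in>A. indicat_real ?E \<omega> \<partial>M) =
      (\<integral>\<^sup>+\<omega>. (\<Prod>(u, B)\<leftarrow>xs. emeasure (poisson_law u (\<Psi> \<omega>)) B) * indicator B (\<Psi> \<omega>) \<partial>M)"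
    using emeasure_increments[OF xs B] by (simp add: emeasure_eq_measure)
  also have "\<dots> = (\<integral>\<^sup>+\<omega>. ennreal (indicat_real A \<omega> * ?g (\<Psi> \<omega>)) \<partial>M)"
    by (intro nn_integral_cong) (auto simp: ennreal_prod_list_measure_poisson A indicator_def)
  also have "\<dots> = ennreal (\<integral>\<omega>\<in>A. ?g (\<Psi> \<omega>) \<partial>M)"
    unfolding set_lebesgue_integral_def real_scaleR_def
  proof (rule nn_integral_eq_integral)
    have "A \<in> events" unfolding A by measurable
    then show "integrable M (\<lambda>\<omega>. indicat_real A \<omega> * ?g (\<Psi> \<omega>))"
      using integrable_real_mult_indicator[OF _ int, of A] by (simp add: mult.commute)
  qed (simp add: nn)
  finally show "(\<integral>\<omega>\<in>A. indicat_real ?E \<omega> \<partial>M) = (\<integral>\<omega>\<in>A. ?g (\<Psi> \<omega>) \<partial>M)"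
    by (subst (asm) ennreal_inj) (auto simp: set_lebesgue_integral_def nn intro!: integral_nonneg_AE)
qed

text \<open>For the single entry (t, \<open>UNIV\<close>) the event \<open>increments_in\<close>
  says that the count at t is finite, and the Poisson law gives it conditional probability
  one.\<close>

lemma AE_count_finite:
  assumes "0 \<le> t"
  shows "AE \<omega> in M. N t \<omega> \<noteq> \<infinity>"
proof (cases "t = 0")
  case True
  then show ?thesis using counting_processD(2)[OF cp] by auto
next
  case False
  then have t: "0 < t" using assms by simp
  let ?E = "{\<omega>\<in>space M. increments_in [(t, UNIV)] (gaps N \<omega>)}"
  have E[measurable]: "?E \<in> events" by measurable
  have int: "integrable M (indicat_real ?E)"
    by (rule integrable_real_indicator[OF E]) (simp only: emeasure_eq_measure ennreal_less_top infinity_ennreal_def)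
  have "AE \<omega> in M. cond_prob_of M G ?E \<omega> = 1"
    using cond_prob_increments_in[of "[(t, UNIV)]"] t prob_space.prob_space[OF prob_space_poisson_law]
    by (simp add: poisson_law_def)
  then have "(\<integral>\<omega>. cond_prob_of M G ?E \<omega> \<partial>M) = (\<integral>\<omega>. 1 \<partial>M)"
    by (intro integral_cong_AE) auto
  then have "prob ?E = 1"
    unfolding G.real_cond_exp_int(2)[OF int] by (simp add: prob_space Int_absorb2 subset_eq del: increments_in.simps)
  then have "AE \<omega> in M. \<omega> \<in> ?E" using AE_in_set_eq_1[OF E] by blast
  then show ?thesis
  proof eventually_elim
    case (elim \<omega>)
    then obtain k where "jumps_by k t (gaps N \<omega>)" by auto
    then have "N t \<omega> = enat k" using count_eq_iff_jumps_by[OF cp _ assms, of \<omega>] elim by simp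
    then show ?case by simp
  qed
qed

text \<open>Indices outside J receive the set \<open>UNIV\<close>, of Poisson mass one, so that the
  list covers consecutive intervals from 0. Almost sure finiteness of the counts permits the passage
  to \<open>increments_in\<close>.\<close>

lemma cond_prob_increments:
  fixes t :: "nat \<Rightarrow> real"
  assumes t0: "t 0 = 0" and mono: "strict_mono_on {0..m} t" and J: "J \<subseteq> {1..m}" "J \<noteq> {}"
  shows "AE \<omega> in M. cond_prob_of M G (\<Inter>j\<in>J. (\<lambda>\<omega>. N (t j) \<omega> - N (t (j - 1)) \<omega>) -` B j \<inter> space M) \<omega> =
    (\<Prod>j\<in>J. measure (poisson_law (t j - t (j - 1)) (\<Psi> \<omega>)) (B j))"
proof -
  define B' where "B' = (\<lambda>j. if j \<in> J then B j else UNIV)"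
  let ?xs = "map (\<lambda>j. (t j - t (j - 1), B' j)) [1..<Suc m]"
  let ?E = "\<Inter>j\<in>J. (\<lambda>\<omega>. N (t j) \<omega> - N (t (j - 1)) \<omega>) -` B j \<inter> space M"
  let ?E' = "{\<omega>\<in>space M. increments_in ?xs (gaps N \<omega>)}"
  have less: "t i < t j" if "i < j" "j \<le> m" for i j
    using mono that by (auto simp: strict_mono_on_def)
  have nn: "0 \<le> t i" if "i \<le> m" for i
    using less[of 0 i] that t0 by (cases "i = 0") auto
  have E': "?E' \<in> events" by measurable
  have finJ: "finite J" using J(1) by (rule finite_subset) simp
  have E: "?E \<in> events"
  proof (rule sets.finite_INT[OF finJ J(2)])
    fix j assume "j \<in> J"
    then have "j \<le> m" using J(1) by auto
    then have "0 \<le> t (j - 1)" "0 \<le> t j" by (auto intro!: nn)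
    from measurable_sets[OF measurable_count_increment[OF cp this]]
    show "(\<lambda>\<omega>. N (t j) \<omega> - N (t (j - 1)) \<omega>) -` B j \<inter> space M \<in> events" by simp
  qed
  have "AE \<omega> in M. \<forall>j\<in>{..m}. N (t j) \<omega> \<noteq> \<infinity>"
    by (intro AE_finite_allI AE_count_finite nn) auto
  then have "AE \<omega> in M. indicat_real ?E \<omega> = indicat_real ?E' \<omega>"
    using AE_space
  proof eventually_elim
    case (elim \<omega>)
    have "\<omega> \<in> ?E' \<longleftrightarrow> (\<forall>j\<in>{1..m}. N (t j) \<omega> - N (t (j - 1)) \<omega> \<in> B' j)"
      using increments_in_iff[OF cp elim(2) t0 mono, of B'] elim by (simp del: upt_Suc)
    also have "\<dots> \<longleftrightarrow> \<omega> \<in> ?E" using J elim(2) by (auto simp: B'_def)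
    finally show ?case by (simp add: indicator_def)
  qed
  then have "AE \<omega> in M. cond_prob_of M G ?E \<omega> = cond_prob_of M G ?E' \<omega>"
    by (rule G.real_cond_exp_cong[OF _ borel_measurable_indicator[OF E] borel_measurable_indicator[OF E']])
  moreover have "AE \<omega> in M. cond_prob_of M G ?E' \<omega> = (\<Prod>(u, B)\<leftarrow>?xs. measure (poisson_law u (\<Psi> \<omega>)) B)"
    using less by (intro cond_prob_increments_in) auto
  ultimately show ?thesis
  proof eventually_elim
    case (elim \<omega>)
    have "(\<Prod>(u, B)\<leftarrow>?xs. measure (poisson_law u (\<Psi> \<omega>)) B) =
        (\<Prod>j\<in>set [1..<Suc m]. measure (poisson_law (t j - t (j - 1)) (\<Psi> \<omega>)) (B' j))"
      by (subst prod.distinct_set_conv_list) (simp_all add: comp_def del: upt_Suc)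
    also have "\<dots> = (\<Prod>j\<in>J. measure (poisson_law (t j - t (j - 1)) (\<Psi> \<omega>)) (B j))"
    proof (rule prod.mono_neutral_cong_right)
      show "J \<subseteq> set [1..<Suc m]" using J(1) by auto
      show "\<forall>j\<in>set [1..<Suc m] - J. measure (poisson_law (t j - t (j - 1)) (\<Psi> \<omega>)) (B' j) = 1"
        using prob_space.prob_space[OF prob_space_poisson_law] by (auto simp: B'_def poisson_law_def)
    qed (auto simp: B'_def)
    finally show ?case using elim by simp
  qed
qed

lemma mixed_poisson_process: "mixed_poisson_process M N \<Psi>"
  unfolding mixed_poisson_process_def
proof (intro conjI allI impI)
  show "\<Psi> \<in> borel_measurable M" by simp
  show "prob {\<omega>\<in>space M. 0 < \<Psi> \<omega>} = 1"
    using \<Psi>_pos by (intro prob_eq_1[THEN iffD2]) auto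
  show "cond_indep_increments M N \<Psi>"
    unfolding cond_indep_increments_def
  proof (intro allI impI)
    fix m :: nat and t :: "nat \<Rightarrow> real"
    assume m: "1 \<le> m" and t0: "t 0 = 0" and mono: "strict_mono_on {0..m} t"
    have nn: "0 \<le> t i" if "i \<le> m" for i
      using strict_mono_onD[OF mono, of 0 i] that t0 by (cases "i = 0") auto
    let ?X = "\<lambda>j \<omega>. N (t j) \<omega> - N (t (j - 1)) \<omega>"
    show "cond_indep_vars M G (\<lambda>_. count_space UNIV) ?X {1..m}"
      unfolding cond_indep_vars_def
    proof (intro conjI ballI allI impI)
      fix j assume "j \<in> {1..m}"
      then show "?X j \<in> M \<rightarrow>\<^sub>M count_space UNIV"
        by (intro measurable_count_increment[OF cp] nn) auto
    next
      fix J B assume J: "J \<subseteq> {1..m}" "J \<noteq> {}" "finite J"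
      have "AE \<omega> in M. \<forall>j\<in>J. cond_prob_of M G (?X j -` B j \<inter> space M) \<omega> =
          measure (poisson_law (t j - t (j - 1)) (\<Psi> \<omega>)) (B j)"
      proof (rule AE_finite_allI[OF J(3)])
        fix j assume "j \<in> J"
        then show "AE \<omega> in M. cond_prob_of M G (?X j -` B j \<inter> space M) \<omega> =
            measure (poisson_law (t j - t (j - 1)) (\<Psi> \<omega>)) (B j)"
          using cond_prob_increments[OF t0 mono, of "{j}" B] J(1) by auto
      qed
      with cond_prob_increments[OF t0 mono J(1,2), of B]
      show "AE \<omega> in M. cond_prob_of M G (\<Inter>j\<in>J. ?X j -` B j \<inter> space M) \<omega> =
          (\<Prod>j\<in>J. cond_prob_of M G (?X j -` B j \<inter> space M) \<omega>)"
        by eventually_elim simp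
    qed
  qed
  fix t s :: real assume t: "0 \<le> t" and s: "0 < s"
  show "\<exists>\<kappa>. cond_distribution M G (count_space UNIV) (\<lambda>\<omega>. N (t + s) \<omega> - N t \<omega>) \<kappa> \<and>
      (AE \<omega> in restr_to_subalg M G. \<kappa> \<omega> = measure_pmf (map_pmf enat (poisson_pmf (s * \<Psi> \<omega>))))"
  proof (intro exI conjI)
    show "cond_distribution M G (count_space UNIV) (\<lambda>\<omega>. N (t + s) \<omega> - N t \<omega>) (\<lambda>\<omega>. poisson_law s (\<Psi> \<omega>))"
      unfolding cond_distribution_def
    proof (intro conjI ballI)
      fix B :: "enat set"
      show "(\<lambda>\<omega>. measure (poisson_law s (\<Psi> \<omega>)) B) \<in> borel_measurable G"
        by (rule measurable_compose[OF \<Psi>_measurable_G measurable_poisson_law[OF s]])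
      \<comment> \<open>The partition must start at 0 and end with the interval from t to t + s. If
        t = 0, strict monotonicity leaves room for one interval only.\<close>
      obtain \<tau> :: "nat \<Rightarrow> real" and m where \<tau>: "\<tau> 0 = 0" "strict_mono_on {0..m} \<tau>" "1 \<le> m" "\<tau> m = t + s" "\<tau> (m - 1) = t"
      proof (cases "t = 0")
        case True
        with s show ?thesis
          by (intro that[of "\<lambda>i. if i = 0 then 0 else s" 1]) (auto simp: strict_mono_on_def)
      next
        case False
        with s t show ?thesis
          by (intro that[of "\<lambda>i. if i = 0 then 0 else if i = 1 then t else t + s" 2])
            (auto simp: strict_mono_on_def)
      qed
      have "AE \<omega> in M. cond_prob_of M G ((\<lambda>\<omega>. N (t + s) \<omega> - N t \<omega>) -` B \<inter> space M) \<omega> = measure (poisson_law s (\<Psi> \<omega>)) B"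
        using cond_prob_increments[OF \<tau>(1,2), of "{m}" "\<lambda>_. B"] \<tau>(3) by (simp add: \<tau>(4) \<tau>(5)[simplified])
      then show "AE \<omega> in M. measure (poisson_law s (\<Psi> \<omega>)) B = cond_prob_of M G ((\<lambda>\<omega>. N (t + s) \<omega> - N t \<omega>) -` B \<inter> space M) \<omega>"
        by eventually_elim simp
    qed (simp_all add: prob_space_poisson_law)
    have "AE \<omega> in restr_to_subalg M G. 0 < \<Psi> \<omega>"
    proof (rule AE_restr_to_subalg2[OF G.subalg \<Psi>_pos])
      note \<Psi>_measurable_G[measurable]
      show "Measurable.pred G (\<lambda>\<omega>. 0 < \<Psi> \<omega>)" by measurable
    qed
    then show "AE \<omega> in restr_to_subalg M G. poisson_law s (\<Psi> \<omega>) = measure_pmf (map_pmf enat (poisson_pmf (s * \<Psi> \<omega>)))"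
      by eventually_elim (rule poisson_law_pos)
  qed
qed

end

section \<open>The multinomial property\<close>

text \<open>The interval lengths telescope in the exponent, and each power is rescaled by t m. The
  multinomial factor is free of r, so it can be taken out of an expectation over a random
  rate.\<close>

lemma poisson_weight_split:
  fixes t :: "nat \<Rightarrow> real"
  assumes "t 0 = 0" "0 < t m"
  shows "(\<Prod>j=1..m. poisson_weight ((t j - t (j - 1)) * r) (k j)) =
    fact (\<Sum>j=1..m. k j) / (\<Prod>j=1..m. fact (k j)) * (\<Prod>j=1..m. ((t j - t (j - 1)) / t m) ^ k j) *
      poisson_weight (t m * r) (\<Sum>j=1..m. k j)"
proof -
  have tele: "(\<Sum>j=1..m. t j - t (j - 1)) = t m"
    using assms(1) by (induction m) simp_all
  have "exp (- (t m * r)) = (\<Prod>j=1..m. exp (- ((t j - t (j - 1)) * r)))"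
    by (simp add: tele[symmetric] sum_distrib_right sum_negf[symmetric] exp_sum)
  moreover have "(t m * r) ^ (\<Sum>j=1..m. k j) = (\<Prod>j=1..m. (t m * r) ^ k j)"
    by (simp add: power_sum)
  moreover have "(\<Prod>j=1..m. ((t j - t (j - 1)) * r) ^ k j) =
      (\<Prod>j=1..m. ((t j - t (j - 1)) / t m) ^ k j) * (\<Prod>j=1..m. (t m * r) ^ k j)"
    unfolding prod.distrib[symmetric] power_mult_distrib[symmetric] using assms(2) by simp
  ultimately show ?thesis
    by (simp add: prod.distrib prod_dividef)
qed

text \<open>Given \<Psi> the increments have a product of Poisson weights as conditional
  probability; \<open>poisson_weight_split\<close> isolates the random rate in the weight of the
  total.\<close>

lemma (in prob_space) mixed_poisson_imp_multinomial:
  assumes cp: "counting_process M N" and mpp: "mixed_poisson_process M N \<Psi>"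
  shows "multinomial_property M N"
proof -
  let ?G = "generated_sigma M \<Psi>"
  have \<Psi>[measurable]: "\<Psi> \<in> borel_measurable M" using mpp by (simp add: mixed_poisson_process_def)
  interpret G: sigma_finite_subalgebra M ?G by (rule sigma_finite_generated[OF \<Psi>])
  have "prob {\<omega>\<in>space M. 0 < \<Psi> \<omega>} = 1" using mpp by (simp add: mixed_poisson_process_def)
  moreover have "{\<omega>\<in>space M. 0 < \<Psi> \<omega>} \<in> events" by measurable
  ultimately have "AE \<omega> in M. \<omega> \<in> {\<omega>\<in>space M. 0 < \<Psi> \<omega>}"
    using AE_in_set_eq_1 by blast
  then have \<Psi>_pos: "AE \<omega> in M. 0 < \<Psi> \<omega>" by eventually_elim simp
  have cond: "AE \<omega> in M. cond_prob_of M ?G ((\<lambda>\<omega>. N t \<omega> - N s \<omega>) -` {enat k} \<inter> space M) \<omega> =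
      poisson_weight ((t - s) * \<Psi> \<omega>) k" if st: "0 \<le> s" "s < t" for s t k
  proof -
    have "t = s + (t - s)" by simp
    then obtain \<kappa> where \<kappa>: "cond_distribution M ?G (count_space UNIV) (\<lambda>\<omega>. N t \<omega> - N s \<omega>) \<kappa>"
      and eq: "AE \<omega> in restr_to_subalg M ?G. \<kappa> \<omega> = measure_pmf (map_pmf enat (poisson_pmf ((t - s) * \<Psi> \<omega>)))"
      using mpp[unfolded mixed_poisson_process_def, THEN conjunct2, THEN conjunct2, THEN conjunct2,
          rule_format, of s "t - s"] st by auto
    have "AE \<omega> in M. measure (\<kappa> \<omega>) {enat k} = cond_prob_of M ?G ((\<lambda>\<omega>. N t \<omega> - N s \<omega>) -` {enat k} \<inter> space M) \<omega>"
      using \<kappa> unfolding cond_distribution_def by simp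
    with AE_restr_to_subalg[OF G.subalg eq] \<Psi>_pos show ?thesis
    proof eventually_elim
      case (elim \<omega>)
      have "enat -` {enat k} = {k}" by auto
      then have "measure (measure_pmf (map_pmf enat (poisson_pmf ((t - s) * \<Psi> \<omega>)))) {enat k} =
          pmf (poisson_pmf ((t - s) * \<Psi> \<omega>)) k"
        by (simp add: pmf.rep_eq)
      then show ?case using elim st by simp
    qed
  qed
  have prob_eq: "prob E = (\<integral>\<omega>. f \<omega> \<partial>M)"
    if E: "E \<in> events" and f: "AE \<omega> in M. cond_prob_of M ?G E \<omega> = f \<omega>" "f \<in> borel_measurable M" for E f
  proof -
    have int: "integrable M (indicat_real E)"
      by (rule integrable_real_indicator[OF E]) (simp only: emeasure_eq_measure ennreal_less_top infinity_ennreal_def)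
    have "prob E = (\<integral>\<omega>. indicat_real E \<omega> \<partial>M)"
      using sets.sets_into_space[OF E] by (simp add: Int_absorb2)
    also have "\<dots> = (\<integral>\<omega>. cond_prob_of M ?G E \<omega> \<partial>M)"
      by (rule G.real_cond_exp_int(2)[OF int, symmetric])
    also have "\<dots> = (\<integral>\<omega>. f \<omega> \<partial>M)"
      by (rule integral_cong_AE) (use f in auto)
    finally show ?thesis .
  qed
  show ?thesis
    unfolding multinomial_property_def
  proof (intro allI impI)
    fix m :: nat and t :: "nat \<Rightarrow> real" and k :: "nat \<Rightarrow> nat"
    assume m: "1 \<le> m" and t0: "t 0 = 0" and mono: "strict_mono_on {0..m} t"
    have nn: "0 \<le> t i" if "i \<le> m" for i
      using strict_mono_onD[OF mono, of 0 i] that t0 by (cases "i = 0") auto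
    have tm: "0 < t m" using strict_mono_onD[OF mono, of 0 m] m t0 by auto
    have step: "t (j - 1) < t j" if "j \<in> {1..m}" for j
      using strict_mono_onD[OF mono, of "j - 1" j] that by auto
    define n where "n = (\<Sum>j=1..m. k j)"
    let ?X = "\<lambda>j \<omega>. N (t j) \<omega> - N (t (j - 1)) \<omega>"
    let ?E = "\<Inter>j\<in>{1..m}. ?X j -` {enat (k j)} \<inter> space M"
    have ci: "cond_indep_vars M ?G (\<lambda>_. count_space UNIV) ?X {1..m}"
      using mpp m t0 mono by (simp add: mixed_poisson_process_def cond_indep_increments_def)
    have "AE \<omega> in M. cond_prob_of M ?G ?E \<omega> = (\<Prod>j\<in>{1..m}. cond_prob_of M ?G (?X j -` {enat (k j)} \<inter> space M) \<omega>)"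
      using ci[unfolded cond_indep_vars_def, THEN conjunct2, rule_format, of "{1..m}" "\<lambda>j. {enat (k j)}"] m by simp
    moreover have "AE \<omega> in M. \<forall>j\<in>{1..m}. cond_prob_of M ?G (?X j -` {enat (k j)} \<inter> space M) \<omega> =
        poisson_weight ((t j - t (j - 1)) * \<Psi> \<omega>) (k j)"
      by (intro AE_finite_allI cond step nn) auto
    ultimately have AE_E: "AE \<omega> in M. cond_prob_of M ?G ?E \<omega> =
        (\<Prod>j=1..m. poisson_weight ((t j - t (j - 1)) * \<Psi> \<omega>) (k j))"
      by eventually_elim simp
    have Em: "?E \<in> events"
    proof (rule sets.finite_INT)
      fix j assume "j \<in> {1..m}"
      then have "?X j \<in> M \<rightarrow>\<^sub>M count_space UNIV" using ci by (simp add: cond_indep_vars_def)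
      from measurable_sets[OF this, of "{enat (k j)}"]
      show "?X j -` {enat (k j)} \<inter> space M \<in> events" by simp
    qed (use m in auto)
    let ?c = "fact n / (\<Prod>j=1..m. fact (k j)) * (\<Prod>j=1..m. ((t j - t (j - 1)) / t m) ^ k j) :: real"
    have "prob ?E = (\<integral>\<omega>. (\<Prod>j=1..m. poisson_weight ((t j - t (j - 1)) * \<Psi> \<omega>) (k j)) \<partial>M)"
      by (rule prob_eq[OF Em AE_E]) measurable
    also have "\<dots> = (\<integral>\<omega>. ?c * poisson_weight (t m * \<Psi> \<omega>) n \<partial>M)"
      unfolding poisson_weight_split[OF t0 tm] n_def ..
    also have "\<dots> = ?c * (\<integral>\<omega>. poisson_weight (t m * \<Psi> \<omega>) n \<partial>M)"
      by (rule integral_mult_right_zero)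
    \<comment> \<open>Since N 0 = 0, the total is itself an increment, and its law follows from the
      same conditional formula.\<close>
    also have "(\<integral>\<omega>. poisson_weight (t m * \<Psi> \<omega>) n \<partial>M) = prob ((\<lambda>\<omega>. N (t m) \<omega> - N 0 \<omega>) -` {enat n} \<inter> space M)"
    proof (rule prob_eq[symmetric])
      show "(\<lambda>\<omega>. N (t m) \<omega> - N 0 \<omega>) -` {enat n} \<inter> space M \<in> events"
        using measurable_sets[OF measurable_count_increment[OF cp order_refl nn[OF order_refl]], of "{enat n}"] by simp
      show "AE \<omega> in M. cond_prob_of M ?G ((\<lambda>\<omega>. N (t m) \<omega> - N 0 \<omega>) -` {enat n} \<inter> space M) \<omega> =
          poisson_weight (t m * \<Psi> \<omega>) n"
        using cond[of 0 "t m" n] tm by simp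
    qed measurable
    also have "(\<lambda>\<omega>. N (t m) \<omega> - N 0 \<omega>) -` {enat n} \<inter> space M = {\<omega>\<in>space M. N (t m) \<omega> = enat n}"
      using counting_processD(2)[OF cp] by auto
    also have "?E = {\<omega>\<in>space M. \<forall>j\<in>{1..m}. ?X j \<omega> = enat (k j)}"
      using m by auto
    finally show "let n = (\<Sum>j=1..m. k j) in
        prob {\<omega>\<in>space M. \<forall>j\<in>{1..m}. N (t j) \<omega> - N (t (j - 1)) \<omega> = enat (k j)} =
        fact n / (\<Prod>j=1..m. fact (k j)) * (\<Prod>j=1..m. ((t j - t (j - 1)) / t m) ^ k j) *
        prob {\<omega>\<in>space M. N (t m) \<omega> = enat n}"
      by (simp only: Let_def n_def)
  qed
qed

text \<open>Because n is increasing, truncated subtraction is exact, and prescribing values is the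
  same as prescribing increments.\<close>

lemma multinomial_path_probability:
  fixes t :: "nat \<Rightarrow> real" and n :: "nat \<Rightarrow> nat"
  assumes cp: "counting_process M N" and mult: "multinomial_property M N"
    and m: "1 \<le> m" and t0: "t 0 = 0" and mono: "strict_mono_on {0..m} t"
    and n0: "n 0 = 0" and n_mono: "\<And>j. j \<in> {1..m} \<Longrightarrow> n (j - 1) \<le> n j"
  shows "measure M {\<omega>\<in>space M. \<forall>j\<in>{1..m}. N (t j) \<omega> = enat (n j)} =
    fact (n m) / (\<Prod>j=1..m. fact (n j - n (j - 1))) *
    (\<Prod>j=1..m. ((t j - t (j - 1)) / t m) ^ (n j - n (j - 1))) *
    measure M {\<omega>\<in>space M. N (t m) \<omega> = enat (n m)}"
proof -
  let ?k = "\<lambda>j. n j - n (j - 1)"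
  have sum: "(\<Sum>j=1..i. ?k j) = n i" if "i \<le> m" for i
    using that
  proof (induction i)
    case (Suc i)
    then show ?case using n_mono[of "Suc i"] by simp
  qed (simp add: n0)
  have "(\<forall>j\<in>{1..m}. N (t j) \<omega> = enat (n j)) \<longleftrightarrow> (\<forall>j\<in>{1..m}. N (t j) \<omega> - N (t (j - 1)) \<omega> = enat (?k j))"
    if \<omega>: "\<omega> \<in> space M" for \<omega>
  proof
    assume *: "\<forall>j\<in>{1..m}. N (t j) \<omega> = enat (n j)"
    have "N (t i) \<omega> = enat (n i)" if "i \<le> m" for i
      using * that n0 t0 counting_processD(2)[OF cp \<omega>] by (cases "i = 0") (auto simp: zero_enat_def)
    then show "\<forall>j\<in>{1..m}. N (t j) \<omega> - N (t (j - 1)) \<omega> = enat (?k j)" by auto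
  next
    assume *: "\<forall>j\<in>{1..m}. N (t j) \<omega> - N (t (j - 1)) \<omega> = enat (?k j)"
    \<comment> \<open>An infinite value after a finite one would make the increment infinite, so the
      values are recovered successively from N 0 = 0.\<close>
    have "N (t i) \<omega> = enat (n i)" if "i \<le> m" for i
      using that
    proof (induction i)
      case 0
      then show ?case using n0 t0 counting_processD(2)[OF cp \<omega>] by (simp add: zero_enat_def)
    next
      case (Suc i)
      have "0 \<le> t i" "t i \<le> t (Suc i)"
        using strict_mono_onD[OF mono, of 0 i] strict_mono_onD[OF mono, of i "Suc i"] Suc.prems t0
        by (cases "i = 0"; simp)+
      then have "N (t i) \<omega> \<le> N (t (Suc i)) \<omega>" by (rule counting_processD(3)[OF cp \<omega>])
      moreover have "N (t (Suc i)) \<omega> - N (t i) \<omega> = enat (n (Suc i) - n i)"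
        using *[rule_format, of "Suc i"] Suc.prems by simp
      ultimately show ?case
        using Suc.IH Suc.prems n_mono[of "Suc i"] by (cases "N (t (Suc i)) \<omega>") auto
    qed
    then show "\<forall>j\<in>{1..m}. N (t j) \<omega> = enat (n j)" by simp
  qed
  then have "{\<omega>\<in>space M. \<forall>j\<in>{1..m}. N (t j) \<omega> = enat (n j)} =
      {\<omega>\<in>space M. \<forall>j\<in>{1..m}. N (t j) \<omega> - N (t (j - 1)) \<omega> = enat (?k j)}" by blast
  then show ?thesis
    using mult[unfolded multinomial_property_def Let_def, rule_format, OF m t0 mono, of ?k]
    unfolding sum[OF order_refl] by simp
qed

text \<open>The multinomial factor of the path up to t (m + 1) is that of the path up to t m times
  that of the two-step path through t m. The first cancels in the conditional probability, so the
  earlier past disappears.\<close>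

lemma (in prob_space) multinomial_imp_markov:
  assumes cp: "counting_process M N" and mult: "multinomial_property M N"
  shows "markov_property M N"
  unfolding markov_property_def
proof (intro allI impI)
  fix m :: nat and t :: "nat \<Rightarrow> real" and n :: "nat \<Rightarrow> nat"
  assume m: "1 \<le> m" and t1: "0 < t 1" and mono: "strict_mono_on {1..m + 1} t"
    and pos: "0 < \<P>(\<omega> in M. \<forall>j\<in>{1..m}. N (t j) \<omega> = enat (n j))"
  have less: "t i < t j" if "1 \<le> i" "i < j" "j \<le> m + 1" for i j
    using strict_mono_onD[OF mono, of i j] that by auto
  have tpos: "0 < t i" if "1 \<le> i" "i \<le> m + 1" for i
    using t1 less[of 1 i] that by (cases "i = 1") auto
  \<comment> \<open>The Markov property leaves index 0 unspecified, whereas the multinomial property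
    starts with time 0 and count 0.\<close>
  define s where "s = (\<lambda>j. if j = 0 then 0 else t j)"
  define r where "r = (\<lambda>j. if j = 0 then 0 else n j)"
  have s: "s 0 = 0" "strict_mono_on {0..m + 1} s" and r0: "r 0 = 0"
    using less tpos by (auto simp: s_def r_def strict_mono_on_def)
  have sm: "strict_mono_on {0..m} s" using s(2) by (auto simp: strict_mono_on_def)
  let ?Em = "{\<omega>\<in>space M. \<forall>j\<in>{1..m}. N (t j) \<omega> = enat (n j)}"
  \<comment> \<open>A path in this event witnesses that the prescribed counts increase.\<close>
  have "?Em \<noteq> {}" using pos by (metis less_irrefl measure_empty)
  then obtain \<omega> where \<omega>: "\<omega> \<in> space M" "\<And>j. j \<in> {1..m} \<Longrightarrow> N (t j) \<omega> = enat (n j)" by blast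
  have r_mono: "r (j - 1) \<le> r j" if "j \<in> {1..m}" for j
  proof (cases "j = 1")
    case False
    then have j: "1 \<le> j - 1" "j - 1 < j" "j - 1 \<le> m + 1" "j \<le> m + 1" using that by auto
    have "N (t (j - 1)) \<omega> \<le> N (t j) \<omega>"
      using less[OF j(1,2,4)] tpos[OF j(1,3)] by (intro counting_processD(3)[OF cp \<omega>(1)]) simp_all
    then show ?thesis using \<omega>(2)[of j] \<omega>(2)[of "j - 1"] that j False by (auto simp: r_def)
  qed (simp add: r_def)
  show "\<P>(\<omega> in M. N (t (m + 1)) \<omega> = enat (n (m + 1)) \<bar> \<forall>j\<in>{1..m}. N (t j) \<omega> = enat (n j)) =
      \<P>(\<omega> in M. N (t (m + 1)) \<omega> = enat (n (m + 1)) \<bar> N (t m) \<omega> = enat (n m))"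
  proof (cases "n m \<le> n (m + 1)")
    case False
    have "\<not> (N (t (m + 1)) \<omega> = enat (n (m + 1)) \<and> N (t m) \<omega> = enat (n m))" if "\<omega> \<in> space M" for \<omega>
      using counting_processD(3)[OF cp that, of "t m" "t (m + 1)"] less[of m "m + 1"] tpos[of m] m False by auto
    moreover have "m \<in> {1..m}" using m by simp
    ultimately have "{\<omega>\<in>space M. N (t (m + 1)) \<omega> = enat (n (m + 1)) \<and> N (t m) \<omega> = enat (n m)} = {}"
      "{\<omega>\<in>space M. N (t (m + 1)) \<omega> = enat (n (m + 1)) \<and> (\<forall>j\<in>{1..m}. N (t j) \<omega> = enat (n j))} = {}"
      by blast+
    then show ?thesis unfolding cond_prob_def by (simp only: measure_empty)
  next
    case True
    define k where "k = n (m + 1) - n m"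
    let ?Q = "prob {\<omega>\<in>space M. N (t m) \<omega> = enat (n m)}"
    let ?R = "prob {\<omega>\<in>space M. N (t (m + 1)) \<omega> = enat (n (m + 1))}"
    \<comment> \<open>c is the multinomial factor of the path up to t m, and d that of the path 0, t
      m, t (m + 1).\<close>
    define c where "c = fact (n m) / (\<Prod>j=1..m. fact (r j - r (j - 1))) *
      (\<Prod>j=1..m. ((s j - s (j - 1)) / t m) ^ (r j - r (j - 1)))"
    define d where "d = fact (n (m + 1)) / (fact (n m) * fact k) *
      ((t m / t (m + 1)) ^ n m * ((t (m + 1) - t m) / t (m + 1)) ^ k)"
    have r_mono': "r (j - 1) \<le> r j" if "j \<in> {1..m + 1}" for j
      using r_mono[of j] that True m by (cases "j = m + 1") (auto simp: r_def)
    have ends: "s m = t m" "r m = n m" "s (m + 1) = t (m + 1)" "r (m + 1) = n (m + 1)"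
      using m by (auto simp: s_def r_def)
    have ev: "{\<omega>\<in>space M. \<forall>j\<in>{1..i}. N (s j) \<omega> = enat (r j)} = {\<omega>\<in>space M. \<forall>j\<in>{1..i}. N (t j) \<omega> = enat (n j)}" for i
      by (auto simp: s_def r_def)
    have Pm: "prob ?Em = c * ?Q"
      using multinomial_path_probability[OF cp mult m s(1) sm r0 r_mono]
      unfolding ev ends c_def by simp
    have sum_r: "(\<Sum>j=1..i. r j - r (j - 1)) = r i" if "i \<le> m" for i
      using that
    proof (induction i)
      case (Suc i)
      then show ?case using r_mono[of "Suc i"] by simp
    qed (simp add: r0)
    \<comment> \<open>The exponents add up to n m, so changing the denominator from t m to t (m + 1)
      contributes this single power.\<close>
    have rescale: "(\<Prod>j=1..m. ((s j - s (j - 1)) / t (m + 1)) ^ (r j - r (j - 1))) =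
        (\<Prod>j=1..m. ((s j - s (j - 1)) / t m) ^ (r j - r (j - 1))) * (t m / t (m + 1)) ^ n m"
    proof -
      have "(t m / t (m + 1)) ^ n m = (\<Prod>j=1..m. (t m / t (m + 1)) ^ (r j - r (j - 1)))"
        using sum_r[of m] by (simp add: power_sum[symmetric] ends)
      then show ?thesis
        using tpos[of m] m by (simp add: prod.distrib[symmetric] power_mult_distrib[symmetric])
    qed
    have "prob {\<omega>\<in>space M. \<forall>j\<in>{1..m + 1}. N (t j) \<omega> = enat (n j)} =
        fact (n (m + 1)) / (\<Prod>j=1..m + 1. fact (r j - r (j - 1))) *
        (\<Prod>j=1..m + 1. ((s j - s (j - 1)) / t (m + 1)) ^ (r j - r (j - 1))) * ?R"
      using multinomial_path_probability[OF cp mult _ s r0 r_mono'] unfolding ev ends by simp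
    also have "\<dots> = c * d * ?R"
    proof -
      have last: "r (Suc m) - r (Suc m - 1) = k" "s (Suc m) - s (Suc m - 1) = t (m + 1) - t m"
        using ends by (simp_all add: k_def)
      have "(\<Prod>j=1..m + 1. fact (r j - r (j - 1))) = (\<Prod>j=1..m. fact (r j - r (j - 1))) * (fact k :: real)"
        using last by simp
      moreover have "(\<Prod>j=1..m + 1. ((s j - s (j - 1)) / t (m + 1)) ^ (r j - r (j - 1))) =
          (\<Prod>j=1..m. ((s j - s (j - 1)) / t m) ^ (r j - r (j - 1))) * (t m / t (m + 1)) ^ n m *
          ((t (m + 1) - t m) / t (m + 1)) ^ k"
        using last rescale by simp
      ultimately show ?thesis by (simp add: c_def d_def)
    qed
    finally have Pm1: "prob {\<omega>\<in>space M. \<forall>j\<in>{1..m + 1}. N (t j) \<omega> = enat (n j)} = c * d * ?R" .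
    let ?s = "\<lambda>j::nat. if j = 0 then 0 else if j = 1 then t m else t (m + 1)"
    let ?r = "\<lambda>j::nat. if j = 0 then 0 else if j = 1 then n m else n (m + 1)"
    have two: "{1..2::nat} = {1, 2}" by auto
    have "prob {\<omega>\<in>space M. \<forall>j\<in>{1..2}. N (?s j) \<omega> = enat (?r j)} =
      fact (?r 2) / (\<Prod>j=1..2. fact (?r j - ?r (j - 1))) *
      (\<Prod>j=1..2. ((?s j - ?s (j - 1)) / ?s 2) ^ (?r j - ?r (j - 1))) *
      prob {\<omega>\<in>space M. N (?s 2) \<omega> = enat (?r 2)}"
    proof (rule multinomial_path_probability[OF cp mult])
      show "strict_mono_on {0..2} ?s"
        using tpos[of m] tpos[of "m + 1"] less[of m "m + 1"] m by (auto simp: strict_mono_on_def)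
      fix j :: nat assume "j \<in> {1..2}"
      then show "?r (j - 1) \<le> ?r j" using True by auto
    qed simp_all
    then have P2: "prob {\<omega>\<in>space M. N (t m) \<omega> = enat (n m) \<and> N (t (m + 1)) \<omega> = enat (n (m + 1))} = d * ?R"
      unfolding two by (simp add: d_def k_def)
    have c: "c \<noteq> 0" and Q: "?Q \<noteq> 0" using pos unfolding Pm by auto
    have E1: "{\<omega>\<in>space M. N (t (m + 1)) \<omega> = enat (n (m + 1)) \<and> (\<forall>j\<in>{1..m}. N (t j) \<omega> = enat (n j))} =
        {\<omega>\<in>space M. \<forall>j\<in>{1..m + 1}. N (t j) \<omega> = enat (n j)}"
    proof -
      have "{1..m + 1} = insert (m + 1) {1..m}" by auto
      then show ?thesis by simp
    qed
    have E2: "{\<omega>\<in>space M. N (t (m + 1)) \<omega> = enat (n (m + 1)) \<and> N (t m) \<omega> = enat (n m)} =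
        {\<omega>\<in>space M. N (t m) \<omega> = enat (n m) \<and> N (t (m + 1)) \<omega> = enat (n (m + 1))}"
      by auto
    show ?thesis
      unfolding cond_prob_def E1 E2 Pm Pm1 P2 using c Q by simp
  qed
qed

section \<open>Equivalence of the multinomial, Markov and mixed Poisson properties\<close>

theorem proposition2p7:
  fixes M :: "'a measure" and N :: "real \<Rightarrow> 'a \<Rightarrow> enat"
  assumes "prob_space M" and "counting_process M N"
  shows
    "(\<forall>\<Theta>'\<in>borel_measurable M.
        (mixed_poisson_process M N \<Theta>' \<longrightarrow> multinomial_property M N) \<and>
        (multinomial_property M N \<longrightarrow> markov_property M N))
   \<and> (\<forall>(\<Theta> :: 'a \<Rightarrow> real ^ 'd) (K :: real ^ 'd \<Rightarrow> real measure) (D :: real ^ 'd \<Rightarrow> 'a measure)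
        (F :: real ^ 'd \<Rightarrow> real \<Rightarrow> real) (L :: (real ^ 'd) set) (C :: real ^ 'd \<Rightarrow> real)
        (p :: real ^ 'd \<Rightarrow> real) (\<Theta>' :: 'a \<Rightarrow> real).
        \<Theta> \<in> borel_measurable M \<longrightarrow>
        K \<in> borel \<rightarrow>\<^sub>M prob_algebra borel \<longrightarrow>
        mixed_renewal_process M N \<Theta> K \<longrightarrow>
        disintegration M \<Theta> D \<longrightarrow>
        consistent_with M \<Theta> D \<longrightarrow>
        (\<forall>n\<ge>1. \<forall>\<theta>. distr (D \<theta>) borel (interarrival N n) = K \<theta>) \<longrightarrow>
        (\<forall>n\<ge>1. \<forall>\<theta>. \<forall>t\<ge>0. F \<theta> t = measure (D \<theta>) {\<omega>\<in>space M. interarrival N n \<omega> \<le> t}) \<longrightarrow>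
        L \<in> null_sets (distr M borel \<Theta>) \<longrightarrow>
        integrable (distr M borel \<Theta>) C \<longrightarrow>
        (\<forall>\<theta>. \<theta> \<notin> L \<longrightarrow>
           F \<theta> C1_differentiable_on {0<..} \<and>
           (\<forall>t>0. 0 < deriv (F \<theta>) t \<and> deriv (F \<theta>) t < C \<theta>) \<and>
           (deriv (F \<theta>) \<longlongrightarrow> p \<theta>) (at_right 0) \<and>
           0 < p \<theta>) \<longrightarrow>
        inj_on p (- L) \<longrightarrow>
        \<Theta>' \<in> borel_measurable M \<longrightarrow>
        (\<forall>\<omega>\<in>space M. \<Theta> \<omega> \<notin> L \<longrightarrow> \<Theta>' \<omega> = p (\<Theta> \<omega>)) \<longrightarrow>
        (multinomial_property M N \<longleftrightarrow> markov_property M N) \<and>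
        (markov_property M N \<longleftrightarrow> mixed_poisson_process M N \<Theta>'))"
proof -
  interpret prob_space M by fact
  note cp = \<open>counting_process M N\<close>
  have i_ii: "multinomial_property M N \<Longrightarrow> markov_property M N"
    by (rule multinomial_imp_markov[OF cp])
  have iii_i: "mixed_poisson_process M N \<Psi> \<Longrightarrow> multinomial_property M N" for \<Psi>
    by (rule mixed_poisson_imp_multinomial[OF cp])
  have ii_iii: "mixed_poisson_process M N \<Theta>'"
    if mp: "markov_property M N" and \<Theta>: "\<Theta> \<in> borel_measurable M" and K: "K \<in> borel \<rightarrow>\<^sub>M prob_algebra borel"
      and mrp: "mixed_renewal_process M N \<Theta> K" and D: "disintegration M \<Theta> D"
      and DK: "\<forall>n\<ge>1. \<forall>\<theta>. distr (D \<theta>) borel (interarrival N n) = K \<theta>"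
      and F: "\<forall>n\<ge>1. \<forall>\<theta>. \<forall>t\<ge>0. F \<theta> t = measure (D \<theta>) {\<omega>\<in>space M. interarrival N n \<omega> \<le> t}"
      and L: "L \<in> null_sets (distr M borel \<Theta>)"
      and reg: "\<forall>\<theta>. \<theta> \<notin> L \<longrightarrow> F \<theta> C1_differentiable_on {0<..} \<and>
          (\<forall>t>0. 0 < deriv (F \<theta>) t \<and> deriv (F \<theta>) t < C \<theta>) \<and>
          (deriv (F \<theta>) \<longlongrightarrow> p \<theta>) (at_right 0) \<and> 0 < p \<theta>"
      and \<Theta>': "\<Theta>' \<in> borel_measurable M" "\<forall>\<omega>\<in>space M. \<Theta> \<omega> \<notin> L \<longrightarrow> \<Theta>' \<omega> = p (\<Theta> \<omega>)"
    for \<Theta> :: "'a \<Rightarrow> real ^ 'd" and K D F L and C :: "real ^ 'd \<Rightarrow> real" and p \<Theta>'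
  proof -
    have F1: "F \<theta> t = measure (D \<theta>) {\<omega>\<in>space M. interarrival N 1 \<omega> \<le> t}" if "0 \<le> t" for \<theta> t
      using F that by blast
    have FK: "F \<theta> t = measure (K \<theta>) {..t}" if "0 \<le> t" for \<theta> t
    proof -
      have sets: "sets (D \<theta>) = sets M" using D by (simp add: disintegration_def)
      have "interarrival N 1 \<in> D \<theta> \<rightarrow>\<^sub>M borel"
        using mixed_renewal_interarrival_measurable[OF mrp, of 0] measurable_cong_sets[OF sets refl] by auto
      then have "measure (distr (D \<theta>) borel (interarrival N 1)) {..t} =
          measure (D \<theta>) (interarrival N 1 -` {..t} \<inter> space (D \<theta>))"
        by (rule measure_distr) simp
      also have "interarrival N 1 -` {..t} \<inter> space (D \<theta>) = {\<omega>\<in>space M. interarrival N 1 \<omega> \<le> t}"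
        using sets_eq_imp_space_eq[OF sets] by auto
      also have "measure (D \<theta>) \<dots> = F \<theta> t" by (rule F1[OF that, symmetric])
      also have "distr (D \<theta>) borel (interarrival N 1) = K \<theta>" using DK by simp
      finally show ?thesis ..
    qed
    \<comment> \<open>Arrival times increase strictly on every path, so the event of a nonpositive
      gap is empty and has mass zero under each \<open>D \<theta>\<close>.\<close>
    have K0: "measure (K \<theta>) {..0} = 0" for \<theta>
    proof -
      have "{\<omega>\<in>space M. interarrival N 1 \<omega> \<le> 0} = {}"
        using interarrival_pos[OF cp, of _ 0] by force
      then have "F \<theta> 0 = 0" unfolding F1[OF order_refl] by (simp only: measure_empty)
      then show ?thesis using FK[of 0 \<theta>] by simp
    qed
    have notL: "AE \<omega> in M. \<Theta> \<omega> \<notin> L"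
      using AE_distrD[OF \<Theta> AE_not_in[OF L]] .
    have "AE \<omega> in M. K (\<Theta> \<omega>) = exponential_law (p (\<Theta> \<omega>))"
      by (rule markov_mixed_renewal_exponential[OF cp mp \<Theta> K mrp K0 FK notL]) (use reg in auto)
    then have "AE \<omega> in M. K (\<Theta> \<omega>) = exponential_law (\<Theta>' \<omega>)"
      using notL AE_space by eventually_elim (use \<Theta>'(2) in auto)
    moreover have "AE \<omega> in M. 0 < \<Theta>' \<omega>"
      using notL AE_space by eventually_elim (use \<Theta>'(2) reg in auto)
    ultimately interpret exponential_mixed_renewal M N \<Theta> K \<Theta>'
      using cp \<Theta> K mrp \<Theta>'(1) by unfold_locales
    show ?thesis by (rule mixed_poisson_process)
  qed
  show ?thesis
  proof (intro conjI ballI allI impI)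
    show "multinomial_property M N" if "mixed_poisson_process M N \<Psi>" for \<Psi>
      using that by (rule iii_i)
    show "markov_property M N" if "multinomial_property M N"
      using that by (rule i_ii)
  qed (use i_ii iii_i ii_iii in blast)+
qed

end
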